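(* Let $\hat{F}_\omega$ be the free profinite group of countable rank, and let $N\leq M\leq\hat{F}_\omega$ be closed subgroups such that $N$ is normal in $\hat{F}_\omega$ and $\hat{F}_\omega/N$ is of finite abelian-simple length. Then $M\cong\hat{F}_\omega$.
   Context: For a profinite group $G$, $D(G)$ is the intersection of all open normal subgroups $N$ with $G/N$ abelian or simple; $G^{(0)}=G$, $G^{(i+1)}=D(G^{(i)})$; the abelian-simple length of $G$ is the least $l$ with $G^{(l)}=1$ ($\infty$ if none exists), and $G$ is of finite abelian-simple length if this is finite. *)

theory Defs
  imports
    "HOL-Algebra.SimpleGroups"
    "HOL-Algebra.Generated_Groups"
    "HOL-Analysis.Analysis"
    "HOL-Library.Extended_Nat"
    "HOL-Library.Countable_Set"
begin

section \<open>Topological and profinite groups\<close>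

locale topological_group = group G for G (structure) +
  fixes T
  assumes topspace_eq: "topspace T = carrier G"
    and continuous_mult: "continuous_map (prod_topology T T) T (\<lambda>(x, y). x \<otimes> y)"
    and continuous_inv: "continuous_map T T (\<lambda>x. inv x)"

locale profinite_group = topological_group +
  assumes compact: "compact_space T"
    and Hausdorff: "Hausdorff_space T"
    and totally_disconnected: "\<lbrakk>connectedin T C; x \<in> C; y \<in> C\<rbrakk> \<Longrightarrow> x = y"

definition top_isomorphic ::
  "('a, 'm) monoid_scheme \<Rightarrow> 'a topology \<Rightarrow> ('b, 'n) monoid_scheme \<Rightarrow> 'b topology \<Rightarrow> bool" where
  "top_isomorphic G T H U \<longleftrightarrow> (\<exists>h\<in>iso G H. homeomorphic_map T U h)"

definition quotient_topology :: "'a topology \<Rightarrow> ('a \<Rightarrow> 'b) \<Rightarrow> 'b topology" where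
  "quotient_topology T f =
     topology (\<lambda>U. U \<subseteq> f ` topspace T \<and> openin T {x \<in> topspace T. f x \<in> U})"

lemma openin_quotient_topology:
  "openin (quotient_topology T f) U \<longleftrightarrow>
     U \<subseteq> f ` topspace T \<and> openin T {x \<in> topspace T. f x \<in> U}"
proof -
  have "istopology (\<lambda>U. U \<subseteq> f ` topspace T \<and> openin T {x \<in> topspace T. f x \<in> U})"
    unfolding istopology_def
  proof (intro conjI allI impI)
    fix A B
    assume "A \<subseteq> f ` topspace T \<and> openin T {x \<in> topspace T. f x \<in> A}"
      and "B \<subseteq> f ` topspace T \<and> openin T {x \<in> topspace T. f x \<in> B}"
    moreover have "{x \<in> topspace T. f x \<in> A \<inter> B} =
        {x \<in> topspace T. f x \<in> A} \<inter> {x \<in> topspace T. f x \<in> B}"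
      by auto
    ultimately show "A \<inter> B \<subseteq> f ` topspace T" "openin T {x \<in> topspace T. f x \<in> A \<inter> B}"
      by auto
  next
    fix \<K>
    assume K: "\<forall>K\<in>\<K>. K \<subseteq> f ` topspace T \<and> openin T {x \<in> topspace T. f x \<in> K}"
    then show "\<Union>\<K> \<subseteq> f ` topspace T" by auto
    have "{x \<in> topspace T. f x \<in> \<Union>\<K>} = \<Union>((\<lambda>K. {x \<in> topspace T. f x \<in> K}) ` \<K>)"
      by auto
    with K show "openin T {x \<in> topspace T. f x \<in> \<Union>\<K>}"
      by (metis (no_types, lifting) imageE openin_Union)
  qed
  then show ?thesis
    by (simp add: quotient_topology_def topology_inverse')
qed

lemma topspace_quotient_topology: "topspace (quotient_topology T f) = f ` topspace T"
proof -
  have "{x \<in> topspace T. f x \<in> f ` topspace T} = topspace T" by auto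
  then have "openin (quotient_topology T f) (f ` topspace T)"
    by (simp add: openin_quotient_topology)
  moreover have "topspace (quotient_topology T f) \<subseteq> f ` topspace T"
    using openin_topspace[of "quotient_topology T f"] unfolding openin_quotient_topology by blast
  ultimately show ?thesis
    using openin_subset by blast
qed

lemma quotient_map_quotient_topology: "quotient_map T (quotient_topology T f) f"
  by (simp add: quotient_map_def topspace_quotient_topology openin_quotient_topology)

text \<open>The topology of the quotient group \<^term>\<open>G Mod N\<close>.\<close>

definition coset_topology :: "('a, 'm) monoid_scheme \<Rightarrow> 'a topology \<Rightarrow> 'a set \<Rightarrow> 'a set topology" where
  "coset_topology G T N = quotient_topology T (\<lambda>x. N #>\<^bsub>G\<^esub> x)"


section \<open>Abelian-simple length\<close>

text \<open>
  \<^const>\<open>simple_group\<close> requires \<open>card (carrier G) > 1\<close>, which fails for infinite groups.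
  This is harmless here: an open subgroup of a compact group has finite index.
\<close>

definition abelian_simple_core :: "('a, 'm) monoid_scheme \<Rightarrow> 'a topology \<Rightarrow> 'a set" where
  "abelian_simple_core G T =
     \<Inter>{N. N \<lhd> G \<and> openin T N \<and> (comm_group (G Mod N) \<or> simple_group (G Mod N))}"

primrec abelian_simple_series :: "('a, 'm) monoid_scheme \<Rightarrow> 'a topology \<Rightarrow> nat \<Rightarrow> 'a set" where
  "abelian_simple_series G T 0 = carrier G"
| "abelian_simple_series G T (Suc i) =
     abelian_simple_core (G\<lparr>carrier := abelian_simple_series G T i\<rparr>)
       (subtopology T (abelian_simple_series G T i))"

text \<open>The infimum of the empty set is \<^term>\<open>\<infinity> :: enat\<close>.\<close>

definition abelian_simple_length :: "('a, 'm) monoid_scheme \<Rightarrow> 'a topology \<Rightarrow> enat" where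
  "abelian_simple_length G T = (INF l\<in>{l. abelian_simple_series G T l = {\<one>\<^bsub>G\<^esub>}}. enat l)"

lemma abelian_simple_length_finite_iff:
  "abelian_simple_length G T < \<infinity> \<longleftrightarrow> (\<exists>l. abelian_simple_series G T l = {\<one>\<^bsub>G\<^esub>})"
  unfolding abelian_simple_length_def INF_less_iff by simp


section \<open>Free profinite groups of countable rank\<close>

definition converges_to_one ::
  "('b, 'n) monoid_scheme \<Rightarrow> 'b topology \<Rightarrow> 'x set \<Rightarrow> ('x \<Rightarrow> 'b) \<Rightarrow> bool" where
  "converges_to_one G U X \<phi> \<longleftrightarrow> (\<forall>N. N \<lhd> G \<and> openin U N \<longrightarrow> finite {x \<in> X. \<phi> x \<notin> N})"

definition topologically_generates ::
  "('b, 'n) monoid_scheme \<Rightarrow> 'b topology \<Rightarrow> 'b set \<Rightarrow> bool" where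
  "topologically_generates G U S \<longleftrightarrow>
     S \<subseteq> carrier G \<and> U closure_of (generate G S) = carrier G"

definition unique_extension ::
  "('a, 'm) monoid_scheme \<Rightarrow> 'a topology \<Rightarrow> 'a set \<Rightarrow>
   ('b, 'n) monoid_scheme \<Rightarrow> 'b topology \<Rightarrow> ('a \<Rightarrow> 'b) \<Rightarrow> bool" where
  "unique_extension F T X G U \<phi> \<longleftrightarrow>
     (\<exists>!h. h \<in> extensional (carrier F) \<and> h \<in> hom F G \<and> continuous_map T U h \<and>
           (\<forall>x\<in>X. h x = \<phi> x))"

text \<open>
  \<open>X\<close> is a basis of \<open>F\<close> converging to \<open>1\<close>: every map from \<open>X\<close> to a profinite group \<open>G\<close> that
  converges to \<open>1\<close> and whose image topologically generates \<open>G\<close> extends uniquely to a continuous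
  homomorphism. A formula cannot quantify over all types, so the test groups \<open>G\<close> live on
  \<^typ>\<open>nat set set\<close>. For countable \<open>X\<close> this loses nothing: such a \<open>G\<close> has a countable dense subset
  and so injects into \<^typ>\<open>nat set set\<close>; lemma \<open>countable_basis_extension\<close> below derives the
  extension property for profinite groups over an arbitrary type. (It would be a real restriction
  for large uncountable \<open>X\<close>, hence \<^term>\<open>countable X\<close> is part of the definition.)
\<close>

definition countable_profinite_basis ::
  "('a, 'm) monoid_scheme \<Rightarrow> 'a topology \<Rightarrow> 'a set \<Rightarrow> bool" where
  "countable_profinite_basis F T X \<longleftrightarrow>
     countable X \<and> topologically_generates F T X \<and> converges_to_one F T X (\<lambda>x. x) \<and>
     (\<forall>(G :: nat set set monoid) U \<phi>.
        profinite_group G U \<and> topologically_generates G U (\<phi> ` X) \<and> converges_to_one G U X \<phi>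
        \<longrightarrow> unique_extension F T X G U \<phi>)"

text \<open>
  The free profinite group of countable rank, characterised up to isomorphism; as usual for
  \<open>F\<^sub>\<omega>\<close>, countable rank means rank \<open>\<aleph>\<^sub>0\<close>.
\<close>

definition free_profinite_omega :: "('a, 'm) monoid_scheme \<Rightarrow> 'a topology \<Rightarrow> bool" where
  "free_profinite_omega F T \<longleftrightarrow>
     profinite_group F T \<and> (\<exists>X. infinite X \<and> countable_profinite_basis F T X)"


subsection \<open>The extension property for arbitrary types\<close>

lemma (in group) countable_generate:
  assumes "countable S"
  shows "countable (generate G S)"
proof -
  define A where "A = rec_nat (insert \<one> (S \<union> (\<lambda>x. inv x) ` S))
    (\<lambda>_ B. B \<union> (\<lambda>(x, y). x \<otimes> y) ` (B \<times> B))"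
  have A0: "A 0 = insert \<one> (S \<union> (\<lambda>x. inv x) ` S)"
    and AS: "A (Suc n) = A n \<union> (\<lambda>(x, y). x \<otimes> y) ` (A n \<times> A n)" for n
    by (simp_all add: A_def)
  have cnt: "countable (A n)" for n
    by (induction n) (use assms in \<open>auto simp: A0 AS\<close>)
  have mono: "A m \<subseteq> A n" if "m \<le> n" for m n
    using that by (rule lift_Suc_mono_le[rotated]) (auto simp: AS)
  have "x \<in> (\<Union>n. A n)" if "x \<in> generate G S" for x
    using that
  proof induction
    case (eng h1 h2)
    then obtain m n where "h1 \<in> A m" "h2 \<in> A n" by blast
    then have "h1 \<in> A (max m n)" "h2 \<in> A (max m n)"
      using mono[of m "max m n"] mono[of n "max m n"] by auto
    then have "h1 \<otimes> h2 \<in> A (Suc (max m n))" by (force simp: AS)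
    then show ?case by blast
  qed (use A0 in blast)+
  then have "generate G S \<subseteq> (\<Union>n. A n)" by blast
  moreover have "countable (\<Union>n. A n)" using cnt by blast
  ultimately show ?thesis by (rule countable_subset)
qed

lemma separable_Hausdorff_inj:
  fixes U :: "'b topology"
  assumes "Hausdorff_space U" "countable D" "U closure_of D = topspace U"
  shows "\<exists>e :: 'b \<Rightarrow> nat set set. inj_on e (topspace U)"
proof -
  define k where "k = to_nat_on D"
  have k: "inj_on k D" using assms(2) by (simp add: k_def inj_on_to_nat_on)
  define e where "e = (\<lambda>x. {k ` (V \<inter> D) | V. openin U V \<and> x \<in> V})"
  have "x = y" if x: "x \<in> topspace U" and y: "y \<in> topspace U" and xy: "e x = e y" for x y
  proof (rule ccontr)
    assume "x \<noteq> y"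
    then obtain V W where V: "openin U V" "x \<in> V" and W: "openin U W" "y \<in> W"
      and VW: "disjnt V W"
      using assms(1) x y unfolding Hausdorff_space_def by meson
    have "k ` (V \<inter> D) \<in> e y" using V xy by (auto simp: e_def)
    then obtain V' where V': "openin U V'" "y \<in> V'" and "k ` (V \<inter> D) = k ` (V' \<inter> D)"
      by (auto simp: e_def)
    then have eq: "V \<inter> D = V' \<inter> D"
      using inj_on_image_eq_iff[OF k] by (meson inf_le2)
    have "y \<in> U closure_of D" using assms(3) y by simp
    moreover have "openin U (V' \<inter> W)" "y \<in> V' \<inter> W" using V' W by auto
    ultimately obtain d where "d \<in> D" "d \<in> V' \<inter> W"
      unfolding in_closure_of by meson
    then show False using eq VW by (auto simp: disjnt_def)
  qed
  then have "inj_on e (topspace U)" by (rule inj_onI)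
  then show ?thesis by blast
qed

lemma profinite_group_transport:
  assumes "profinite_group G U" and H: "group H"
    and e: "e \<in> iso G H" and hom: "homeomorphic_map U V e"
  shows "profinite_group H V"
proof -
  interpret G: profinite_group G U by fact
  obtain f where f: "homeomorphic_maps U V e f"
    using hom homeomorphic_map_maps by blast
  have ce: "continuous_map U V e" and cf: "continuous_map V U f"
    and fe: "\<And>x. x \<in> carrier G \<Longrightarrow> f (e x) = x"
    and ef: "\<And>y. y \<in> topspace V \<Longrightarrow> e (f y) = y"
    using f G.topspace_eq by (auto simp: homeomorphic_maps_def)
  have eh: "e \<in> hom G H" using e by (simp add: iso_def)
  interpret e: group_hom G H e
    using H eh by (simp add: group_hom_def group_hom_axioms_def G.is_group)
  have tV: "topspace V = carrier H"
    using e homeomorphic_imp_surjective_map[OF hom] G.topspace_eq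
    by (simp add: iso_def bij_betw_def)
  have fc: "f y \<in> carrier G" if "y \<in> carrier H" for y
    using cf that tV G.topspace_eq by (auto simp: continuous_map_def Pi_def)
  have hs: "U homeomorphic_space V"
    using hom homeomorphic_map_imp_homeomorphic_space by blast
  show ?thesis
  proof (unfold_locales)
    show "topspace V = carrier H" by fact
    have "continuous_map (prod_topology V V) V
        (e \<circ> ((\<lambda>(x, y). x \<otimes>\<^bsub>G\<^esub> y) \<circ> (\<lambda>(x, y). (f x, f y))))"
      by (intro continuous_map_compose[of _ U] continuous_map_compose[of _ "prod_topology U U"]
          G.continuous_mult ce) (use cf in \<open>simp add: continuous_map_prod_top\<close>)
    then show "continuous_map (prod_topology V V) V (\<lambda>(x, y). x \<otimes>\<^bsub>H\<^esub> y)"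
      by (rule continuous_map_eq) (auto simp: tV fc ef)
    have "continuous_map V V (e \<circ> ((\<lambda>x. inv\<^bsub>G\<^esub> x) \<circ> f))"
      by (intro continuous_map_compose[of _ U] G.continuous_inv ce cf)
    then show "continuous_map V V (\<lambda>x. inv\<^bsub>H\<^esub> x)"
      by (rule continuous_map_eq) (auto simp: tV fc ef)
    show "compact_space V"
      using hs G.compact homeomorphic_compact_space by blast
    show "Hausdorff_space V"
      using hs G.Hausdorff homeomorphic_Hausdorff_space by blast
    fix C x y assume C: "connectedin V C" "x \<in> C" "y \<in> C"
    have "connectedin U (f ` C)" using cf C(1) by (rule connectedin_continuous_map_image)
    then have "f x = f y" using G.totally_disconnected C by blast
    moreover have "x \<in> topspace V" "y \<in> topspace V"
      using C connectedin_subset_topspace by blast+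
    ultimately show "x = y" using ef by metis
  qed
qed

lemma countable_basis_extension:
  fixes G :: "('b, 'n) monoid_scheme" and U :: "'b topology"
  assumes X: "countable_profinite_basis F T X" and F: "profinite_group F T"
    and G: "profinite_group G U"
    and gen: "topologically_generates G U (\<phi> ` X)" and conv: "converges_to_one G U X \<phi>"
  shows "unique_extension F T X G U \<phi>"
proof -
  interpret F: profinite_group F T by fact
  interpret G: profinite_group G U by fact
  have \<phi>X: "\<phi> ` X \<subseteq> carrier G" and dense: "U closure_of (generate G (\<phi> ` X)) = topspace U"
    using gen by (auto simp: topologically_generates_def G.topspace_eq)
  have XF: "X \<subseteq> carrier F" using X by (auto simp: countable_profinite_basis_def topologically_generates_def)
  have "countable (generate G (\<phi> ` X))"
    using X by (intro G.countable_generate countable_image) (simp add: countable_profinite_basis_def)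
  then obtain e :: "'b \<Rightarrow> nat set set" where "inj_on e (topspace U)"
    using separable_Hausdorff_inj[OF G.Hausdorff _ dense] by blast
  then have inj: "inj_on e (carrier G)" by (simp add: G.topspace_eq)
  define f where "f = inv_into (carrier G) e"
  have fe: "f (e x) = x" if "x \<in> carrier G" for x using inj that by (simp add: f_def)
  define H where "H = \<lparr>carrier = e ` carrier G, monoid.mult = (\<lambda>a b. e (f a \<otimes>\<^bsub>G\<^esub> f b)), one = e \<one>\<^bsub>G\<^esub>\<rparr>"
  define V where "V = quotient_topology U e"
  have cH: "carrier H = e ` carrier G" by (simp add: H_def)
  have H: "group H"
  proof (rule groupI)
    fix x assume "x \<in> carrier H"
    then obtain a where "a \<in> carrier G" "x = e a" by (auto simp: H_def)
    then show "\<exists>y\<in>carrier H. y \<otimes>\<^bsub>H\<^esub> x = \<one>\<^bsub>H\<^esub>"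
      by (intro bexI[of _ "e (inv\<^bsub>G\<^esub> a)"]) (auto simp: H_def fe)
  qed (auto simp: H_def fe G.m_assoc)
  have iso: "e \<in> iso G H"
    by (rule isoI) (auto simp: H_def hom_def fe bij_betw_def inj)
  have fH: "f \<in> hom H G"
    by (rule homI) (auto simp: H_def fe)
  have homeo: "homeomorphic_map U V e"
    unfolding homeomorphic_map_def V_def
    using quotient_map_quotient_topology inj by (auto simp: G.topspace_eq)
  have PH: "profinite_group H V" by (rule profinite_group_transport[OF G H iso homeo])
  then interpret H: profinite_group H V .
  interpret e: group_hom G H e
    using iso by (simp add: group_hom_def group_hom_axioms_def G.is_group H iso_def)
  have "topologically_generates H V ((\<lambda>x. e (\<phi> x)) ` X)"
  proof -
    have "V closure_of (e ` generate G (\<phi> ` X)) = e ` (U closure_of generate G (\<phi> ` X))"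
      by (rule homeomorphic_map_closure_of[OF homeo])
        (use G.generate_incl[OF \<phi>X] in \<open>simp add: G.topspace_eq\<close>)
    moreover have "e ` generate G (\<phi> ` X) = generate H (e ` \<phi> ` X)"
      using e.generate_img[OF \<phi>X] by simp
    ultimately have "V closure_of (generate H (e ` \<phi> ` X)) = carrier H"
      using dense by (simp only: G.topspace_eq cH)
    then show ?thesis
      using \<phi>X unfolding topologically_generates_def image_image cH by blast
  qed
  moreover have "converges_to_one H V X (\<lambda>x. e (\<phi> x))"
    unfolding converges_to_one_def
  proof (intro allI impI, elim conjE)
    fix N assume N: "N \<lhd> H" "openin V N"
    define N' where "N' = {x \<in> carrier G. e x \<in> N}"
    interpret N: normal N H by fact
    have "N' \<lhd> G"
    proof (rule G.normal_invI)
      show "subgroup N' G"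
        by (rule G.subgroupI) (auto simp: N'_def N.one_closed intro!: exI[of _ "\<one>\<^bsub>G\<^esub>"])
      show "x \<otimes>\<^bsub>G\<^esub> h \<otimes>\<^bsub>G\<^esub> inv\<^bsub>G\<^esub> x \<in> N'" if "x \<in> carrier G" "h \<in> N'" for x h
        using that N.inv_op_closed2 by (auto simp: N'_def)
    qed
    moreover have "openin U N'"
      using N(2) by (simp add: V_def openin_quotient_topology N'_def G.topspace_eq)
    ultimately have "finite {x \<in> X. \<phi> x \<notin> N'}"
      using conv by (simp add: converges_to_one_def)
    moreover have "{x \<in> X. e (\<phi> x) \<notin> N} = {x \<in> X. \<phi> x \<notin> N'}"
      using \<phi>X by (auto simp: N'_def)
    ultimately show "finite {x \<in> X. e (\<phi> x) \<notin> N}" by simp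
  qed
  ultimately have ext: "unique_extension F T X H V (\<lambda>x. e (\<phi> x))"
    using X PH unfolding countable_profinite_basis_def by blast
  then obtain h where h: "h \<in> hom F H" "continuous_map T V h" "\<forall>x\<in>X. h x = e (\<phi> x)"
    unfolding unique_extension_def by blast
  obtain f' where f': "homeomorphic_maps U V e f'"
    using homeo homeomorphic_map_maps by blast
  have cf: "continuous_map V U f"
    by (rule continuous_map_eq[of V U f'])
      (use f' fe in \<open>auto simp: homeomorphic_maps_def V_def topspace_quotient_topology G.topspace_eq\<close>)
  let ?g = "restrict (f \<circ> h) (carrier F)"
  have g1: "?g \<in> hom F G"
    using hom_compose[OF h(1) fH] by (auto simp: hom_def)
  have g2: "continuous_map T U ?g"
    by (rule continuous_map_eq[OF continuous_map_compose[OF h(2) cf]]) (simp add: F.topspace_eq)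
  have g3: "\<forall>x\<in>X. ?g x = \<phi> x"
    using h(3) XF \<phi>X by (auto simp: fe image_subset_iff)
  show ?thesis
    unfolding unique_extension_def
  proof (intro ex1I conjI)
    show "?g \<in> extensional (carrier F)" by simp
    show "?g \<in> hom F G" "continuous_map T U ?g" "\<forall>x\<in>X. ?g x = \<phi> x" by fact+
    fix k assume k: "k \<in> extensional (carrier F) \<and> k \<in> hom F G \<and> continuous_map T U k \<and> (\<forall>x\<in>X. k x = \<phi> x)"
    have lift: "restrict (e \<circ> k) (carrier F) \<in> extensional (carrier F) \<and>
        restrict (e \<circ> k) (carrier F) \<in> hom F H \<and>
        continuous_map T V (restrict (e \<circ> k) (carrier F)) \<and>
        (\<forall>x\<in>X. restrict (e \<circ> k) (carrier F) x = e (\<phi> x))"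
      if k: "k \<in> hom F G" "continuous_map T U k" "\<forall>x\<in>X. k x = \<phi> x" for k
    proof (intro conjI)
      show "restrict (e \<circ> k) (carrier F) \<in> hom F H"
        using hom_compose[OF k(1) e.homh] by (auto simp: hom_def)
      show "continuous_map T V (restrict (e \<circ> k) (carrier F))"
        by (rule continuous_map_eq[OF continuous_map_compose[OF k(2) homeomorphic_imp_continuous_map[OF homeo]]])
          (simp add: F.topspace_eq)
    qed (use k(3) XF in auto)
    have eq: "restrict (e \<circ> k) (carrier F) = restrict (e \<circ> ?g) (carrier F)"
      using ext lift[of k] lift[OF g1 g2 g3] k unfolding unique_extension_def by blast
    show "k = ?g"
    proof (rule extensionalityI[of _ "carrier F"])
      fix x assume x: "x \<in> carrier F"
      then have "e (k x) = e (?g x)" using fun_cong[OF eq, of x] by simp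
      moreover have "k x \<in> carrier G" "?g x \<in> carrier G"
        using k g1 x by (auto simp: hom_def Pi_def)
      ultimately show "k x = ?g x" using inj by (meson inj_onD)
    qed (use k in auto)
  qed
qed

end

theory Submission
  imports Defs "HOL-Algebra.Zassenhaus"
begin

text \<open>
  By Iwasawa's criterion a profinite group with a countable base is free of countable rank if and
  only if all its finite embedding problems have proper solutions, so this property has to be
  passed from \<open>F\<close> to \<open>M\<close>. Pulling the abelian-simple series of \<open>F/N\<close> back to
  \<open>F = D\<^sub>0 \<ge> \<dots> \<ge> D\<^sub>l = N\<close>, one descends from \<open>M D\<^sub>i\<close> to \<open>M D\<^sub>i\<^sub>+\<^sub>1\<close>. Hence let \<open>G = M P\<close> with \<open>P\<close> normal in
  \<open>G\<close> and \<open>D(P) \<le> M\<close>, and let \<open>\<alpha> : A \<rightarrow> B\<close>, \<open>\<phi> : M \<rightarrow> B\<close> be an embedding problem for \<open>M\<close> whose kernel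
  \<open>C\<close> is minimal normal in \<open>A\<close>. Extend \<open>\<phi>\<close> to an open subgroup \<open>K = M L\<close> and induce it to \<open>G\<close>, as in
  the method of twisted wreath products: a proper solution of the induced problem over \<open>G\<close>, with
  kernel \<open>C\<^sup>G\<^sup>/\<^sup>K\<close>, restricts to a homomorphism \<open>\<psi> : M \<rightarrow> A\<close> over \<open>B\<close>. It is onto as soon as
  \<open>\<psi>(D(P) \<inter> L) \<noteq> 1\<close>, because this is a normal subgroup of \<open>A\<close> inside \<open>C\<close>. If \<open>P\<close> moves enough points of
  \<open>G/K\<close>, commutators of \<open>P\<close> with elements of \<open>C\<^sup>G\<^sup>/\<^sup>K\<close> provide nontrivial elements that a quotient of
  \<open>P\<close> built from abelian and simple groups cannot detect; otherwise \<open>M\<close> is open and \<open>L \<le> M\<close>.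
\<close>

section \<open>Topological and profinite groups\<close>

text \<open>Finding a lift \<open>\<psi>\<close> of \<open>\<phi>\<close> is the easy half. The
  obstacle is that a proper solution over \<open>G\<close> only yields \<open>\<psi>(L) = C\<close>,
  and \<open>L\<close> need not lie in \<open>M\<close>. The part of \<open>L\<close> known to lie
  in \<open>M\<close> is \<open>D(P) \<inter> L\<close>, and \<open>D(P)\<close> is an intersection
  that offers no explicit elements. So one writes down a commutator \<open>v\<close> of two elements
  of \<open>P\<close> with \<open>v \<in> L\<close> and shows that \<open>v\<close> is congruent to
  an element of \<open>D(P)\<close> modulo the subgroup \<open>R\<close> of
  \<open>L \<inter> P\<close> on which all coordinates are trivial. By compactness the quotients of
  \<open>P\<close> may be treated one at a time: abelian ones kill \<open>v\<close>, and a
  nonabelian simple one is handled by a subgroup \<open>X\<close> containing \<open>v\<close> that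
  commutes modulo \<open>R\<close> with one of its conjugates. Three points of \<open>G/K\<close>
  are needed because an element with prescribed value at \<open>p\<close> is put into
  \<open>P\<close> by making it a commutator with some \<open>a \<in> P\<close>, which spreads its
  support to \<open>{p, a p}\<close>. A second element \<open>b\<close> with \<open>p\<close>,
  \<open>a p\<close>, \<open>b p\<close> distinct isolates \<open>p\<close> again.\<close>

context topological_group
begin

lemma continuous_map_mult:
  assumes "continuous_map Y T f" "continuous_map Y T g"
  shows "continuous_map Y T (\<lambda>x. f x \<otimes> g x)"
proof -
  have "continuous_map Y (prod_topology T T) (\<lambda>x. (f x, g x))"
    using assms by (simp add: continuous_map_paired)
  from continuous_map_compose[OF this continuous_mult] show ?thesis by (simp add: o_def)
qed

lemma continuous_map_inverse:
  assumes "continuous_map Y T f"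
  shows "continuous_map Y T (\<lambda>x. inv (f x))"
  using continuous_map_compose[OF assms continuous_inv] by (simp add: o_def)

lemma continuous_map_const_mult:
  assumes "a \<in> carrier G"
  shows "continuous_map T T (\<lambda>x. a \<otimes> x)"
  by (rule continuous_map_mult) (use assms in \<open>simp_all add: topspace_eq\<close>)

lemma openin_translate:
  assumes "openin T U" "a \<in> carrier G"
  shows "openin T {x \<in> carrier G. a \<otimes> x \<in> U}"
  using openin_continuous_map_preimage[OF continuous_map_const_mult[OF assms(2)] assms(1)]
  by (simp add: topspace_eq)

lemma closedin_translate:
  assumes "closedin T U" "a \<in> carrier G"
  shows "closedin T {x \<in> carrier G. a \<otimes> x \<in> U}"
  using closedin_continuous_map_preimage[OF continuous_map_const_mult[OF assms(2)] assms(1)]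
  by (simp add: topspace_eq)

lemma closedin_open_subgroup:
  assumes H: "subgroup H G" and "openin T H"
  shows "closedin T H"
proof -
  interpret H: subgroup H G by fact
  have "openin T (carrier G - H)"
  proof (subst openin_subopen, intro ballI)
    fix h assume h: "h \<in> carrier G - H"
    show "\<exists>U. openin T U \<and> h \<in> U \<and> U \<subseteq> carrier G - H"
    proof (intro exI conjI)
      show "openin T {x \<in> carrier G. inv h \<otimes> x \<in> H}"
        using h assms by (intro openin_translate) auto
      show "h \<in> {x \<in> carrier G. inv h \<otimes> x \<in> H}" using h by simp
      show "{x \<in> carrier G. inv h \<otimes> x \<in> H} \<subseteq> carrier G - H"
      proof safe
        fix x assume x: "x \<in> carrier G" "inv h \<otimes> x \<in> H" "x \<in> H"
        then have "x \<otimes> inv (inv h \<otimes> x) \<in> H" by blast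
        then have "h \<in> H" using x(1) h by (simp add: inv_mult_group m_assoc[symmetric])
        then show False using h by simp
      qed
    qed
  qed
  then show ?thesis using H.subset by (simp add: closedin_def topspace_eq)
qed

lemma subgroup_topological:
  assumes "subgroup H G"
  shows "topological_group (G\<lparr>carrier := H\<rparr>) (subtopology T H)"
proof -
  interpret H: subgroup H G by fact
  interpret K: group "G\<lparr>carrier := H\<rparr>" by (rule subgroup_imp_group[OF assms])
  show ?thesis
  proof (unfold_locales, goal_cases)
    case 1
    then show ?case using H.subset by (auto simp: topspace_eq)
  next
    case 2
    have "continuous_map (prod_topology (subtopology T H) (subtopology T H)) T (\<lambda>(x, y). x \<otimes> y)"
      using continuous_map_from_subtopology[OF continuous_mult] by (metis subtopology_Times)
    then show ?case
      by (auto simp: continuous_map_in_subtopology topspace_eq)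
  next
    case 3
    have "continuous_map (subtopology T H) (subtopology T H) (\<lambda>x. inv x)"
      using continuous_inv
      by (auto simp: continuous_map_in_subtopology continuous_map_from_subtopology topspace_eq)
    then show ?case
      by (rule continuous_map_eq) (use assms in \<open>auto simp: m_inv_consistent\<close>)
  qed
qed

text \<open>The tube lemma in complementary form: the bad pairs form a closed set, and projecting
  along a compact factor is a closed map. It is applied to multiplication by a clopen set and to
  conjugation by the whole group.\<close>

lemma openin_forall_compact:
  assumes "compactin T C" and f: "continuous_map (prod_topology T T) T (\<lambda>(c, x). f c x)"
    and U: "openin T U"
  shows "openin T {x \<in> carrier G. \<forall>c\<in>C. f c x \<in> U}"
proof -
  let ?TC = "subtopology T C"
  have CG: "C \<subseteq> carrier G" using assms(1) compactin_subset_topspace topspace_eq by metis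
  have tC: "topspace ?TC = C" using CG by (auto simp: topspace_eq)
  have cm: "continuous_map (prod_topology ?TC T) T (\<lambda>(c, x). f c x)"
    using continuous_map_from_subtopology[OF f] by (metis prod_topology_subtopology(1))
  let ?B = "{p \<in> topspace (prod_topology ?TC T). (case p of (c, x) \<Rightarrow> f c x) \<in> topspace T - U}"
  have "closedin (prod_topology ?TC T) ?B"
    by (rule closedin_continuous_map_preimage[OF cm]) (use U in auto)
  moreover have "compact_space ?TC" using assms(1) by (simp add: compactin_subspace)
  ultimately have "closedin T (snd ` ?B)"
    using closed_map_snd unfolding closed_map_def by blast
  then have "openin T (topspace T - snd ` ?B)" by blast
  moreover have "topspace T - snd ` ?B = {x \<in> carrier G. \<forall>c\<in>C. f c x \<in> U}"
  proof -
    have "f c x \<in> carrier G" if "c \<in> C" "x \<in> carrier G" for c x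
      using continuous_map_image_subset_topspace[OF cm] that tC by (force simp: topspace_eq)
    then have "snd ` ?B = {x \<in> carrier G. \<exists>c\<in>C. f c x \<notin> U}"
      using CG by (force simp: topspace_eq tC image_iff)
    then show ?thesis by (auto simp: topspace_eq)
  qed
  ultimately show ?thesis by simp
qed

end

section \<open>Open subgroups, finite quotients and closed subgroups of profinite groups\<close>

context profinite_group
begin

lemma compactin_closed: "closedin T C \<Longrightarrow> compactin T C"
  using closedin_compact_space compact by blast

text \<open>In a compact Hausdorff space a component can be split off by a clopen set from any
  closed set disjoint from it; here the component of \<open>x\<close> is just
  \<open>{x}\<close>.\<close>

lemma clopen_base:
  assumes "openin T V" "x \<in> V"
  obtains C where "openin T C" "closedin T C" "x \<in> C" "C \<subseteq> V"
proof -
  have x: "x \<in> topspace T" using assms openin_subset by blast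
  have "connected_component_of_set T x = {x}"
  proof -
    have "connectedin T (connected_component_of_set T x)"
      by (rule connectedin_connected_component_of)
    moreover have "x \<in> connected_component_of_set T x"
      using x by (simp add: connected_component_of_refl)
    ultimately show ?thesis using totally_disconnected by blast
  qed
  then have "{x} \<in> connected_components_of T"
    using x by (force simp: connected_components_of_def)
  then have "separated_between T {x} (topspace T - V)"
    by (intro separated_between_compact_connected_component)
      (use x assms Hausdorff compact in \<open>auto simp: compact_imp_locally_compact_space\<close>)
  then obtain A B where AB: "openin T A" "openin T B" "A \<union> B = topspace T" "disjnt A B"
    "{x} \<subseteq> A" "topspace T - V \<subseteq> B"
    unfolding separated_between_def by blast
  have "A = topspace T - B" using AB openin_subset by (auto simp: disjnt_iff)
  then have "closedin T A" using AB by blast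
  moreover have "A \<subseteq> V"
    using AB openin_subset[OF AB(1)] by (auto simp: disjnt_iff)
  ultimately show ?thesis using that AB by blast
qed

text \<open>Shrink \<open>V\<close> to a clopen \<open>C\<close> containing \<open>\<one>\<close>.
  The elements \<open>x\<close> with \<open>C x \<subseteq> C\<close> form an open submonoid
  \<open>S\<close>; its units are the wanted subgroup, and they lie in \<open>C\<close> because
  \<open>\<one> \<in> C\<close>.\<close>

lemma open_subgroup_base:
  assumes "openin T V" "\<one> \<in> V"
  obtains H where "subgroup H G" "openin T H" "H \<subseteq> V"
proof -
  obtain C where C: "openin T C" "closedin T C" "\<one> \<in> C" "C \<subseteq> V"
    using clopen_base[OF assms] .
  have CG: "C \<subseteq> carrier G" using C openin_subset topspace_eq by metis
  define S where "S = {x \<in> carrier G. \<forall>c\<in>C. c \<otimes> x \<in> C}"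
  have S: "openin T S"
    unfolding S_def by (rule openin_forall_compact[OF compactin_closed[OF C(2)] continuous_mult C(1)])
  define H where "H = {x \<in> S. inv x \<in> S}"
  have HS: "H = S \<inter> {x \<in> topspace T. inv x \<in> S}"
    by (auto simp: H_def S_def topspace_eq)
  have "openin T H"
    unfolding HS using openin_continuous_map_preimage[OF continuous_inv S] S by blast
  moreover have "subgroup H G"
  proof (rule subgroupI)
    have "\<one> \<in> S" using CG by (auto simp: S_def)
    then show "H \<noteq> {}" by (auto simp: H_def)
    fix a b assume ab: "a \<in> H" "b \<in> H"
    have mS: "x \<otimes> y \<in> S" if "x \<in> S" "y \<in> S" for x y
      using that CG by (auto simp: S_def m_assoc[symmetric] subset_iff)
    show "a \<otimes> b \<in> H" using ab mS by (auto simp: H_def S_def inv_mult_group)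
  qed (auto simp: H_def S_def)
  moreover have "H \<subseteq> V"
  proof
    fix x assume x: "x \<in> H"
    then have "\<one> \<otimes> x \<in> C" "x \<in> carrier G" using C by (auto simp: H_def S_def)
    then show "x \<in> V" using C by auto
  qed
  ultimately show ?thesis using that by blast
qed

text \<open>The normal core of an open subgroup is open because the condition over all conjugating
  elements ranges over a compact set.\<close>

lemma open_normal_base:
  assumes "openin T V" "\<one> \<in> V"
  obtains N where "N \<lhd> G" "openin T N" "N \<subseteq> V"
proof -
  obtain H where H: "subgroup H G" "openin T H" "H \<subseteq> V" using open_subgroup_base[OF assms] .
  interpret H: subgroup H G by fact
  define N where "N = {x \<in> carrier G. \<forall>g\<in>carrier G. g \<otimes> x \<otimes> inv g \<in> H}"
  have cg: "compactin T (carrier G)" using compact by (simp add: compact_space_def topspace_eq)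
  have "continuous_map (prod_topology T T) T (\<lambda>p. fst p \<otimes> snd p \<otimes> inv (fst p))"
    by (intro continuous_map_mult continuous_map_inverse continuous_map_fst continuous_map_snd)
  then have "openin T N"
    unfolding N_def by (intro openin_forall_compact[OF cg _ H(2)]) (simp add: case_prod_unfold)
  moreover have "N \<lhd> G"
  proof (rule normal_invI)
    show "subgroup N G"
    proof (rule subgroupI)
      show "N \<noteq> {}" by (auto simp: N_def intro!: exI[of _ \<one>])
      fix a b assume ab: "a \<in> N" "b \<in> N"
      have "g \<otimes> (a \<otimes> b) \<otimes> inv g = (g \<otimes> a \<otimes> inv g) \<otimes> (g \<otimes> b \<otimes> inv g)"
        if "g \<in> carrier G" for g
        using ab that by (simp add: N_def m_assoc inv_solve_left)
      then show "a \<otimes> b \<in> N" using ab by (auto simp: N_def)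
      have "g \<otimes> inv a \<otimes> inv g = inv (g \<otimes> a \<otimes> inv g)"
        if "g \<in> carrier G" for g
        using ab that by (simp add: N_def m_assoc inv_mult_group)
      then show "inv a \<in> N" using ab by (auto simp: N_def)
    qed (auto simp: N_def)
    fix x h assume xh: "x \<in> carrier G" "h \<in> N"
    have "g \<otimes> (x \<otimes> h \<otimes> inv x) \<otimes> inv g = (g \<otimes> x) \<otimes> h \<otimes> inv (g \<otimes> x)"
      if "g \<in> carrier G" for g
      using xh that by (simp add: N_def m_assoc inv_mult_group)
    then show "x \<otimes> h \<otimes> inv x \<in> N" using xh by (auto simp: N_def)
  qed
  moreover have "N \<subseteq> V"
  proof
    fix x assume "x \<in> N"
    then have "\<one> \<otimes> x \<otimes> inv \<one> \<in> H" "x \<in> carrier G"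
      using one_closed unfolding N_def by blast+
    then show "x \<in> V" using H by auto
  qed
  ultimately show ?thesis using that by blast
qed

text \<open>The cosets are disjoint, nonempty and open, so a finite subcover already contains all of
  them.\<close>

lemma finite_open_quotient:
  assumes "N \<lhd> G" "openin T N"
  shows "finite (carrier (G Mod N))"
proof -
  interpret N: normal N G by fact
  have "openin T C" if "C \<in> rcosets N" for C
  proof -
    obtain x where x: "x \<in> carrier G" "C = N #> x" using \<open>C \<in> rcosets N\<close> by (auto simp: RCOSETS_def)
    have "C = {y \<in> carrier G. inv x \<otimes> y \<in> N}"
    proof (intro equalityI subsetI)
      fix y assume "y \<in> C"
      then obtain n where n: "n \<in> N" "y = n \<otimes> x" using x by (auto simp: r_coset_def)
      then show "y \<in> {y \<in> carrier G. inv x \<otimes> y \<in> N}"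
        using x N.inv_op_closed1 by (auto simp: m_assoc[symmetric])
    next
      fix y assume y: "y \<in> {y \<in> carrier G. inv x \<otimes> y \<in> N}"
      then have "x \<otimes> (inv x \<otimes> y) \<otimes> inv x \<in> N" using N.inv_op_closed2 x by blast
      then have "y \<otimes> inv x \<in> N" using x y by (simp add: m_assoc[symmetric])
      moreover have "y = y \<otimes> inv x \<otimes> x" using x y by (simp add: m_assoc)
      ultimately show "y \<in> C" using x by (auto simp: r_coset_def)
    qed
    then show ?thesis using openin_translate[OF assms(2)] x by simp
  qed
  moreover have "\<Union>(rcosets N) = topspace T" using N.subgroup_axioms
    by (simp add: rcosets_part_G topspace_eq)
  moreover have "compactin T (topspace T)" using compact by (simp add: compact_space_def)
  ultimately obtain \<F> where F: "finite \<F>" "\<F> \<subseteq> rcosets N" "topspace T \<subseteq> \<Union>\<F>"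
    unfolding compactin_def by (metis order_refl)
  have "rcosets N \<subseteq> \<F>"
  proof
    fix C assume C: "C \<in> rcosets N"
    then obtain x where x: "x \<in> C" "x \<in> carrier G" using rcos_self[OF _ N.subgroup_axioms]
      by (auto simp: RCOSETS_def)
    then obtain D where "D \<in> \<F>" "x \<in> D" using F topspace_eq by blast
    then show "C \<in> \<F>" using rcos_disjoint[OF N.subgroup_axioms] C x F
      unfolding pairwise_def disjnt_iff by (metis subset_iff)
  qed
  then show ?thesis using F by (simp add: FactGroup_def finite_subset)
qed

lemma closed_subgroup_profinite:
  assumes "subgroup H G" "closedin T H"
  shows "profinite_group (G\<lparr>carrier := H\<rparr>) (subtopology T H)"
proof -
  interpret H: topological_group "G\<lparr>carrier := H\<rparr>" "subtopology T H"
    by (rule subgroup_topological[OF assms(1)])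
  show ?thesis
  proof
    show "compact_space (subtopology T H)"
      using compactin_closed[OF assms(2)] by (simp add: compactin_subspace)
    show "Hausdorff_space (subtopology T H)" using Hausdorff Hausdorff_space_subtopology by blast
    show "x = y" if "connectedin (subtopology T H) C" "x \<in> C" "y \<in> C" for C x y
      using totally_disconnected that by (metis connectedin_subtopology)
  qed
qed

lemma closedin_set_mult:
  assumes "closedin T A" "closedin T B"
  shows "closedin T (A <#> B)"
proof -
  have "compactin (prod_topology T T) (A \<times> B)"
    using assms compactin_closed by (simp add: compactin_Times)
  then have "compactin T ((\<lambda>(x, y). x \<otimes> y) ` (A \<times> B))"
    by (rule image_compactin[OF _ continuous_mult])
  moreover have "(\<lambda>(x, y). x \<otimes> y) ` (A \<times> B) = A <#> B"
    by (auto simp: set_mult_def)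
  ultimately show ?thesis using Hausdorff compactin_imp_closedin by metis
qed

end

section \<open>Finite embedding problems\<close>

text \<open>Continuity into a discrete space, phrased without a topology on the codomain. Points
  \<open>b\<close> outside the image merely contribute empty fibres.\<close>

definition locally_constant :: "'a topology \<Rightarrow> ('a \<Rightarrow> 'b) \<Rightarrow> bool" where
  "locally_constant T f \<longleftrightarrow> (\<forall>b. openin T {x \<in> topspace T. f x = b})"

lemma locally_constant_vimage:
  assumes "locally_constant T f"
  shows "openin T {x \<in> topspace T. f x \<in> S}"
proof -
  have "{x \<in> topspace T. f x \<in> S} = (\<Union>b\<in>S. {x \<in> topspace T. f x = b})" by auto
  then show ?thesis using assms by (auto simp: locally_constant_def)
qed

lemma locally_constant_compose:
  assumes "locally_constant T f" "\<And>x. x \<in> topspace T \<Longrightarrow> h x = g (f x)"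
  shows "locally_constant T h"
proof -
  have "{x \<in> topspace T. h x = b} = {x \<in> topspace T. f x \<in> {y. g y = b}}" for b
    using assms(2) by auto
  then show ?thesis
    unfolding locally_constant_def using locally_constant_vimage[OF assms(1)] by metis
qed

lemma locally_constant_subtopology:
  assumes "locally_constant T f"
  shows "locally_constant (subtopology T S) f"
proof -
  have "{x \<in> topspace (subtopology T S). f x = b} = S \<inter> {x \<in> topspace T. f x = b}" for b
    by auto
  then show ?thesis
    using assms unfolding locally_constant_def by (auto simp: openin_subtopology_Int2)
qed

lemma locally_constant_closed_vimage:
  assumes "locally_constant T f"
  shows "closedin T {x \<in> topspace T. f x \<in> S}"
proof -
  have "topspace T - {x \<in> topspace T. f x \<in> S} = {x \<in> topspace T. f x \<in> - S}" by auto
  then show ?thesis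
    using locally_constant_vimage[OF assms, of "- S"] by (simp add: closedin_def)
qed

lemma (in topological_group) locally_constant_hom:
  assumes H: "group H" and h: "h \<in> hom G H"
    and N: "openin T N" "\<one> \<in> N" and 1: "\<And>x. x \<in> N \<Longrightarrow> h x = \<one>\<^bsub>H\<^esub>"
  shows "locally_constant T h"
  unfolding locally_constant_def
proof (intro allI, subst openin_subopen, intro ballI)
  interpret h: group_hom G H h using H h by (simp add: group_hom_def group_hom_axioms_def)
  fix b x assume x: "x \<in> {x \<in> topspace T. h x = b}"
  then have xG: "x \<in> carrier G" by (simp add: topspace_eq)
  show "\<exists>U. openin T U \<and> x \<in> U \<and> U \<subseteq> {x \<in> topspace T. h x = b}"
  proof (intro exI conjI)
    show "openin T {y \<in> carrier G. inv x \<otimes> y \<in> N}" using xG by (intro openin_translate N) simp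
    show "x \<in> {y \<in> carrier G. inv x \<otimes> y \<in> N}" using xG N by simp
    show "{y \<in> carrier G. inv x \<otimes> y \<in> N} \<subseteq> {x \<in> topspace T. h x = b}"
    proof
      fix y assume "y \<in> {y \<in> carrier G. inv x \<otimes> y \<in> N}"
      then have y: "y \<in> carrier G" "h (inv x \<otimes> y) = \<one>\<^bsub>H\<^esub>" using 1 by auto
      have "h y = h (x \<otimes> (inv x \<otimes> y))" using xG y by (simp add: m_assoc[symmetric])
      also have "\<dots> = h x" using xG y by (subst h.hom_mult) auto
      finally show "y \<in> {x \<in> topspace T. h x = b}" using x y by (simp add: topspace_eq)
    qed
  qed
qed

definition continuous_epi ::
  "('a, 'm) monoid_scheme \<Rightarrow> 'a topology \<Rightarrow> ('b, 'n) monoid_scheme \<Rightarrow> ('a \<Rightarrow> 'b) \<Rightarrow> bool" where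
  "continuous_epi G T A \<phi> \<longleftrightarrow>
     \<phi> \<in> hom G A \<and> \<phi> ` carrier G = carrier A \<and> locally_constant T \<phi>"

lemma continuous_epi_compose:
  assumes "continuous_epi G T A \<phi>" "\<alpha> \<in> hom A B" "\<alpha> ` carrier A = carrier B"
    and "topspace T = carrier G"
  shows "continuous_epi G T B (\<lambda>x. \<alpha> (\<phi> x))"
  using assms hom_compose[of \<phi> G A \<alpha> B] locally_constant_compose[of T \<phi> _ \<alpha>]
  unfolding continuous_epi_def by (auto simp: o_def image_image[symmetric])

lemma (in topological_group) continuous_epi_coset:
  assumes "N \<lhd> G" "openin T N"
  shows "continuous_epi G T (G Mod N) (\<lambda>x. N #> x)"
proof -
  interpret N: normal N G by fact
  have h: "(\<lambda>x. N #> x) \<in> hom G (G Mod N)" by (rule N.r_coset_hom_Mod)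
  have "locally_constant T (\<lambda>x. N #> x)"
    by (rule locally_constant_hom[OF N.factorgroup_is_group h assms(2) N.one_closed])
      (simp add: coset_join2[OF _ N.subgroup_axioms])
  with h show ?thesis by (simp add: continuous_epi_def carrier_FactGroup)
qed

text \<open>
  As in \<^const>\<open>countable_profinite_basis\<close>, the quantifier over finite groups is restricted to one
  type that contains all of them up to isomorphism.
\<close>

definition embedding_property :: "('a, 'm) monoid_scheme \<Rightarrow> 'a topology \<Rightarrow> bool" where
  "embedding_property G T \<longleftrightarrow>
     (\<forall>(A :: nat monoid) (B :: nat monoid) \<alpha> \<phi>.
        group A \<and> finite (carrier A) \<and> group B \<and> \<alpha> \<in> hom A B \<and> \<alpha> ` carrier A = carrier B \<and>
        continuous_epi G T B \<phi> \<longrightarrow>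
        (\<exists>\<psi>. continuous_epi G T A \<psi> \<and> (\<forall>x\<in>carrier G. \<alpha> (\<psi> x) = \<phi> x)))"

lemma finite_group_iso_nat:
  assumes "group A" "finite (carrier A)"
  obtains A' :: "nat monoid" and e f where "group A'" "finite (carrier A')"
    "e \<in> hom A A'" "e ` carrier A = carrier A'" "f \<in> hom A' A" "f ` carrier A' = carrier A"
    "\<And>x. x \<in> carrier A \<Longrightarrow> f (e x) = x" "\<And>y. y \<in> carrier A' \<Longrightarrow> e (f y) = y"
proof -
  interpret A: group A by fact
  obtain e :: "'a \<Rightarrow> nat" where inj: "inj_on e (carrier A)"
    using assms(2) finite_imp_inj_to_nat_seg by metis
  define f where "f = inv_into (carrier A) e"
  have fe: "f (e x) = x" if "x \<in> carrier A" for x using inj that by (simp add: f_def)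
  define A' where
    "A' = \<lparr>carrier = e ` carrier A, monoid.mult = (\<lambda>a b. e (f a \<otimes>\<^bsub>A\<^esub> f b)), one = e \<one>\<^bsub>A\<^esub>\<rparr>"
  show ?thesis
  proof (rule that[of A' e f])
    show "group A'"
    proof (rule groupI)
      fix x assume "x \<in> carrier A'"
      then obtain a where "a \<in> carrier A" "x = e a" by (auto simp: A'_def)
      then show "\<exists>y\<in>carrier A'. y \<otimes>\<^bsub>A'\<^esub> x = \<one>\<^bsub>A'\<^esub>"
        by (intro bexI[of _ "e (inv\<^bsub>A\<^esub> a)"]) (auto simp: A'_def fe)
    qed (auto simp: A'_def fe A.m_assoc)
  qed (use assms(2) in \<open>auto simp: A'_def fe hom_def image_iff\<close>)
qed

text \<open>Lifts the restriction to groups on \<open>nat\<close>: the problem is copied to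
  \<open>nat\<close>, solved there, and the solution is carried back along the isomorphism of the
  copies of \<open>A\<close>.\<close>

lemma embedding_propertyD:
  assumes EP: "embedding_property G T" and T: "topspace T = carrier G"
    and A: "group A" "finite (carrier A)" and B: "group B"
    and \<alpha>: "\<alpha> \<in> hom A B" "\<alpha> ` carrier A = carrier B" and \<phi>: "continuous_epi G T B \<phi>"
  obtains \<psi> where "continuous_epi G T A \<psi>" "\<And>x. x \<in> carrier G \<Longrightarrow> \<alpha> (\<psi> x) = \<phi> x"
proof -
  have "finite (carrier B)" using A \<alpha> by (metis finite_imageI)
  then obtain B' :: "nat monoid" and e f where B': "group B'" "finite (carrier B')"
    "e \<in> hom B B'" "e ` carrier B = carrier B'" "f \<in> hom B' B" "f ` carrier B' = carrier B"
    "\<And>x. x \<in> carrier B \<Longrightarrow> f (e x) = x"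
    using finite_group_iso_nat[OF B] by metis
  obtain A' :: "nat monoid" and i j where A': "group A'" "finite (carrier A')"
    "i \<in> hom A A'" "i ` carrier A = carrier A'" "j \<in> hom A' A" "j ` carrier A' = carrier A"
    "\<And>x. x \<in> carrier A \<Longrightarrow> j (i x) = x"
    using finite_group_iso_nat[OF A] by metis
  have 1: "(\<lambda>x. e (\<alpha> (j x))) \<in> hom A' B'"
    using hom_compose[OF hom_compose[OF A'(5) \<alpha>(1)] B'(3)] by (simp add: o_def)
  have 2: "(\<lambda>x. e (\<alpha> (j x))) ` carrier A' = carrier B'"
    using A'(6) \<alpha>(2) B'(4) by (metis image_image)
  have 3: "continuous_epi G T B' (\<lambda>x. e (\<phi> x))"
    by (rule continuous_epi_compose[OF \<phi> B'(3,4) T])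
  obtain \<psi> where \<psi>: "continuous_epi G T A' \<psi>" "\<forall>x\<in>carrier G. e (\<alpha> (j (\<psi> x))) = e (\<phi> x)"
    using EP[unfolded embedding_property_def, rule_format, OF conjI[OF A'(1) conjI[OF A'(2) conjI[OF B'(1)
      conjI[OF 1 conjI[OF 2 3]]]]]] by blast
  have "continuous_epi G T A (\<lambda>x. j (\<psi> x))"
    by (rule continuous_epi_compose[OF \<psi>(1) A'(5,6) T])
  moreover have "\<alpha> (j (\<psi> x)) = \<phi> x" if x: "x \<in> carrier G" for x
  proof -
    have "\<psi> x \<in> carrier A'" "\<phi> x \<in> carrier B"
      using x \<psi>(1) \<phi> unfolding continuous_epi_def by blast+
    moreover from this have "\<alpha> (j (\<psi> x)) \<in> carrier B" using A'(6) \<alpha>(2) by blast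
    ultimately show ?thesis using \<psi>(2) x B'(7) by metis
  qed
  ultimately show ?thesis using that by blast
qed

text \<open>Factoring through an arbitrary surjection instead of a coset group lets the finite
  groups stay on \<open>nat\<close>.\<close>

lemma hom_factor_surj:
  assumes \<pi>: "group_hom G Q \<pi>" "\<pi> ` carrier G = carrier Q" and a: "group_hom G A a"
    and ker: "\<And>x. x \<in> carrier G \<Longrightarrow> \<pi> x = \<one>\<^bsub>Q\<^esub> \<Longrightarrow> a x = \<one>\<^bsub>A\<^esub>"
  obtains \<alpha> where "\<alpha> \<in> hom Q A" "\<alpha> ` carrier Q = a ` carrier G"
    "\<And>x. x \<in> carrier G \<Longrightarrow> \<alpha> (\<pi> x) = a x"
proof -
  interpret \<pi>: group_hom G Q \<pi> by fact
  interpret a: group_hom G A a by fact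
  define \<alpha> where "\<alpha> = (\<lambda>q. a (inv_into (carrier G) \<pi> q))"
  have \<alpha>\<pi>: "\<alpha> (\<pi> x) = a x" if x: "x \<in> carrier G" for x
  proof -
    define y where "y = inv_into (carrier G) \<pi> (\<pi> x)"
    have y: "y \<in> carrier G" "\<pi> y = \<pi> x"
      using x by (auto simp: y_def intro: inv_into_into f_inv_into_f)
    have "\<pi> (inv\<^bsub>G\<^esub> y \<otimes>\<^bsub>G\<^esub> x) = \<one>\<^bsub>Q\<^esub>" using x y by simp
    then have "a (inv\<^bsub>G\<^esub> y \<otimes>\<^bsub>G\<^esub> x) = \<one>\<^bsub>A\<^esub>"
      by (rule ker[OF \<pi>.G.m_closed[OF \<pi>.G.inv_closed[OF y(1)] x]])
    then have "a y \<otimes>\<^bsub>A\<^esub> a (inv\<^bsub>G\<^esub> y \<otimes>\<^bsub>G\<^esub> x) = a y" using y(1) by simp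
    moreover have "a y \<otimes>\<^bsub>A\<^esub> a (inv\<^bsub>G\<^esub> y \<otimes>\<^bsub>G\<^esub> x) = a (y \<otimes>\<^bsub>G\<^esub> (inv\<^bsub>G\<^esub> y \<otimes>\<^bsub>G\<^esub> x))"
      using x y(1) by (simp only: a.hom_mult \<pi>.G.inv_closed \<pi>.G.m_closed)
    moreover have "y \<otimes>\<^bsub>G\<^esub> (inv\<^bsub>G\<^esub> y \<otimes>\<^bsub>G\<^esub> x) = x" using x y(1) by (simp add: \<pi>.G.m_assoc[symmetric])
    ultimately have "a y = a x" by (simp only:)
    then show ?thesis by (simp add: \<alpha>_def y_def)
  qed
  have "\<alpha> \<in> hom Q A"
  proof (rule homI)
    fix q r assume "q \<in> carrier Q" "r \<in> carrier Q"
    then have "q \<in> \<pi> ` carrier G" "r \<in> \<pi> ` carrier G" using \<pi>(2) by simp_all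
    then obtain x y where xy: "x \<in> carrier G" "q = \<pi> x" "y \<in> carrier G" "r = \<pi> y" by blast
    then show "\<alpha> q \<in> carrier A" by (simp add: \<alpha>\<pi>)
    have "\<alpha> (q \<otimes>\<^bsub>Q\<^esub> r) = \<alpha> (\<pi> (x \<otimes>\<^bsub>G\<^esub> y))" using xy by simp
    also have "\<dots> = \<alpha> q \<otimes>\<^bsub>A\<^esub> \<alpha> r" using xy \<alpha>\<pi>[of "x \<otimes>\<^bsub>G\<^esub> y"] by (simp add: \<alpha>\<pi>)
    finally show "\<alpha> (q \<otimes>\<^bsub>Q\<^esub> r) = \<alpha> q \<otimes>\<^bsub>A\<^esub> \<alpha> r" .
  qed
  moreover have "\<alpha> ` carrier Q = a ` carrier G"
    unfolding \<pi>(2)[symmetric] image_image using \<alpha>\<pi> by simp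
  ultimately show ?thesis using that \<alpha>\<pi> by blast
qed

section \<open>Reduction to embedding problems with minimal normal kernel\<close>

text \<open>Induction on the order of the kernel. If a normal subgroup \<open>J\<close> of
  \<open>A\<close> lies strictly between \<open>1\<close> and the kernel, solve the problem for
  \<open>A/J\<close> over \<open>B\<close> first and then the one for \<open>A\<close> over
  \<open>A/J\<close>; both kernels are smaller.\<close>

lemma embedding_property_minimalI:
  fixes G :: "('a, 'm) monoid_scheme"
  assumes T: "topspace T = carrier G"
    and min: "\<And>(A :: nat monoid) (B :: nat monoid) \<alpha> \<phi>. \<lbrakk>group A; finite (carrier A); group B;
        \<alpha> \<in> hom A B; \<alpha> ` carrier A = carrier B; continuous_epi G T B \<phi>;
        kernel A B \<alpha> \<noteq> {\<one>\<^bsub>A\<^esub>};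
        \<And>J. J \<lhd> A \<Longrightarrow> J \<subseteq> kernel A B \<alpha> \<Longrightarrow> J = {\<one>\<^bsub>A\<^esub>} \<or> J = kernel A B \<alpha>\<rbrakk>
      \<Longrightarrow> \<exists>\<psi>. continuous_epi G T A \<psi> \<and> (\<forall>x\<in>carrier G. \<alpha> (\<psi> x) = \<phi> x)"
  shows "embedding_property G T"
proof -
  have "\<exists>\<psi>. continuous_epi G T A \<psi> \<and> (\<forall>x\<in>carrier G. \<alpha> (\<psi> x) = \<phi> x)"
    if "group A" "finite (carrier A)" "group B" "\<alpha> \<in> hom A B" "\<alpha> ` carrier A = carrier B"
      "continuous_epi G T B \<phi>"
    for A :: "nat monoid" and B :: "nat monoid" and \<alpha> \<phi>
    using that
  proof (induction "card (kernel A B \<alpha>)" arbitrary: A B \<alpha> \<phi> rule: less_induct)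
    case less
    interpret A: group A by fact
    interpret \<alpha>: group_hom A B \<alpha> using less.prems by (simp add: group_hom_def group_hom_axioms_def)
    let ?C = "kernel A B \<alpha>"
    have finC: "finite ?C" using less.prems(2) by (simp add: kernel_def)
    consider "?C = {\<one>\<^bsub>A\<^esub>}"
      | "?C \<noteq> {\<one>\<^bsub>A\<^esub>}" "\<And>J. J \<lhd> A \<Longrightarrow> J \<subseteq> ?C \<Longrightarrow> J = {\<one>\<^bsub>A\<^esub>} \<or> J = ?C"
      | J where "J \<lhd> A" "J \<subseteq> ?C" "J \<noteq> {\<one>\<^bsub>A\<^esub>}" "J \<noteq> ?C" by blast
    then show ?case
    proof cases
      case 1
      then have inj: "inj_on \<alpha> (carrier A)" by (rule \<alpha>.trivial_ker_imp_inj)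
      then have iso: "\<alpha> \<in> iso A B" using less.prems by (simp add: iso_def bij_betw_def)
      let ?i = "inv_into (carrier A) \<alpha>"
      have i: "?i \<in> iso B A" using A.iso_set_sym[OF iso] .
      have "continuous_epi G T A (\<lambda>x. ?i (\<phi> x))"
        by (rule continuous_epi_compose[OF less.prems(6) _ _ T])
          (use i in \<open>auto simp: iso_def bij_betw_def\<close>)
      moreover have "\<forall>x\<in>carrier G. \<alpha> (?i (\<phi> x)) = \<phi> x"
        using less.prems(5,6) unfolding continuous_epi_def by (metis f_inv_into_f imageI)
      ultimately show ?thesis by blast
    next
      case 2
      show ?thesis by (rule min[OF less.prems 2])
    next
      case 3
      interpret J: normal J A by fact
      have Jfin: "finite (carrier (A Mod J))" using less.prems(2) by (simp add: carrier_FactGroup)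
      \<comment> \<open>\<open>Q\<close> is \<open>A/J\<close> copied to \<open>nat\<close>, since
        the induction hypothesis speaks only of groups on that type.\<close>
      obtain Q :: "nat monoid" and e f where Q: "group Q" "finite (carrier Q)"
        "e \<in> hom (A Mod J) Q" "e ` carrier (A Mod J) = carrier Q"
        "f \<in> hom Q (A Mod J)" "f ` carrier Q = carrier (A Mod J)"
        "\<And>x. x \<in> carrier (A Mod J) \<Longrightarrow> f (e x) = x"
        using finite_group_iso_nat[OF J.factorgroup_is_group Jfin] by metis
      define \<pi> where "\<pi> = (\<lambda>x. e (J #>\<^bsub>A\<^esub> x))"
      have \<pi>: "\<pi> \<in> hom A Q" "\<pi> ` carrier A = carrier Q"
        using hom_compose[OF J.r_coset_hom_Mod Q(3)] Q(4)
        by (simp_all add: \<pi>_def o_def carrier_FactGroup image_image)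
      interpret \<pi>: group_hom A Q \<pi> using Q \<pi> by (simp add: group_hom_def group_hom_axioms_def)
      have \<pi>eq: "\<pi> x = \<pi> y \<longleftrightarrow> J #>\<^bsub>A\<^esub> x = J #>\<^bsub>A\<^esub> y" if "x \<in> carrier A" "y \<in> carrier A" for x y
      proof -
        have "J #>\<^bsub>A\<^esub> x \<in> carrier (A Mod J)" "J #>\<^bsub>A\<^esub> y \<in> carrier (A Mod J)"
          using that by (simp_all add: carrier_FactGroup)
        then show ?thesis using Q(7) unfolding \<pi>_def by metis
      qed
      have kJ: "kernel A Q \<pi> = J"
      proof -
        have "\<pi> x = \<one>\<^bsub>Q\<^esub> \<longleftrightarrow> x \<in> J" if x: "x \<in> carrier A" for x
        proof -
          have "\<pi> x = \<one>\<^bsub>Q\<^esub> \<longleftrightarrow> \<pi> x = \<pi> \<one>\<^bsub>A\<^esub>" by simp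
          also have "\<dots> \<longleftrightarrow> J #>\<^bsub>A\<^esub> x = J"
            using \<pi>eq[OF x A.one_closed] A.coset_mult_one[OF J.subset] by (simp only:)
          also have "\<dots> \<longleftrightarrow> x \<in> J"
            using x A.coset_join1[OF _ x J.subgroup_axioms] A.coset_join2[OF x J.subgroup_axioms] by blast
          finally show ?thesis .
        qed
        then show ?thesis using J.subset by (auto simp: kernel_def)
      qed
      have "\<alpha> x = \<one>\<^bsub>B\<^esub>" if "x \<in> carrier A" "\<pi> x = \<one>\<^bsub>Q\<^esub>" for x
        using kJ that 3(2) unfolding kernel_def by blast
      then obtain \<beta> where \<beta>: "\<beta> \<in> hom Q B" and \<beta>s': "\<beta> ` carrier Q = \<alpha> ` carrier A"
        and \<beta>\<pi>: "\<And>x. x \<in> carrier A \<Longrightarrow> \<beta> (\<pi> x) = \<alpha> x"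
        using hom_factor_surj[OF \<pi>.group_hom_axioms \<pi>(2) \<alpha>.group_hom_axioms] by blast
      have \<beta>s: "\<beta> ` carrier Q = carrier B" using \<beta>s' less.prems(5) by (rule trans)
      have Qel: "\<exists>x\<in>carrier A. q = \<pi> x" if "q \<in> carrier Q" for q using that \<pi>(2) by blast
      have kQ: "kernel Q B \<beta> = \<pi> ` ?C"
      proof -
        have "q \<in> \<pi> ` ?C" if "q \<in> kernel Q B \<beta>" for q
          using that Qel[of q] by (force simp: kernel_def \<beta>\<pi>)
        then show ?thesis using \<pi>(2) by (auto simp: kernel_def \<beta>\<pi>)
      qed
      obtain c where c: "c \<in> J" "c \<noteq> \<one>\<^bsub>A\<^esub>" using 3(3) J.one_closed by blast
      have "card (kernel Q B \<beta>) < card ?C"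
      proof -
        \<comment> \<open>The kernel of \<open>\<beta>\<close> is the image of \<open>?C\<close>,
          and it is strictly smaller because \<open>c\<close> is identified with
          \<open>\<one>\<close>.\<close>
        have "\<not> inj_on \<pi> ?C"
        proof
          assume "inj_on \<pi> ?C"
          moreover have "\<pi> c = \<pi> \<one>\<^bsub>A\<^esub>" using c(1) kJ by (auto simp: kernel_def)
          moreover have "\<one>\<^bsub>A\<^esub> \<in> ?C" "c \<in> ?C" using c 3(2) by (auto simp: kernel_def)
          ultimately show False using c(2) by (meson inj_onD)
        qed
        then show ?thesis
          unfolding kQ using card_image_le[OF finC, of \<pi>] eq_card_imp_inj_on[OF finC, of \<pi>] by linarith
      qed
      from less.hyps[OF this Q(1,2) less.prems(3) \<beta> \<beta>s less.prems(6)]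
      obtain \<psi>1 where \<psi>1: "continuous_epi G T Q \<psi>1" "\<forall>x\<in>carrier G. \<beta> (\<psi>1 x) = \<phi> x" by blast
      have "card (kernel A Q \<pi>) < card ?C"
        unfolding kJ using 3 finC by (intro psubset_card_mono) auto
      from less.hyps[OF this less.prems(1,2) Q(1) \<pi> \<psi>1(1)]
      obtain \<psi> where \<psi>: "continuous_epi G T A \<psi>" "\<forall>x\<in>carrier G. \<pi> (\<psi> x) = \<psi>1 x" by blast
      have "\<alpha> (\<psi> x) = \<phi> x" if x: "x \<in> carrier G" for x
      proof -
        have "\<psi> x \<in> carrier A" using x \<psi>(1) unfolding continuous_epi_def by blast
        then show ?thesis using \<beta>\<pi> \<psi>(2) \<psi>1(2) x by metis
      qed
      then show ?thesis using \<psi>(1) by blast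
    qed
  qed
  then show ?thesis unfolding embedding_property_def by blast
qed

section \<open>Simple quotients and the abelian-simple core\<close>

lemma (in group) commutator_conj_normal:
  assumes "N \<lhd> G" "x \<in> N" "y \<in> carrier G"
  shows "x \<otimes> y \<otimes> inv x \<otimes> inv y \<in> N"
proof -
  interpret N: normal N G by fact
  have "x \<otimes> (y \<otimes> inv x \<otimes> inv y) \<in> N"
    using assms N.inv_op_closed2 by blast
  then show ?thesis using assms N.subset by (simp add: m_assoc subset_iff)
qed

lemma (in group) commutator_eq_one_iff:
  assumes "x \<in> carrier G" "y \<in> carrier G"
  shows "x \<otimes> y \<otimes> inv x \<otimes> inv y = \<one> \<longleftrightarrow> x \<otimes> y = y \<otimes> x"
proof -
  have "x \<otimes> y \<otimes> inv x \<otimes> inv y = (x \<otimes> y) \<otimes> inv (y \<otimes> x)"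
    using assms by (simp add: inv_mult_group m_assoc)
  then have "x \<otimes> y \<otimes> inv x \<otimes> inv y = \<one> \<longleftrightarrow> \<one> = (x \<otimes> y) \<otimes> inv (y \<otimes> x)"
    by (simp only: eq_commute[of \<one>])
  also have "\<dots> \<longleftrightarrow> x \<otimes> y = \<one> \<otimes> (y \<otimes> x)"
    using assms by (intro inv_solve_right) auto
  finally show ?thesis using assms by simp
qed

lemma (in group) commutator_in_derived:
  assumes "x \<in> carrier G" "y \<in> carrier G"
  shows "x \<otimes> y \<otimes> inv x \<otimes> inv y \<in> derived G (carrier G)"
  unfolding derived_def using assms by (intro generate.incl) blast

lemma (in group) derived_subset_comm_quotient:
  assumes "N \<lhd> G" "comm_group (G Mod N)"
  shows "derived G (carrier G) \<subseteq> N"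
proof -
  interpret N: normal N G by fact
  interpret Q: comm_group "G Mod N" by fact
  interpret \<pi>: group_hom G "G Mod N" "\<lambda>x. N #> x"
    using N.r_coset_hom_Mod by (simp add: group_hom_def group_hom_axioms_def)
  have "x \<otimes> y \<otimes> inv x \<otimes> inv y \<in> N" if x: "x \<in> carrier G" and y: "y \<in> carrier G" for x y
  proof -
    have "N #> (x \<otimes> y \<otimes> inv x \<otimes> inv y) =
      (N #> x) \<otimes>\<^bsub>G Mod N\<^esub> (N #> y) \<otimes>\<^bsub>G Mod N\<^esub> inv\<^bsub>G Mod N\<^esub> (N #> x) \<otimes>\<^bsub>G Mod N\<^esub> inv\<^bsub>G Mod N\<^esub> (N #> y)"
      using x y by (simp only: \<pi>.hom_mult \<pi>.hom_inv m_closed inv_closed)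
    also have "\<dots> = \<one>\<^bsub>G Mod N\<^esub>"
      using Q.commutator_eq_one_iff Q.m_comm \<pi>.hom_closed[OF x] \<pi>.hom_closed[OF y] by blast
    finally have "N #> (x \<otimes> y \<otimes> inv x \<otimes> inv y) = N" by simp
    then show ?thesis using x y coset_join1[OF _ _ N.subgroup_axioms] N.subset by simp
  qed
  then have "derived_set G (carrier G) \<subseteq> N" by blast
  then show ?thesis
    unfolding derived_def by (rule generate_subgroup_incl[OF _ N.subgroup_axioms])
qed

text \<open>
  A nontrivial image of a normal subgroup in the nonabelian simple quotient \<^term>\<open>G Mod U\<close> is
  everything. If \<^term>\<open>R \<inter> W\<close> has trivial image, then the images of \<^term>\<open>X \<inter> W\<close> and of its
  conjugate by \<^term>\<open>g\<close> commute, so they are trivial, too.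
\<close>

lemma (in group) simple_quotient_step:
  assumes L: "L \<lhd> G" and R: "R \<lhd> G" and RX: "R \<subseteq> X" "X \<subseteq> L" and X: "subgroup X G"
    and Xn: "\<And>l x. l \<in> L \<Longrightarrow> x \<in> X \<Longrightarrow> l \<otimes> x \<otimes> inv l \<in> X"
    and g: "g \<in> carrier G"
    and comm: "\<And>x y. x \<in> X \<Longrightarrow> y \<in> X \<Longrightarrow>
      x \<otimes> (g \<otimes> y \<otimes> inv g) \<otimes> inv x \<otimes> inv (g \<otimes> y \<otimes> inv g) \<in> R"
    and W: "W \<lhd> G" and U: "U \<lhd> G" "simple_group (G Mod U)" "\<not> comm_group (G Mod U)"
    and u: "u \<in> X \<inter> W"
  shows "\<exists>u'\<in>X \<inter> W \<inter> U. inv u \<otimes> u' \<in> R"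
proof -
  interpret L: normal L G by fact
  interpret R: normal R G by fact
  interpret W: normal W G by fact
  interpret X: subgroup X G by fact
  interpret U: normal U G by fact
  let ?S = "G Mod U"
  interpret S: simple_group ?S by fact
  let ?\<pi> = "\<lambda>x. U #> x"
  have \<pi>h: "?\<pi> \<in> hom G ?S" by (rule U.r_coset_hom_Mod)
  have \<pi>s: "?\<pi> ` carrier G = carrier ?S" by (simp add: carrier_FactGroup)
  interpret \<pi>: group_hom G ?S ?\<pi> using \<pi>h by (simp add: group_hom_def group_hom_axioms_def)
  have \<pi>U: "?\<pi> x = \<one>\<^bsub>?S\<^esub> \<longleftrightarrow> x \<in> U" if "x \<in> carrier G" for x
    using coset_join1[OF _ that U.subgroup_axioms] coset_join2[OF that U.subgroup_axioms] U.subset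
    by auto
  have norm: "?\<pi> ` Z = {\<one>\<^bsub>?S\<^esub>} \<or> ?\<pi> ` Z = carrier ?S" if "Z \<lhd> G" for Z
    using S.no_real_normal_subgroup normal.surj_hom_normal_subgroup[OF that \<pi>.group_hom_axioms \<pi>s]
    by blast
  have RW: "R \<inter> W \<lhd> G" and LW: "L \<inter> W \<lhd> G"
    using normal_subgroup_intersect R L W by blast+
  have uG: "u \<in> carrier G" using u by auto
  show ?thesis
  proof (cases "?\<pi> ` (R \<inter> W) = {\<one>\<^bsub>?S\<^esub>}")
    \<comment> \<open>By simplicity \<open>R \<inter> W\<close> covers the quotient, so
      \<open>u\<close> can be moved into \<open>U\<close> by a factor from
      \<open>R \<inter> W\<close>, which changes neither its class modulo \<open>R\<close> nor its
      membership in \<open>X \<inter> W\<close>.\<close>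
    case False
    then have "?\<pi> ` (R \<inter> W) = carrier ?S" using norm RW by blast
    then have "?\<pi> u \<in> ?\<pi> ` (R \<inter> W)" using \<pi>.hom_closed[OF uG] by (simp only:)
    then obtain k where k: "k \<in> R" "k \<in> W" "?\<pi> k = ?\<pi> u" by (metis imageE IntE)
    have kG: "k \<in> carrier G" using k by auto
    have "?\<pi> (u \<otimes> inv k) = ?\<pi> u \<otimes>\<^bsub>?S\<^esub> inv\<^bsub>?S\<^esub> ?\<pi> k"
      using uG kG by (simp only: \<pi>.hom_mult \<pi>.hom_inv inv_closed)
    also have "\<dots> = \<one>\<^bsub>?S\<^esub>" unfolding k(3) using \<pi>.hom_closed[OF uG] by (rule S.r_inv)
    finally have "u \<otimes> inv k \<in> U" by (rule iffD1[OF \<pi>U[OF m_closed[OF uG inv_closed[OF kG]]]])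
    moreover have "u \<otimes> inv k \<in> X \<inter> W" using u k RX by blast
    moreover have "inv u \<otimes> (u \<otimes> inv k) \<in> R" using uG kG k by (simp add: m_assoc[symmetric])
    ultimately show ?thesis by blast
  next
    case True
    have "X \<inter> W \<subseteq> U"
    proof (rule ccontr)
      assume "\<not> X \<inter> W \<subseteq> U"
      then obtain z where z: "z \<in> X" "z \<in> W" "z \<notin> U" by blast
      then have "z \<in> carrier G" by auto
      from \<pi>U[OF this] have zn: "?\<pi> z \<noteq> \<one>\<^bsub>?S\<^esub>" using z by (simp only: not_False_eq_True)
      have "?\<pi> z \<in> ?\<pi> ` (L \<inter> W)" using z RX by (intro imageI) auto
      then have "?\<pi> ` (L \<inter> W) \<noteq> {\<one>\<^bsub>?S\<^esub>}" using zn by (metis singletonD)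
      then have LWs: "?\<pi> ` (L \<inter> W) = carrier ?S" using norm LW by blast
      have XW: "subgroup (X \<inter> W) G" using X W.subgroup_axioms subgroups_Inter_pair by blast
      \<comment> \<open>\<open>L \<inter> W\<close> maps onto the simple group and normalises
        \<open>X \<inter> W\<close>, so the image of \<open>X \<inter> W\<close> is invariant under
        all conjugations.\<close>
      have "?\<pi> ` (X \<inter> W) \<lhd> ?S"
      proof (rule S.normal_invI)
        show "subgroup (?\<pi> ` (X \<inter> W)) ?S" by (rule \<pi>.subgroup_img_is_subgroup[OF XW])
        fix s h assume "s \<in> carrier ?S" "h \<in> ?\<pi> ` (X \<inter> W)"
        then obtain l x where l: "l \<in> L \<inter> W" "s = ?\<pi> l" and x: "x \<in> X \<inter> W" "h = ?\<pi> x"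
          using LWs by blast
        have lG: "l \<in> carrier G" and xG: "x \<in> carrier G" using l x by auto
        have "s \<otimes>\<^bsub>?S\<^esub> h \<otimes>\<^bsub>?S\<^esub> inv\<^bsub>?S\<^esub> s = ?\<pi> (l \<otimes> x \<otimes> inv l)"
          unfolding l x using lG xG by (simp only: \<pi>.hom_mult \<pi>.hom_inv inv_closed m_closed)
        moreover have "l \<otimes> x \<otimes> inv l \<in> X \<inter> W" using Xn l x W.inv_op_closed2 lG by blast
        ultimately show "s \<otimes>\<^bsub>?S\<^esub> h \<otimes>\<^bsub>?S\<^esub> inv\<^bsub>?S\<^esub> s \<in> ?\<pi> ` (X \<inter> W)" by blast
      qed
      moreover have "?\<pi> z \<in> ?\<pi> ` (X \<inter> W)" using z by (intro imageI) auto
      then have "?\<pi> ` (X \<inter> W) \<noteq> {\<one>\<^bsub>?S\<^esub>}" using zn by (metis singletonD)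
      ultimately have XWs: "?\<pi> ` (X \<inter> W) = carrier ?S" using S.no_real_normal_subgroup by blast
      have "s \<otimes>\<^bsub>?S\<^esub> t = t \<otimes>\<^bsub>?S\<^esub> s" if s: "s \<in> carrier ?S" and t: "t \<in> carrier ?S" for s t
      proof -
        let ?g = "?\<pi> g"
        have gS: "?g \<in> carrier ?S" using g \<pi>.hom_closed by blast
        \<comment> \<open>\<open>s\<close> is lifted to \<open>x\<close>, and \<open>t\<close> to a
          conjugate by \<open>g\<close> of an element \<open>y\<close>. The commutator of these
          lifts is in \<open>R\<close> by \<open>comm\<close> and in \<open>W\<close> because
          \<open>x\<close> is, hence has trivial image.\<close>
        obtain x where x: "x \<in> X \<inter> W" "s = ?\<pi> x" using s XWs by blast
        have "inv\<^bsub>?S\<^esub> ?g \<otimes>\<^bsub>?S\<^esub> t \<otimes>\<^bsub>?S\<^esub> ?g \<in> carrier ?S" using gS t by blast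
        then obtain y where y: "y \<in> X \<inter> W" "inv\<^bsub>?S\<^esub> ?g \<otimes>\<^bsub>?S\<^esub> t \<otimes>\<^bsub>?S\<^esub> ?g = ?\<pi> y"
          using XWs by (metis (no_types, lifting) imageE)
        define y' where "y' = g \<otimes> y \<otimes> inv g"
        have xG: "x \<in> carrier G" and yG: "y \<in> carrier G" using x y by auto
        have y'G: "y' \<in> carrier G" using g yG by (simp add: y'_def)
        have "?\<pi> y' = ?g \<otimes>\<^bsub>?S\<^esub> ?\<pi> y \<otimes>\<^bsub>?S\<^esub> inv\<^bsub>?S\<^esub> ?g"
          unfolding y'_def using g yG by (simp only: \<pi>.hom_mult \<pi>.hom_inv inv_closed m_closed)
        also have "\<dots> = t"
        proof -
          have "?g \<otimes>\<^bsub>?S\<^esub> (inv\<^bsub>?S\<^esub> ?g \<otimes>\<^bsub>?S\<^esub> t \<otimes>\<^bsub>?S\<^esub> ?g) \<otimes>\<^bsub>?S\<^esub> inv\<^bsub>?S\<^esub> ?g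
              = (?g \<otimes>\<^bsub>?S\<^esub> inv\<^bsub>?S\<^esub> ?g) \<otimes>\<^bsub>?S\<^esub> t \<otimes>\<^bsub>?S\<^esub> (?g \<otimes>\<^bsub>?S\<^esub> inv\<^bsub>?S\<^esub> ?g)"
            using gS t by (simp only: S.m_assoc S.m_closed S.inv_closed)
          then show ?thesis unfolding y(2)[symmetric]
            using gS t by (simp only: S.r_inv S.l_one S.r_one)
        qed
        finally have y't: "?\<pi> y' = t" .
        have "x \<otimes> y' \<otimes> inv x \<otimes> inv y' \<in> R" using comm x y by (simp add: y'_def)
        moreover have "x \<otimes> y' \<otimes> inv x \<otimes> inv y' \<in> W"
          using commutator_conj_normal[OF W _ y'G] x by blast
        ultimately have "?\<pi> (x \<otimes> y' \<otimes> inv x \<otimes> inv y') = \<one>\<^bsub>?S\<^esub>" using True by blast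
        then have "s \<otimes>\<^bsub>?S\<^esub> t \<otimes>\<^bsub>?S\<^esub> inv\<^bsub>?S\<^esub> s \<otimes>\<^bsub>?S\<^esub> inv\<^bsub>?S\<^esub> t = \<one>\<^bsub>?S\<^esub>"
          using xG y'G unfolding x(2) y't[symmetric]
          by (simp only: \<pi>.hom_mult \<pi>.hom_inv inv_closed m_closed)
        then show ?thesis using S.commutator_eq_one_iff[OF s t] by blast
      qed
      then have "comm_group ?S" by (intro S.group_comm_groupI) auto
      then show False using U by blast
    qed
    then show ?thesis using u uG by (intro bexI[of _ u]) (auto simp: R.one_closed)
  qed
qed

text \<open>All members of the family defining the core are closed, so by compactness the coset of
  \<open>v\<close> modulo \<open>R\<close> meets their intersection once it meets every finite
  subintersection.\<close>

lemma (in profinite_group) abelian_simple_core_congruence: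
  assumes L: "L \<lhd> G" and R: "R \<lhd> G" and Rc: "closedin T R" and RX: "R \<subseteq> X" "X \<subseteq> L"
    and X: "subgroup X G"
    and Xn: "\<And>l x. l \<in> L \<Longrightarrow> x \<in> X \<Longrightarrow> l \<otimes> x \<otimes> inv l \<in> X"
    and g: "g \<in> carrier G"
    and comm: "\<And>x y. x \<in> X \<Longrightarrow> y \<in> X \<Longrightarrow>
      x \<otimes> (g \<otimes> y \<otimes> inv g) \<otimes> inv x \<otimes> inv (g \<otimes> y \<otimes> inv g) \<in> R"
    and v: "v \<in> X" "v \<in> derived G (carrier G)"
  obtains q where "q \<in> abelian_simple_core G T" "inv v \<otimes> q \<in> R"
proof -
  interpret R: normal R G by fact
  interpret X: subgroup X G by fact
  define \<N> where "\<N> = {N. N \<lhd> G \<and> openin T N \<and> (comm_group (G Mod N) \<or> simple_group (G Mod N))}"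
  have vG: "v \<in> carrier G" using v X.subset by blast
  let ?D = "derived G (carrier G)"
  have fin: "\<exists>u\<in>X \<inter> ?D \<inter> \<Inter>\<F>. inv v \<otimes> u \<in> R" if "finite \<F>" "\<F> \<subseteq> \<N>" for \<F>
  proof -
    \<comment> \<open>The normal subgroup \<open>W\<close> is carried along because
      \<open>simple_quotient_step\<close> corrects \<open>u\<close> without leaving it, so earlier
      quotients stay trivial. Starting at the derived subgroup disposes of every abelian quotient at
      once.\<close>
    have "\<exists>W. W \<lhd> G \<and> W \<subseteq> ?D \<inter> \<Inter>\<F> \<and> (\<exists>u\<in>X \<inter> W. inv v \<otimes> u \<in> R)"
      using that
    proof (induction \<F>)
      case empty
      show ?case
        using v vG derived_self_is_normal R.one_closed
        by (intro exI[of _ ?D] conjI bexI[of _ v]) auto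
    next
      case (insert U \<F>)
      then obtain W u where W: "W \<lhd> G" "W \<subseteq> ?D \<inter> \<Inter>\<F>" and u: "u \<in> X \<inter> W" "inv v \<otimes> u \<in> R"
        by auto
      have U: "U \<lhd> G" "comm_group (G Mod U) \<or> simple_group (G Mod U)"
        using insert.prems by (auto simp: \<N>_def)
      show ?case
      proof (cases "comm_group (G Mod U)")
        case True
        then show ?thesis
          using derived_subset_comm_quotient[OF U(1)] W u by (intro exI[of _ W]) auto
      next
        case False
        then obtain u' where u': "u' \<in> X \<inter> W \<inter> U" "inv u \<otimes> u' \<in> R"
          using simple_quotient_step[OF L R RX X Xn g comm W(1) U(1) _ False u(1)] U by blast
        have "u \<in> carrier G" "u' \<in> carrier G" using u u' by auto
        then have "inv v \<otimes> u' = (inv v \<otimes> u) \<otimes> (inv u \<otimes> u')"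
          using vG r_inv[of u] by (simp add: m_assoc[of _ u] m_assoc[of u "inv u", symmetric])
        then have "inv v \<otimes> u' \<in> R" using u(2) u'(2) by simp
        then show ?thesis
          using normal_subgroup_intersect[OF W(1) U(1)] u' W by (intro exI[of _ "W \<inter> U"]) auto
      qed
    qed
    then show ?thesis by blast
  qed
  define Z where "Z = {x \<in> carrier G. inv v \<otimes> x \<in> R}"
  have Zc: "closedin T Z" unfolding Z_def using closedin_translate[OF Rc] vG by blast
  have cl: "closedin T C" if "C \<in> insert Z \<N>" for C
    using that Zc by (auto simp: \<N>_def intro: closedin_open_subgroup normal_imp_subgroup)
  \<comment> \<open>The coset \<open>Z\<close> is set aside; the element found for the remaining
    members lies in it by construction.\<close>
  have fip: "\<Inter>\<F> \<noteq> {}" if F: "finite \<F>" "\<F> \<subseteq> insert Z \<N>" for \<F>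
  proof -
    obtain u where u: "u \<in> X \<inter> ?D \<inter> \<Inter>(\<F> - {Z})" "inv v \<otimes> u \<in> R"
      using fin[of "\<F> - {Z}"] F by blast
    then have "u \<in> Z" using X.subset by (auto simp: Z_def)
    then show ?thesis using u by blast
  qed
  have "\<Inter>(insert Z \<N>) \<noteq> {}"
    by (rule compact[unfolded compact_space_fip, THEN spec, THEN mp]) (intro conjI ballI allI impI, rule cl, assumption, rule fip, auto)
  then obtain q where "q \<in> Z" "q \<in> \<Inter>\<N>" by blast
  then show ?thesis using that by (auto simp: Z_def \<N>_def abelian_simple_core_def)
qed

section \<open>Induced extensions\<close>

text \<open>
  The fibre product over the wreath product of \<^term>\<open>B\<close> with \<^term>\<open>\<Gamma>\<close> attached to a cocycle
  \<^term>\<open>\<kappa> :: 'g \<Rightarrow> 'i \<Rightarrow> 'b\<close>. Solving the embedding problem that it poses lifts the cocycle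
  along \<^term>\<open>\<alpha>\<close>.
\<close>

definition induced_extension ::
  "('g, 'x) monoid_scheme \<Rightarrow> 'i set \<Rightarrow> ('g \<Rightarrow> 'i \<Rightarrow> 'i) \<Rightarrow> ('g \<Rightarrow> 'i \<Rightarrow> 'b) \<Rightarrow>
   ('a, 'y) monoid_scheme \<Rightarrow> ('a \<Rightarrow> 'b) \<Rightarrow> (('i \<Rightarrow> 'a) \<times> 'g) monoid" where
  "induced_extension \<Gamma> I act \<kappa> A \<alpha> =
     \<lparr>carrier = {(f, x). x \<in> carrier \<Gamma> \<and> f \<in> I \<rightarrow>\<^sub>E carrier A \<and> (\<forall>i\<in>I. \<alpha> (f i) = \<kappa> x i)},
      monoid.mult = (\<lambda>(f, x) (f', x'). (\<lambda>i\<in>I. f (act x' i) \<otimes>\<^bsub>A\<^esub> f' i, x \<otimes>\<^bsub>\<Gamma>\<^esub> x')),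
      one = (\<lambda>i\<in>I. \<one>\<^bsub>A\<^esub>, \<one>\<^bsub>\<Gamma>\<^esub>)\<rparr>"

text \<open>The rule says that \<open>x\<close> goes homomorphically to the pair of
  \<open>\<kappa> x\<close> and \<open>x\<close> in a twisted wreath product. In particular,
  \<open>\<lambda>x. \<kappa> x i\<close> is a homomorphism on the stabiliser of \<open>i\<close>;
  this is how the coordinate at a base point becomes a homomorphism.\<close>

locale cocycle = group G + B: group B for G (structure) and B (structure) +
  fixes I :: "'i set" and act :: "'a \<Rightarrow> 'i \<Rightarrow> 'i" and \<kappa> :: "'a \<Rightarrow> 'i \<Rightarrow> 'c"
  assumes act_closed [simp]: "\<lbrakk>x \<in> carrier G; i \<in> I\<rbrakk> \<Longrightarrow> act x i \<in> I"
    and act_mult: "\<lbrakk>x \<in> carrier G; y \<in> carrier G; i \<in> I\<rbrakk> \<Longrightarrow> act (x \<otimes>\<^bsub>G\<^esub> y) i = act x (act y i)"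
    and act_one [simp]: "i \<in> I \<Longrightarrow> act \<one>\<^bsub>G\<^esub> i = i"
    and cocycle_closed [simp]: "\<lbrakk>x \<in> carrier G; i \<in> I\<rbrakk> \<Longrightarrow> \<kappa> x i \<in> carrier B"
    and cocycle_mult: "\<lbrakk>x \<in> carrier G; y \<in> carrier G; i \<in> I\<rbrakk>
      \<Longrightarrow> \<kappa> (x \<otimes>\<^bsub>G\<^esub> y) i = \<kappa> x (act y i) \<otimes>\<^bsub>B\<^esub> \<kappa> y i"
begin

lemma cocycle_one [simp]:
  assumes "i \<in> I"
  shows "\<kappa> \<one>\<^bsub>G\<^esub> i = \<one>\<^bsub>B\<^esub>"
proof -
  have "\<kappa> \<one>\<^bsub>G\<^esub> i = \<kappa> \<one>\<^bsub>G\<^esub> i \<otimes>\<^bsub>B\<^esub> \<kappa> \<one>\<^bsub>G\<^esub> i"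
    using cocycle_mult[of "\<one>\<^bsub>G\<^esub>" "\<one>\<^bsub>G\<^esub>" i] assms by simp
  then show ?thesis using assms B.r_cancel_one'[of "\<kappa> \<one>\<^bsub>G\<^esub> i" "\<kappa> \<one>\<^bsub>G\<^esub> i"] by simp
qed

lemma act_inv_act [simp]:
  assumes "x \<in> carrier G" "i \<in> I"
  shows "act (inv\<^bsub>G\<^esub> x) (act x i) = i" "act x (act (inv\<^bsub>G\<^esub> x) i) = i"
  using act_mult[of "inv\<^bsub>G\<^esub> x" x i] act_mult[of x "inv\<^bsub>G\<^esub> x" i] assms by simp_all

lemma cocycle_inv:
  assumes "x \<in> carrier G" "i \<in> I"
  shows "\<kappa> (inv\<^bsub>G\<^esub> x) i = inv\<^bsub>B\<^esub> \<kappa> x (act (inv\<^bsub>G\<^esub> x) i)"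
proof (rule B.inv_equality[symmetric])
  have "\<kappa> (inv\<^bsub>G\<^esub> x) i \<otimes>\<^bsub>B\<^esub> \<kappa> x (act (inv\<^bsub>G\<^esub> x) i) = \<kappa> (inv\<^bsub>G\<^esub> x \<otimes>\<^bsub>G\<^esub> x) (act (inv\<^bsub>G\<^esub> x) i)"
    using assms by (simp only: cocycle_mult act_closed inv_closed act_inv_act)
  then show "\<kappa> (inv\<^bsub>G\<^esub> x) i \<otimes>\<^bsub>B\<^esub> \<kappa> x (act (inv\<^bsub>G\<^esub> x) i) = \<one>\<^bsub>B\<^esub>"
    using assms by simp
qed (use assms in auto)

text \<open>Conjugation by \<open>g\<close> moves the coordinate at \<open>j\<close> to
  \<open>act g j\<close>, up to conjugation of its value. All later computations of supports rest on
  this.\<close>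

lemma cocycle_conj:
  assumes "g \<in> carrier G" "x \<in> carrier G" "i \<in> I"
    and triv: "\<And>j. j \<in> I \<Longrightarrow> act x j = j"
  shows "\<kappa> (g \<otimes>\<^bsub>G\<^esub> x \<otimes>\<^bsub>G\<^esub> inv\<^bsub>G\<^esub> g) i =
    \<kappa> g (act (inv\<^bsub>G\<^esub> g) i) \<otimes>\<^bsub>B\<^esub> \<kappa> x (act (inv\<^bsub>G\<^esub> g) i) \<otimes>\<^bsub>B\<^esub> inv\<^bsub>B\<^esub> \<kappa> g (act (inv\<^bsub>G\<^esub> g) i)"
  using assms by (simp add: cocycle_mult cocycle_inv)

lemma group_induced_extension:
  assumes A: "group A" and \<alpha>: "\<alpha> \<in> hom A B"
  shows "group (induced_extension G I act \<kappa> A \<alpha>)" (is "group ?E")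
proof -
  interpret \<alpha>: group_hom A B \<alpha>
    using A \<alpha> by (simp add: group_hom_def group_hom_axioms_def)
  have A_el: "f i \<in> carrier A" if "f \<in> I \<rightarrow>\<^sub>E carrier A" "i \<in> I" for f i using that by auto
  show ?thesis
  proof (rule groupI)
    fix p assume "p \<in> carrier ?E"
    then obtain f x where p: "p = (f, x)" "x \<in> carrier G" "f \<in> I \<rightarrow>\<^sub>E carrier A"
      "\<And>i. i \<in> I \<Longrightarrow> \<alpha> (f i) = \<kappa> x i" by (auto simp: induced_extension_def)
    \<comment> \<open>Multiplying by \<open>p\<close> on the right shifts the index by
      \<open>x\<close>, so the inverse has to be read off at the index shifted back.\<close>
    let ?f = "\<lambda>i\<in>I. inv\<^bsub>A\<^esub> f (act (inv\<^bsub>G\<^esub> x) i)"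
    show "\<exists>q\<in>carrier ?E. q \<otimes>\<^bsub>?E\<^esub> p = \<one>\<^bsub>?E\<^esub>"
    proof (rule bexI)
      show "(?f, inv\<^bsub>G\<^esub> x) \<otimes>\<^bsub>?E\<^esub> p = \<one>\<^bsub>?E\<^esub>"
        using p A_el by (auto simp: induced_extension_def fun_eq_iff)
      show "(?f, inv\<^bsub>G\<^esub> x) \<in> carrier ?E"
        using p A_el by (auto simp: induced_extension_def cocycle_inv)
    qed
  next
    show "\<one>\<^bsub>?E\<^esub> \<in> carrier ?E" by (auto simp: induced_extension_def)
  next
    fix p assume "p \<in> carrier ?E"
    then show "\<one>\<^bsub>?E\<^esub> \<otimes>\<^bsub>?E\<^esub> p = p"
      using A_el by (auto simp: induced_extension_def PiE_def intro!: extensionalityI[of _ I])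
  next
    fix p q assume "p \<in> carrier ?E" "q \<in> carrier ?E"
    then show "p \<otimes>\<^bsub>?E\<^esub> q \<in> carrier ?E"
      using A_el by (auto simp: induced_extension_def cocycle_mult)
    fix r assume "r \<in> carrier ?E"
    then show "p \<otimes>\<^bsub>?E\<^esub> q \<otimes>\<^bsub>?E\<^esub> r = p \<otimes>\<^bsub>?E\<^esub> (q \<otimes>\<^bsub>?E\<^esub> r)"
      using A_el \<open>p \<in> _\<close> \<open>q \<in> _\<close>
      by (auto simp: induced_extension_def act_mult \<alpha>.m_assoc m_assoc fun_eq_iff)
  qed
qed

lemma induced_extension_snd:
  assumes "\<alpha> \<in> hom A B" "\<alpha> ` carrier A = carrier B"
  shows "snd \<in> hom (induced_extension G I act \<kappa> A \<alpha>) G"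
    and "snd ` carrier (induced_extension G I act \<kappa> A \<alpha>) = carrier G"
proof -
  show "snd \<in> hom (induced_extension G I act \<kappa> A \<alpha>) G"
    by (rule homI) (auto simp: induced_extension_def)
  show "snd ` carrier (induced_extension G I act \<kappa> A \<alpha>) = carrier G"
  proof (intro equalityI subsetI)
    fix x assume x: "x \<in> carrier G"
    let ?f = "\<lambda>i\<in>I. inv_into (carrier A) \<alpha> (\<kappa> x i)"
    have "\<kappa> x i \<in> \<alpha> ` carrier A" if "i \<in> I" for i using that x assms(2) by simp
    then have "(?f, x) \<in> carrier (induced_extension G I act \<kappa> A \<alpha>)"
      using x by (auto simp: induced_extension_def inv_into_into f_inv_into_f)
    then show "x \<in> snd ` carrier (induced_extension G I act \<kappa> A \<alpha>)" by force
  qed (auto simp: induced_extension_def)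
qed

lemma finite_induced_extension:
  assumes "finite (carrier G)" "finite I" "finite (carrier A)"
  shows "finite (carrier (induced_extension G I act \<kappa> A \<alpha>))"
  by (rule finite_subset[of _ "(I \<rightarrow>\<^sub>E carrier A) \<times> carrier G"])
    (use assms in \<open>auto simp: induced_extension_def intro: finite_PiE\<close>)

end

text \<open>Since \<open>L\<close> acts trivially and \<open>\<kappa>\<close> is trivial on it, the
  data descend to the finite group \<open>G/L\<close>. A proper solution for the induced extension
  over \<open>G/L\<close> has second component \<open>L #> x\<close>, its first component is
  \<open>\<sigma>\<close>, and its surjectivity is the last claim.\<close>

lemma (in profinite_group) lift_cocycle:
  fixes A :: "('c, 'p) monoid_scheme" and B :: "('d, 'q) monoid_scheme"
  assumes EP: "embedding_property G T"
    and L: "L \<lhd> G" "openin T L"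
    and I: "finite I" and coc: "cocycle G B I act \<kappa>"
    and triv: "\<And>l i. l \<in> L \<Longrightarrow> i \<in> I \<Longrightarrow> act l i = i" "\<And>l i. l \<in> L \<Longrightarrow> i \<in> I \<Longrightarrow> \<kappa> l i = \<one>\<^bsub>B\<^esub>"
    and A: "group A" "finite (carrier A)" and \<alpha>: "\<alpha> \<in> hom A B" "\<alpha> ` carrier A = carrier B"
  obtains \<sigma> where "cocycle G A I act \<sigma>"
    "\<And>x i. x \<in> carrier G \<Longrightarrow> i \<in> I \<Longrightarrow> \<alpha> (\<sigma> x i) = \<kappa> x i"
    "\<And>i. locally_constant T (\<lambda>x. \<sigma> x i)"
    "\<And>f. f \<in> I \<rightarrow> kernel A B \<alpha> \<Longrightarrow> \<exists>x\<in>L. \<forall>i\<in>I. \<sigma> x i = f i"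
proof -
  interpret L: normal L G by fact
  interpret coc: cocycle G B I act \<kappa> by fact
  interpret A: group A by fact
  interpret \<alpha>: group_hom A B \<alpha> using \<alpha> A by (simp add: group_hom_def group_hom_axioms_def)
  let ?\<Gamma> = "G Mod L"
  interpret \<Gamma>: group ?\<Gamma> by (rule L.factorgroup_is_group)
  \<comment> \<open>Arbitrary representatives suffice, because \<open>act\<close> and
    \<open>\<kappa>\<close> are constant on the cosets of \<open>L\<close>.\<close>
  define rep where "rep = (\<lambda>X. SOME y. y \<in> carrier G \<and> X = L #> y)"
  define act' where "act' = (\<lambda>X. act (rep X))"
  define \<kappa>' where "\<kappa>' = (\<lambda>X. \<kappa> (rep X))"
  have rep: "rep (L #> x) \<in> carrier G \<and> L #> x = L #> rep (L #> x)" if "x \<in> carrier G" for x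
    unfolding rep_def by (rule someI[of _ x]) (use that in simp)
  have ex: "\<exists>l\<in>L. x = l \<otimes> rep (L #> x)" if "x \<in> carrier G" for x
    using rep[OF that] rcos_self[OF that L.subgroup_axioms] by (auto simp: r_coset_def)
  have act': "act' (L #> x) i = act x i" if x: "x \<in> carrier G" and i: "i \<in> I" for x i
  proof -
    obtain l where l: "l \<in> L" "x = l \<otimes> rep (L #> x)" using ex[OF x] by blast
    then have "act x i = act (l \<otimes> rep (L #> x)) i" by (simp only:)
    also have "\<dots> = act (rep (L #> x)) i"
      using l(1) rep[OF x] i triv by (subst coc.act_mult) auto
    finally show ?thesis by (simp add: act'_def)
  qed
  have \<kappa>': "\<kappa>' (L #> x) i = \<kappa> x i" if x: "x \<in> carrier G" and i: "i \<in> I" for x i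
  proof -
    obtain l where l: "l \<in> L" "x = l \<otimes> rep (L #> x)" using ex[OF x] by blast
    then have "\<kappa> x i = \<kappa> (l \<otimes> rep (L #> x)) i" by (simp only:)
    also have "\<dots> = \<kappa> (rep (L #> x)) i"
      using l(1) rep[OF x] i triv by (subst coc.cocycle_mult) auto
    finally show ?thesis by (simp add: \<kappa>'_def)
  qed
  have \<Gamma>el: "\<exists>x\<in>carrier G. X = L #> x" if "X \<in> carrier ?\<Gamma>" for X
    using that by (auto simp: carrier_FactGroup)
  have \<Gamma>one: "\<one>\<^bsub>?\<Gamma>\<^esub> = L #> \<one>" using L.subset by simp
  interpret coc': cocycle ?\<Gamma> B I act' \<kappa>'
  proof (unfold_locales, goal_cases)
    case (1 X i) then show ?case using \<Gamma>el[of X] act' by auto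
  next
    case (2 X Y i)
    then obtain x y where xy: "x \<in> carrier G" "y \<in> carrier G" "X = L #> x" "Y = L #> y"
      using \<Gamma>el by meson
    have "X \<otimes>\<^bsub>?\<Gamma>\<^esub> Y = L #> (x \<otimes> y)" using xy by (simp add: L.rcos_sum)
    then show ?case using 2 xy by (simp add: act' coc.act_mult)
  next
    case (3 i) then show ?case using act'[of \<one> i] unfolding \<Gamma>one by simp
  next
    case (4 X i) then show ?case using \<Gamma>el[of X] \<kappa>' by auto
  next
    case (5 X Y i)
    then obtain x y where xy: "x \<in> carrier G" "y \<in> carrier G" "X = L #> x" "Y = L #> y"
      using \<Gamma>el by meson
    have "X \<otimes>\<^bsub>?\<Gamma>\<^esub> Y = L #> (x \<otimes> y)" using xy by (simp add: L.rcos_sum)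
    then show ?case using 5 xy by (simp add: \<kappa>' act' coc.cocycle_mult)
  qed
  let ?E = "induced_extension ?\<Gamma> I act' \<kappa>' A \<alpha>"
  obtain \<Psi> where \<Psi>: "continuous_epi G T ?E \<Psi>" "\<And>x. x \<in> carrier G \<Longrightarrow> snd (\<Psi> x) = L #> x"
    using embedding_propertyD[OF EP topspace_eq coc'.group_induced_extension[OF A(1) \<alpha>(1)]
        coc'.finite_induced_extension[OF finite_open_quotient[OF L] I A(2)] \<Gamma>.is_group
        coc'.induced_extension_snd[OF \<alpha>] continuous_epi_coset[OF L]] by blast
  define \<sigma> where "\<sigma> = (\<lambda>x. fst (\<Psi> x))"
  have \<Psi>el: "\<Psi> x = (\<sigma> x, L #> x)" if "x \<in> carrier G" for x
    using \<Psi>(2)[OF that] by (simp add: \<sigma>_def prod_eq_iff)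
  have E: "(\<sigma> x, L #> x) \<in> carrier ?E" if "x \<in> carrier G" for x
    using \<Psi>(1) \<Psi>el[OF that] that unfolding continuous_epi_def by force
  have \<sigma>: "\<sigma> x i \<in> carrier A" "\<alpha> (\<sigma> x i) = \<kappa> x i" if "x \<in> carrier G" "i \<in> I" for x i
    using E[OF that(1)] that \<kappa>' by (auto simp: induced_extension_def)
  show ?thesis
  proof (rule that[of \<sigma>])
    show "cocycle G A I act \<sigma>"
    proof (unfold_locales, goal_cases)
      case (5 x y i)
      have "\<Psi> (x \<otimes> y) = \<Psi> x \<otimes>\<^bsub>?E\<^esub> \<Psi> y"
        using \<Psi>(1) 5 by (simp add: continuous_epi_def hom_def)
      then have "\<sigma> (x \<otimes> y) = (\<lambda>i\<in>I. \<sigma> x (act' (L #> y) i) \<otimes>\<^bsub>A\<^esub> \<sigma> y i)"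
        using 5 by (simp add: \<Psi>el induced_extension_def)
      then show ?case using 5 by (simp add: act')
    qed (use \<sigma> in \<open>simp_all add: coc.act_mult\<close>)
    show "\<alpha> (\<sigma> x i) = \<kappa> x i" if "x \<in> carrier G" "i \<in> I" for x i using \<sigma> that by blast
    show "locally_constant T (\<lambda>x. \<sigma> x i)" for i
      by (rule locally_constant_compose[of T \<Psi> _ "\<lambda>p. fst p i"])
        (use \<Psi>(1) in \<open>simp_all add: continuous_epi_def \<sigma>_def\<close>)
    fix f assume f: "f \<in> I \<rightarrow> kernel A B \<alpha>"
    \<comment> \<open>Over the unit coset the cocycle is trivial, so every family with values in the
      kernel occurs; a preimage has second component \<open>L\<close> and thus lies in
      \<open>L\<close>.\<close>
    have "(restrict f I, L) \<in> carrier ?E"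
      using f coc'.cocycle_one \<Gamma>.one_closed by (auto simp: induced_extension_def kernel_def)
    then obtain x where x: "x \<in> carrier G" "\<Psi> x = (restrict f I, L)"
      using \<Psi>(1) unfolding continuous_epi_def by (metis imageE)
    then have "L #> x = L" "\<sigma> x = restrict f I" using \<Psi>el by auto
    then show "\<exists>x\<in>L. \<forall>i\<in>I. \<sigma> x i = f i"
      using coset_join1[OF _ x(1) L.subgroup_axioms] L.subset by (intro bexI[of _ x]) auto
  qed
qed

section \<open>Cocycles of coset actions\<close>

lemma (in group) l_coset_eq_iff:
  assumes K: "subgroup K G" and x: "x \<in> carrier G" and y: "y \<in> carrier G"
  shows "x <# K = y <# K \<longleftrightarrow> inv x \<otimes> y \<in> K"
proof -
  interpret K: subgroup K G by fact
  show ?thesis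
  proof
    assume "x <# K = y <# K"
    moreover have "y \<otimes> \<one> \<in> y <# K" using K.one_closed by (auto simp: l_coset_def)
    ultimately have "y \<in> x <# K" using y by simp
    then obtain k where "k \<in> K" "y = x \<otimes> k" using y by (auto simp: l_coset_def)
    then show "inv x \<otimes> y \<in> K" using x by (simp add: m_assoc[symmetric])
  next
    assume "inv x \<otimes> y \<in> K"
    moreover have "y = x \<otimes> (inv x \<otimes> y)" using x y by (simp add: m_assoc[symmetric])
    ultimately have "y \<in> x <# K" by (auto simp: l_coset_def)
    then show "x <# K = y <# K" using l_repr_independence[OF _ x K] by blast
  qed
qed

text \<open>Induction of \<open>\<phi>\<close> from \<open>K\<close> to \<open>G\<close>: with
  representatives \<open>t i\<close> of the cosets, \<open>x\<close> moves \<open>t i\<close> to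
  \<open>t (x <# i)\<close> times an element of \<open>K\<close>, to which \<open>\<phi>\<close> is
  applied. On \<open>L\<close> this element is a conjugate in \<open>L\<close>, so its value is
  trivial.\<close>

lemma (in group) coset_cocycle:
  assumes K: "subgroup K G" and B: "group B" and \<phi>: "\<phi> \<in> hom (G\<lparr>carrier := K\<rparr>) B"
    and L: "L \<lhd> G" "L \<subseteq> K" "\<And>l. l \<in> L \<Longrightarrow> \<phi> l = \<one>\<^bsub>B\<^esub>"
  obtains \<kappa> where "cocycle G B ((\<lambda>x. x <# K) ` carrier G) (l_coset G) \<kappa>"
    "\<And>k. k \<in> K \<Longrightarrow> \<kappa> k K = \<phi> k"
    "\<And>l i. l \<in> L \<Longrightarrow> i \<in> (\<lambda>x. x <# K) ` carrier G \<Longrightarrow> l <# i = i"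
    "\<And>l i. l \<in> L \<Longrightarrow> i \<in> (\<lambda>x. x <# K) ` carrier G \<Longrightarrow> \<kappa> l i = \<one>\<^bsub>B\<^esub>"
proof -
  interpret K: subgroup K G by fact
  interpret L: normal L G by fact
  interpret B: group B by fact
  let ?I = "(\<lambda>x. x <# K) ` carrier G"
  \<comment> \<open>The coset \<open>K\<close> gets the representative \<open>\<one>\<close>, so
    that the cocycle at \<open>K\<close> is \<open>\<phi>\<close> itself and not merely a conjugate
    of it.\<close>
  define t where "t = (\<lambda>i. if i = K then \<one> else SOME x. x \<in> carrier G \<and> i = x <# K)"
  have t: "t i \<in> carrier G" "t i <# K = i" if i: "i \<in> ?I" for i
  proof -
    have "t i \<in> carrier G \<and> i = t i <# K"
    proof (cases "i = K")
      case True
      then show ?thesis using K.subset by (simp add: t_def lcos_mult_one)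
    next
      case False
      obtain x where "x \<in> carrier G \<and> i = x <# K" using i by blast
      then show ?thesis unfolding t_def using False someI[of "\<lambda>x. x \<in> carrier G \<and> i = x <# K"] by simp
    qed
    then show "t i \<in> carrier G" "t i <# K = i" by auto
  qed
  have act_closed: "x <# i \<in> ?I" if "x \<in> carrier G" "i \<in> ?I" for x i
    using that K.subset by (auto simp: lcos_m_assoc)
  have act_mult: "(x \<otimes> y) <# i = x <# (y <# i)" if "x \<in> carrier G" "y \<in> carrier G" "i \<in> ?I" for x y i
    using that K.subset by (auto simp: lcos_m_assoc l_coset_subset_G m_assoc)
  have act_one: "\<one> <# i = i" if "i \<in> ?I" for i
    using that K.subset by (auto simp: lcos_m_assoc)
  have act_L: "l <# i = i" if l: "l \<in> L" and i: "i \<in> ?I" for l i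
  proof -
    have lG: "l \<in> carrier G" using l by auto
    have "inv t i \<otimes> (l \<otimes> t i) \<in> K"
      using L.inv_op_closed1[OF t(1)[OF i] l] L(2) t(1)[OF i] lG by (auto simp: m_assoc)
    then have "t i <# K = (l \<otimes> t i) <# K" using l_coset_eq_iff[OF K] t(1)[OF i] lG by simp
    then show ?thesis using t[OF i] lG K.subset by (metis lcos_m_assoc)
  qed
  define \<kappa> where "\<kappa> = (\<lambda>x i. \<phi> (inv t (x <# i) \<otimes> x \<otimes> t i))"
  have inK: "inv t (x <# i) \<otimes> x \<otimes> t i \<in> K" if x: "x \<in> carrier G" and i: "i \<in> ?I" for x i
  proof -
    have "t (x <# i) <# K = (x \<otimes> t i) <# K"
      using t[OF i] t(2)[OF act_closed[OF x i]] x K.subset by (simp add: lcos_m_assoc[symmetric])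
    then show ?thesis
      using l_coset_eq_iff[OF K, of "t (x <# i)" "x \<otimes> t i"] t(1)[OF i] t(1)[OF act_closed[OF x i]] x
      by (simp add: m_assoc)
  qed
  have KI: "K \<in> ?I" using K.subset by (force simp: lcos_mult_one intro: image_eqI[of _ _ \<one>])
  show ?thesis
  proof (rule that[of \<kappa>])
    show "cocycle G B ?I (l_coset G) \<kappa>"
    proof (unfold_locales, goal_cases)
      case (4 x i)
      then show ?case using inK[OF 4] \<phi> by (auto simp: \<kappa>_def hom_def)
    next
      case (5 x y i)
      have c: "t i \<in> carrier G" "t (y <# i) \<in> carrier G" "t ((x \<otimes> y) <# i) \<in> carrier G"
        using t(1) act_closed 5 by auto
      have "inv t ((x \<otimes> y) <# i) \<otimes> (x \<otimes> y) \<otimes> t i =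
        (inv t ((x \<otimes> y) <# i) \<otimes> x \<otimes> t (y <# i)) \<otimes> (inv t (y <# i) \<otimes> y \<otimes> t i)"
        using 5 c by (simp add: m_assoc inv_solve_left)
          (simp add: m_assoc[symmetric])
      moreover have "inv t ((x \<otimes> y) <# i) \<otimes> x \<otimes> t (y <# i) \<in> K"
        using inK[OF 5(1) act_closed[OF 5(2,3)]] act_mult[OF 5] by simp
      ultimately show ?case
        using \<phi> inK[OF 5(2,3)] act_mult[OF 5] by (simp add: \<kappa>_def hom_def)
    qed (use act_closed act_mult act_one in auto)
    show "\<kappa> k K = \<phi> k" if "k \<in> K" for k
    proof -
      have "k <# K = K" using that
        by (metis K.mem_carrier K.subset K lcos_mult_one l_repr_independence l_inv one_closed l_coset_eq_iff[OF K]
            inv_one l_one)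
      then show ?thesis using that by (simp add: \<kappa>_def t_def)
    qed
    show "l <# i = i" if "l \<in> L" "i \<in> ?I" for l i using act_L that .
    show "\<kappa> l i = \<one>\<^bsub>B\<^esub>" if l: "l \<in> L" and i: "i \<in> ?I" for l i
      using act_L[OF l i] L.inv_op_closed1[OF t(1)[OF i] l] L(3) by (simp add: \<kappa>_def)
  qed
qed

section \<open>Functoriality of the abelian-simple core\<close>

text \<open>Preimages of the subgroups defining the core of \<open>H\<close> occur among those
  defining the core of \<open>G\<close>, because the quotients are isomorphic. It is used for
  conjugations and for the projection to \<open>F/N\<close>.\<close>

lemma abelian_simple_core_hom:
  assumes \<pi>: "group_hom G H \<pi>" "\<pi> ` carrier G = carrier H"
    and cont: "continuous_map T U \<pi>" and T: "topspace T = carrier G"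
    and x: "x \<in> abelian_simple_core G T"
  shows "\<pi> x \<in> abelian_simple_core H U"
  unfolding abelian_simple_core_def
proof (intro InterI, clarify)
  interpret \<pi>: group_hom G H \<pi> by fact
  fix N assume N: "N \<lhd> H" "openin U N" "comm_group (H Mod N) \<or> simple_group (H Mod N)"
  interpret N: normal N H by fact
  define N' where "N' = {x \<in> carrier G. \<pi> x \<in> N}"
  define \<rho> where "\<rho> = (\<lambda>x. N #>\<^bsub>H\<^esub> \<pi> x)"
  have "\<rho> \<in> hom G (H Mod N)"
    using hom_compose[OF \<pi>.homh N.r_coset_hom_Mod] by (simp add: \<rho>_def o_def)
  then interpret \<rho>: group_hom G "H Mod N" \<rho>
    using N.factorgroup_is_group by (simp add: group_hom_def group_hom_axioms_def)
  have "\<rho> ` carrier G = (\<lambda>y. N #>\<^bsub>H\<^esub> y) ` \<pi> ` carrier G" by (auto simp: \<rho>_def)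
  then have \<rho>s: "\<rho> ` carrier G = carrier (H Mod N)" by (simp only: \<pi>(2) carrier_FactGroup)
  have ker: "kernel G (H Mod N) \<rho> = N'"
  proof -
    have "\<rho> x = N \<longleftrightarrow> \<pi> x \<in> N" if "x \<in> carrier G" for x
      using \<pi>.H.coset_join1[OF _ _ N.subgroup_axioms] \<pi>.H.coset_join2[OF _ N.subgroup_axioms]
        \<pi>.hom_closed[OF that] by (auto simp: \<rho>_def)
    then show ?thesis by (auto simp: kernel_def N'_def)
  qed
  then have iso: "(\<lambda>X. the_elem (\<rho> ` X)) \<in> iso (G Mod N') (H Mod N)"
    using \<rho>.FactGroup_iso_set[OF \<rho>s] by simp
  have N': "N' \<lhd> G" using \<rho>.normal_kernel ker by simp
  interpret N': normal N' G by fact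
  \<comment> \<open>The inverse isomorphism is the one required: commutativity and simplicity are
    known for \<open>H Mod N\<close> and have to be carried to \<open>G Mod N'\<close>.\<close>
  have iso': "inv_into (carrier (G Mod N')) (\<lambda>X. the_elem (\<rho> ` X)) \<in> iso (H Mod N) (G Mod N')"
    using group.iso_set_sym[OF N'.factorgroup_is_group iso] .
  have "openin T N'"
    using openin_continuous_map_preimage[OF cont N(2)] unfolding N'_def T .
  moreover have "comm_group (G Mod N') \<or> simple_group (G Mod N')"
    using N(3)
  proof
    assume "comm_group (H Mod N)"
    then show ?thesis
      using comm_group.iso_imp_comm_group[OF _ is_isoI[OF iso'] group.is_monoid[OF N'.factorgroup_is_group]] by blast
  next
    assume "simple_group (H Mod N)"
    then show ?thesis using simple_group.iso_simple[OF _ N'.factorgroup_is_group iso'] by blast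
  qed
  ultimately have "x \<in> N'" using x N' unfolding abelian_simple_core_def by blast
  then show "\<pi> x \<in> N" unfolding N'_def by blast
qed

text \<open>The whole group itself belongs to the intersected family, its quotient being trivial and
  hence abelian.\<close>

lemma (in group) abelian_simple_core_subset:
  assumes "topspace T = carrier G"
  shows "abelian_simple_core G T \<subseteq> carrier G"
proof -
  have "openin T (carrier G)" using assms openin_topspace by metis
  moreover have "comm_group (G Mod carrier G)"
  proof -
    interpret N: normal "carrier G" G by (rule normal_self)
    interpret Q: group "G Mod carrier G" by (rule N.factorgroup_is_group)
    have "X = \<one>\<^bsub>G Mod carrier G\<^esub>" if "X \<in> carrier (G Mod carrier G)" for X
      using that coset_join2[OF _ subgroup_self] by (auto simp: carrier_FactGroup)
    then show ?thesis using Q.group_comm_groupI by metis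
  qed
  ultimately show ?thesis using normal_self unfolding abelian_simple_core_def by blast
qed

lemma (in group) subgroup_abelian_simple_core:
  assumes "topspace T = carrier G"
  shows "subgroup (abelian_simple_core G T) G"
proof (rule subgroupI)
  show "abelian_simple_core G T \<subseteq> carrier G" by (rule abelian_simple_core_subset[OF assms])
  have "\<one> \<in> abelian_simple_core G T"
    by (auto simp: abelian_simple_core_def intro: subgroup.one_closed normal_imp_subgroup)
  then show "abelian_simple_core G T \<noteq> {}" by blast
qed (auto simp: abelian_simple_core_def intro: subgroup.m_inv_closed subgroup.m_closed normal_imp_subgroup)

text \<open>Conjugation by \<open>g\<close> restricts to a continuous automorphism of
  \<open>P\<close>, which preserves the core. Only continuity of conjugations enters, so that the
  lemma also applies to the coset topology on a quotient.\<close>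

lemma (in group) normal_abelian_simple_core:
  assumes "P \<lhd> G" and T: "topspace T = carrier G"
    and conj: "\<And>g. g \<in> carrier G \<Longrightarrow> continuous_map T T (\<lambda>x. g \<otimes> x \<otimes> inv g)"
  shows "abelian_simple_core (G\<lparr>carrier := P\<rparr>) (subtopology T P) \<lhd> G" (is "?D \<lhd> G")
proof -
  interpret P: normal P G by fact
  interpret PT: group "G\<lparr>carrier := P\<rparr>" by (rule subgroup_imp_group[OF P.subgroup_axioms])
  have topP: "topspace (subtopology T P) = carrier (G\<lparr>carrier := P\<rparr>)"
    using P.subset by (auto simp: T)
  show ?thesis
  proof (rule normal_invI)
    show "subgroup ?D G"
      using PT.subgroup_abelian_simple_core[OF topP] incl_subgroup[OF P.subgroup_axioms] by blast
    fix g d assume g: "g \<in> carrier G" and d: "d \<in> ?D"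
    let ?c = "\<lambda>x. g \<otimes> x \<otimes> inv g"
    have "?c \<in> hom (G\<lparr>carrier := P\<rparr>) (G\<lparr>carrier := P\<rparr>)"
    proof (rule homI)
      fix x y assume "x \<in> carrier (G\<lparr>carrier := P\<rparr>)" "y \<in> carrier (G\<lparr>carrier := P\<rparr>)"
      then have xy: "x \<in> P" "y \<in> P" "x \<in> carrier G" "y \<in> carrier G" using P.subset by auto
      then show "?c x \<in> carrier (G\<lparr>carrier := P\<rparr>)" using P.inv_op_closed2[OF g] by simp
      have "inv g \<otimes> (g \<otimes> z) = z" if "z \<in> carrier G" for z
        using g that by (simp add: m_assoc[symmetric])
      then show "?c (x \<otimes>\<^bsub>G\<lparr>carrier := P\<rparr>\<^esub> y) = ?c x \<otimes>\<^bsub>G\<lparr>carrier := P\<rparr>\<^esub> ?c y"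
        using g xy by (simp add: m_assoc)
    qed
    then have gh: "group_hom (G\<lparr>carrier := P\<rparr>) (G\<lparr>carrier := P\<rparr>) ?c"
      by (simp add: group_hom_def group_hom_axioms_def PT.is_group)
    have "x \<in> ?c ` P" if x: "x \<in> P" for x
    proof -
      have "x = ?c (inv g \<otimes> x \<otimes> g)"
      proof -
        have "g \<otimes> (inv g \<otimes> z) = z" if "z \<in> carrier G" for z
          using g that by (simp add: m_assoc[symmetric])
        then show ?thesis using g x P.subset by (simp add: m_assoc subset_iff)
      qed
      then show ?thesis using P.inv_op_closed1[OF g x] by blast
    qed
    then have surj: "?c ` carrier (G\<lparr>carrier := P\<rparr>) = carrier (G\<lparr>carrier := P\<rparr>)"
      using P.inv_op_closed2[OF g] by auto
    have "continuous_map (subtopology T P) (subtopology T P) ?c"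
      using conj[OF g] P.inv_op_closed2[OF g]
      by (auto simp: continuous_map_in_subtopology continuous_map_from_subtopology)
    from abelian_simple_core_hom[OF gh surj this topP d] show "?c d \<in> ?D" .
  qed
qed

lemma (in topological_group) continuous_map_conj:
  assumes "g \<in> carrier G"
  shows "continuous_map T T (\<lambda>x. g \<otimes> x \<otimes> inv g)"
  using assms by (intro continuous_map_mult) (simp_all add: topspace_eq)

section \<open>Extending homomorphisms to \<open>M L\<close> and separating cosets\<close>

lemma (in group) subgroup_mult_normal:
  assumes "subgroup M G" "L \<lhd> G"
  shows "subgroup (M <#> L) G"
  using mult_norm_subgroup[OF assms(2,1)] commut_normal[OF assms] by simp

text \<open>The extension sends \<open>m \<otimes> l\<close> to \<open>\<phi> m\<close>. Two choices
  of \<open>m\<close> differ by an element of \<open>L \<inter> M\<close>, where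
  \<open>\<phi>\<close> is trivial, so the choice by \<open>SOME\<close> does not matter.\<close>

lemma (in group) hom_mult_extension:
  assumes M: "subgroup M G" and L: "L \<lhd> G" and B: "group B"
    and \<phi>: "\<phi> \<in> hom (G\<lparr>carrier := M\<rparr>) B" and triv: "\<And>x. x \<in> L \<inter> M \<Longrightarrow> \<phi> x = \<one>\<^bsub>B\<^esub>"
  obtains \<phi>' where "\<phi>' \<in> hom (G\<lparr>carrier := M <#> L\<rparr>) B"
    "\<And>m. m \<in> M \<Longrightarrow> \<phi>' m = \<phi> m" "\<And>l. l \<in> L \<Longrightarrow> \<phi>' l = \<one>\<^bsub>B\<^esub>"
proof -
  interpret M: subgroup M G by fact
  interpret L: normal L G by fact
  interpret B: group B by fact
  interpret \<phi>: group_hom "G\<lparr>carrier := M\<rparr>" B \<phi>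
    using \<phi> B subgroup_imp_group[OF M] by (simp add: group_hom_def group_hom_axioms_def)
  define \<phi>' where "\<phi>' = (\<lambda>k. \<phi> (SOME m. m \<in> M \<and> inv m \<otimes> k \<in> L))"
  have \<phi>': "\<phi>' k = \<phi> m" if k: "k \<in> carrier G" and m: "m \<in> M" and mk: "inv m \<otimes> k \<in> L" for k m
  proof -
    define n where "n = (SOME m. m \<in> M \<and> inv m \<otimes> k \<in> L)"
    have "n \<in> M \<and> inv n \<otimes> k \<in> L" unfolding n_def by (rule someI[of _ m]) (use m mk in blast)
    then have n: "n \<in> M" "inv n \<otimes> k \<in> L" by auto
    have mG: "m \<in> carrier G" and nG: "n \<in> carrier G" using m n by auto
    have "(inv m \<otimes> k) \<otimes> inv (inv n \<otimes> k) = inv m \<otimes> (k \<otimes> inv k) \<otimes> n"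
      using mG nG k by (simp only: inv_mult_group m_assoc inv_closed m_closed inv_inv)
    then have "inv m \<otimes> n = (inv m \<otimes> k) \<otimes> inv (inv n \<otimes> k)" using mG nG k by simp
    then have "inv m \<otimes> n \<in> L" using mk n(2) by simp
    then have "\<phi> (inv m \<otimes> n) = \<one>\<^bsub>B\<^esub>" using triv m n by simp
    moreover have "\<phi> n = \<phi> m \<otimes>\<^bsub>B\<^esub> \<phi> (inv m \<otimes> n)"
      using \<phi>.hom_mult[of m "inv m \<otimes> n"] m n(1) mG nG by (simp add: m_assoc[symmetric])
    ultimately show ?thesis using m \<phi>.hom_closed[of m] by (simp add: \<phi>'_def n_def)
  qed
  have el: "\<exists>m\<in>M. k \<in> carrier G \<and> inv m \<otimes> k \<in> L" if "k \<in> M <#> L" for k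
  proof -
    obtain m l where "m \<in> M" "l \<in> L" "k = m \<otimes> l" using \<open>k \<in> M <#> L\<close> by (auto simp: set_mult_def)
    then show ?thesis by (intro bexI[of _ m]) (auto simp: m_assoc[symmetric])
  qed
  show ?thesis
  proof (rule that[of \<phi>'])
    show "\<phi>' m = \<phi> m" if "m \<in> M" for m using \<phi>'[of m m] that by simp
    show "\<phi>' l = \<one>\<^bsub>B\<^esub>" if "l \<in> L" for l
      using \<phi>'[of l \<one>] that \<phi>.hom_one by simp
    show "\<phi>' \<in> hom (G\<lparr>carrier := M <#> L\<rparr>) B"
    proof (rule homI)
      fix j k assume "j \<in> carrier (G\<lparr>carrier := M <#> L\<rparr>)" "k \<in> carrier (G\<lparr>carrier := M <#> L\<rparr>)"
      then obtain m n where m: "m \<in> M" "j \<in> carrier G" "inv m \<otimes> j \<in> L"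
        and n: "n \<in> M" "k \<in> carrier G" "inv n \<otimes> k \<in> L"
        using el[of j] el[of k] by auto
      have mG: "m \<in> carrier G" and nG: "n \<in> carrier G" using m n by auto
      show "\<phi>' j \<in> carrier B" using \<phi>'[OF m(2,1,3)] m(1) \<phi>.hom_closed by simp
      have "inv (m \<otimes> n) \<otimes> (j \<otimes> k) = (inv n \<otimes> (inv m \<otimes> j) \<otimes> n) \<otimes> (inv n \<otimes> k)"
      proof -
        have "n \<otimes> (inv n \<otimes> k) = k" using nG n by (simp add: m_assoc[symmetric])
        then show ?thesis using mG nG m n by (simp add: inv_mult_group m_assoc)
      qed
      also have "\<dots> \<in> L" using L.inv_op_closed1[OF nG m(3)] n(3) by blast
      finally have "inv (m \<otimes> n) \<otimes> (j \<otimes> k) \<in> L" .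
      then have "\<phi>' (j \<otimes> k) = \<phi> (m \<otimes> n)" using \<phi>' m n by simp
      also have "\<dots> = \<phi> m \<otimes>\<^bsub>B\<^esub> \<phi> n" using \<phi>.hom_mult[of m n] m n by simp
      finally show "\<phi>' (j \<otimes>\<^bsub>G\<lparr>carrier := M <#> L\<rparr>\<^esub> k) = \<phi>' j \<otimes>\<^bsub>B\<^esub> \<phi>' k"
        using \<phi>'[OF m(2,1,3)] \<phi>'[OF n(2,1,3)] by simp
    qed
  qed
qed

text \<open>
  Either \<^term>\<open>M\<close> has index at most 2 and hence is open, or \<^term>\<open>P\<close> provides three distinct
  cosets of \<^term>\<open>M\<close>, which remain distinct modulo a small open normal subgroup.
\<close>

lemma (in profinite_group) open_normal_separating:
  assumes M: "subgroup M G" "closedin T M" and P: "P \<subseteq> carrier G"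
    and MP: "\<And>x. x \<in> carrier G \<Longrightarrow> \<exists>p\<in>P. \<exists>m\<in>M. x = p \<otimes> m"
    and V: "openin T V" "\<one> \<in> V"
  obtains L where "L \<lhd> G" "openin T L" "L \<subseteq> V" "L \<subseteq> M"
  | L a b where "L \<lhd> G" "openin T L" "L \<subseteq> V" "a \<in> P" "b \<in> P"
    "a \<notin> M <#> L" "b \<notin> M <#> L" "inv a \<otimes> b \<notin> M <#> L"
proof -
  interpret M: subgroup M G by fact
  show ?thesis
  proof (cases "\<exists>a\<in>carrier G. \<exists>b\<in>carrier G. a \<notin> M \<and> b \<notin> M \<and> inv a \<otimes> b \<notin> M")
    case True
    then obtain a b where ab: "a \<in> carrier G" "b \<in> carrier G" "a \<notin> M" "b \<notin> M" "inv a \<otimes> b \<notin> M"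
      by blast
    \<comment> \<open>\<open>a\<close> and \<open>b\<close> are replaced by their factors in
      \<open>P\<close>, which represent the same cosets of \<open>M\<close>.\<close>
    obtain p m where p: "p \<in> P" "m \<in> M" "a = p \<otimes> m" using MP[OF ab(1)] by blast
    obtain q n where q: "q \<in> P" "n \<in> M" "b = q \<otimes> n" using MP[OF ab(2)] by blast
    have c: "p \<in> carrier G" "q \<in> carrier G" "m \<in> carrier G" "n \<in> carrier G" using p q P by auto
    have pM: "p \<notin> M" "q \<notin> M" using ab p q by auto
    have "inv a \<otimes> b = inv m \<otimes> (inv p \<otimes> q) \<otimes> n" using p q c by (simp add: inv_mult_group m_assoc)
    then have pqM: "inv p \<otimes> q \<notin> M" using ab(5) p q by auto
    \<comment> \<open>As \<open>M\<close> is closed, some neighbourhood \<open>W\<close> of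
      \<open>\<one>\<close> satisfies \<open>x W \<inter> M = {}\<close>, and this keeps
      \<open>x\<close> out of \<open>M L\<close> for every \<open>L\<close> inside
      \<open>W\<close>.\<close>
    have nb: "\<exists>W. openin T W \<and> \<one> \<in> W \<and> (\<forall>L. L \<lhd> G \<longrightarrow> L \<subseteq> W \<longrightarrow> x \<notin> M <#> L)"
      if x: "x \<in> carrier G" "x \<notin> M" for x
    proof (intro exI conjI allI impI notI)
      show "openin T {y \<in> carrier G. x \<otimes> y \<in> carrier G - M}"
        using M(2) x by (intro openin_translate) (auto simp: closedin_def topspace_eq)
      show "\<one> \<in> {y \<in> carrier G. x \<otimes> y \<in> carrier G - M}" using x by simp
      fix L assume L: "L \<lhd> G" "L \<subseteq> {y \<in> carrier G. x \<otimes> y \<in> carrier G - M}" "x \<in> M <#> L"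
      interpret L: normal L G by fact
      obtain m l where ml: "m \<in> M" "l \<in> L" "x = m \<otimes> l" using L(3) by (auto simp: set_mult_def)
      then have "x \<otimes> inv l = m" by (simp add: m_assoc)
      moreover have "inv l \<in> L" using ml by blast
      ultimately show False using L(2) ml(1) by auto
    qed
    obtain W1 where W1: "openin T W1" "\<one> \<in> W1" "\<And>L. L \<lhd> G \<Longrightarrow> L \<subseteq> W1 \<Longrightarrow> p \<notin> M <#> L"
      using nb[of p] c pM by blast
    obtain W2 where W2: "openin T W2" "\<one> \<in> W2" "\<And>L. L \<lhd> G \<Longrightarrow> L \<subseteq> W2 \<Longrightarrow> q \<notin> M <#> L"
      using nb[of q] c pM by blast
    obtain W3 where W3: "openin T W3" "\<one> \<in> W3" "\<And>L. L \<lhd> G \<Longrightarrow> L \<subseteq> W3 \<Longrightarrow> inv p \<otimes> q \<notin> M <#> L"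
      using nb[of "inv p \<otimes> q"] c pqM by blast
    have "openin T (V \<inter> (W1 \<inter> (W2 \<inter> W3)))" "\<one> \<in> V \<inter> (W1 \<inter> (W2 \<inter> W3))"
      using V W1 W2 W3 by auto
    then obtain L where "L \<lhd> G" "openin T L" "L \<subseteq> V \<inter> (W1 \<inter> (W2 \<inter> W3))"
      using open_normal_base by blast
    then show ?thesis using that(2)[of L p q] W1(3) W2(3) W3(3) p q by blast
  next
    case False
    have "openin T M"
    proof (cases "M = carrier G")
      case True
      then show ?thesis using openin_topspace topspace_eq by metis
    next
      case ne: False
      then obtain a where a: "a \<in> carrier G" "a \<notin> M" using M.subset by blast
      have "inv a \<otimes> x \<notin> M" if "x \<in> M" for x
      proof
        assume "inv a \<otimes> x \<in> M"
        then have "x \<otimes> inv (inv a \<otimes> x) \<in> M" using that by blast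
        then have "a \<in> M" using that a by (simp add: inv_mult_group m_assoc[symmetric])
        then show False using a by simp
      qed
      \<comment> \<open>The complement of \<open>M\<close> is the single coset \<open>a M\<close>;
        it is closed, and therefore \<open>M\<close> is open.\<close>
      then have "carrier G - M = {x \<in> carrier G. inv a \<otimes> x \<in> M}" using False a by blast
      then have "closedin T (topspace T - M)"
        using closedin_translate[OF M(2)] a by (simp add: topspace_eq)
      then show ?thesis using M.subset by (simp add: openin_closedin_eq topspace_eq)
    qed
    then have "openin T (V \<inter> M)" "\<one> \<in> V \<inter> M" using V by auto
    then obtain L where "L \<lhd> G" "openin T L" "L \<subseteq> V \<inter> M" using open_normal_base by blast
    then show ?thesis using that(1) by blast
  qed
qed

section \<open>Embedding problems for closed subgroups\<close>

text \<open>\<open>abelian_simple_core_congruence\<close> is applied inside \<open>P\<close>: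
  \<open>X\<close> collects the elements of \<open>L \<inter> P\<close> supported on
  \<open>S\<close>, and \<open>R\<close> those with all coordinates trivial. On \<open>L\<close> the
  coordinates are homomorphisms, so congruence modulo \<open>R\<close> means equal
  coordinates.\<close>

lemma (in profinite_group) abelian_simple_core_detects:
  assumes P: "P \<lhd> G" "closedin T P" and L: "L \<lhd> G" "closedin T L"
    and coc: "cocycle G A I act \<sigma>" and lc: "\<And>i. locally_constant T (\<lambda>x. \<sigma> x i)"
    and triv: "\<And>l i. l \<in> L \<Longrightarrow> i \<in> I \<Longrightarrow> act l i = i"
    and g: "g \<in> P"
    and comm: "\<And>x y i. \<lbrakk>x \<in> L; y \<in> L; i \<in> I; \<forall>j\<in>I - S. \<sigma> x j = \<one>\<^bsub>A\<^esub>; \<forall>j\<in>I - S. \<sigma> y j = \<one>\<^bsub>A\<^esub>\<rbrakk> \<Longrightarrow>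
      \<sigma> x i \<otimes>\<^bsub>A\<^esub> \<sigma> (g \<otimes> y \<otimes> inv g) i = \<sigma> (g \<otimes> y \<otimes> inv g) i \<otimes>\<^bsub>A\<^esub> \<sigma> x i"
    and s: "s \<in> P" and t: "t \<in> P" and v: "v = s \<otimes> t \<otimes> inv s \<otimes> inv t" "v \<in> L"
      "\<And>j. j \<in> I - S \<Longrightarrow> \<sigma> v j = \<one>\<^bsub>A\<^esub>"
  obtains q where "q \<in> abelian_simple_core (G\<lparr>carrier := P\<rparr>) (subtopology T P)" "q \<in> L"
    "\<And>i. i \<in> I \<Longrightarrow> \<sigma> q i = \<sigma> v i"
proof -
  interpret P: normal P G by fact
  interpret L: normal L G by fact
  interpret coc: cocycle G A I act \<sigma> by fact
  let ?H = "G\<lparr>carrier := P\<rparr>"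
  interpret H: profinite_group ?H "subtopology T P"
    by (rule closed_subgroup_profinite[OF P.subgroup_axioms P(2)])
  have Hinv: "inv\<^bsub>?H\<^esub> x = inv x" if "x \<in> P" for x
    using that m_inv_consistent[OF P.subgroup_axioms] by blast
  have \<sigma>mult: "\<sigma> (x \<otimes> y) i = \<sigma> x i \<otimes>\<^bsub>A\<^esub> \<sigma> y i" if "x \<in> carrier G" "y \<in> L" "i \<in> I" for x y i
    using that by (simp add: coc.cocycle_mult triv)
  have \<sigma>inv: "\<sigma> (inv x) i = inv\<^bsub>A\<^esub> \<sigma> x i" if "x \<in> L" "i \<in> I" for x i
    using that by (simp add: coc.cocycle_inv triv)
  have \<sigma>conj: "\<sigma> (h \<otimes> x \<otimes> inv h) i =
    \<sigma> h (act (inv h) i) \<otimes>\<^bsub>A\<^esub> \<sigma> x (act (inv h) i) \<otimes>\<^bsub>A\<^esub> inv\<^bsub>A\<^esub> \<sigma> h (act (inv h) i)"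
    if "h \<in> carrier G" "x \<in> L" "i \<in> I" for h x i
    using that triv by (intro coc.cocycle_conj) auto
  define X where "X = {x \<in> L \<inter> P. \<forall>i\<in>I - S. \<sigma> x i = \<one>\<^bsub>A\<^esub>}"
  define R where "R = {x \<in> L \<inter> P. \<forall>i\<in>I. \<sigma> x i = \<one>\<^bsub>A\<^esub>}"
  have LP: "L \<inter> P \<lhd> ?H"
    using normal_restrict_supergroup[OF P.subgroup_axioms normal_subgroup_intersect[OF L(1) P(1)]] by auto
  have sub: "subgroup {x \<in> L \<inter> P. \<forall>i\<in>J. \<sigma> x i = \<one>\<^bsub>A\<^esub>} G" if J: "J \<subseteq> I" for J
  proof (rule subgroupI)
    show "{x \<in> L \<inter> P. \<forall>i\<in>J. \<sigma> x i = \<one>\<^bsub>A\<^esub>} \<noteq> {}"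
      using J coc.cocycle_one L.one_closed P.one_closed by blast
  qed (use J in \<open>auto simp: \<sigma>mult \<sigma>inv subset_iff\<close>)
  have "R \<lhd> G"
  proof (rule normal_invI)
    show "subgroup R G" unfolding R_def using sub by blast
    fix h x assume hx: "h \<in> carrier G" "x \<in> R"
    then have "h \<otimes> x \<otimes> inv h \<in> L \<inter> P" using L.inv_op_closed2 P.inv_op_closed2 by (auto simp: R_def)
    then show "h \<otimes> x \<otimes> inv h \<in> R" using hx by (auto simp: R_def \<sigma>conj)
  qed
  moreover have "R \<subseteq> P" by (auto simp: R_def)
  ultimately have RH: "R \<lhd> ?H" using normal_restrict_supergroup[OF P.subgroup_axioms] by blast
  have XH: "subgroup X ?H"
    unfolding X_def by (rule subgroup_incl[OF sub P.subgroup_axioms]) auto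
  have Rc: "closedin (subtopology T P) R"
  proof -
    have "closedin T {x \<in> topspace T. \<sigma> x i \<in> {\<one>\<^bsub>A\<^esub>}}" for i
      by (rule locally_constant_closed_vimage[OF lc])
    then have "closedin T (\<Inter> (insert L ((\<lambda>i. {x \<in> topspace T. \<sigma> x i \<in> {\<one>\<^bsub>A\<^esub>}}) ` I)))"
      using L(2) by (intro closedin_Inter) blast+
    moreover have "R = \<Inter> (insert L ((\<lambda>i. {x \<in> topspace T. \<sigma> x i \<in> {\<one>\<^bsub>A\<^esub>}}) ` I)) \<inter> P"
      using L.subset by (auto simp: R_def topspace_eq)
    ultimately show ?thesis unfolding closedin_subtopology by blast
  qed
  have RX: "R \<subseteq> X" "X \<subseteq> L \<inter> P" by (auto simp: R_def X_def)
  have sG: "s \<in> carrier G" and tG: "t \<in> carrier G" and gG: "g \<in> carrier G" using s t g by auto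
  have vP: "v \<in> P" using v s t by simp
  have vX: "v \<in> X" using v vP by (simp add: X_def)
  have vD: "v \<in> derived ?H (carrier ?H)"
    using H.commutator_in_derived[of s t] s t v by (simp add: Hinv)
  \<comment> \<open>\<open>L\<close> fixes every index, so conjugation by its elements does not move
    supports.\<close>
  have Xn: "l \<otimes>\<^bsub>?H\<^esub> x \<otimes>\<^bsub>?H\<^esub> inv\<^bsub>?H\<^esub> l \<in> X" if l: "l \<in> L \<inter> P" and x: "x \<in> X" for l x
  proof -
    have "\<sigma> (l \<otimes> x \<otimes> inv l) i = \<one>\<^bsub>A\<^esub>" if "i \<in> I - S" for i
      using l x that by (simp add: \<sigma>conj X_def triv)
    then show ?thesis using l x by (auto simp: Hinv X_def)
  qed
  have cm: "x \<otimes>\<^bsub>?H\<^esub> (g \<otimes>\<^bsub>?H\<^esub> y \<otimes>\<^bsub>?H\<^esub> inv\<^bsub>?H\<^esub> g) \<otimes>\<^bsub>?H\<^esub> inv\<^bsub>?H\<^esub> x \<otimes>\<^bsub>?H\<^esub>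
      inv\<^bsub>?H\<^esub> (g \<otimes>\<^bsub>?H\<^esub> y \<otimes>\<^bsub>?H\<^esub> inv\<^bsub>?H\<^esub> g) \<in> R" if x: "x \<in> X" and y: "y \<in> X" for x y
  proof -
    define z where "z = g \<otimes> y \<otimes> inv g"
    have xLP: "x \<in> L" "x \<in> P" and yLP: "y \<in> L" "y \<in> P" using x y by (auto simp: X_def)
    have z: "z \<in> L" "z \<in> P" using yLP g gG L.inv_op_closed2 by (auto simp: z_def)
    have zG: "z \<in> carrier G" "x \<in> carrier G" using z xLP by auto
    have "\<sigma> (x \<otimes> z \<otimes> inv x \<otimes> inv z) i = \<one>\<^bsub>A\<^esub>" if i: "i \<in> I" for i
    proof -
      have "\<sigma> (x \<otimes> z \<otimes> inv x \<otimes> inv z) i = \<sigma> x i \<otimes>\<^bsub>A\<^esub> \<sigma> z i \<otimes>\<^bsub>A\<^esub> inv\<^bsub>A\<^esub> \<sigma> x i \<otimes>\<^bsub>A\<^esub> inv\<^bsub>A\<^esub> \<sigma> z i"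
        using xLP z zG i by (simp add: \<sigma>mult \<sigma>inv)
      also have "\<dots> = \<one>\<^bsub>A\<^esub>"
        using comm[of x y i] x y i zG by (subst coc.B.commutator_eq_one_iff) (auto simp: X_def z_def)
      finally show ?thesis .
    qed
    then show ?thesis using xLP z g yLP by (auto simp: R_def Hinv z_def)
  qed
  obtain q where q: "q \<in> abelian_simple_core ?H (subtopology T P)" "inv\<^bsub>?H\<^esub> v \<otimes>\<^bsub>?H\<^esub> q \<in> R"
    using H.abelian_simple_core_congruence[OF LP RH Rc RX XH Xn _ cm vX vD] g by auto
  have qP: "q \<in> P" using q(1) H.abelian_simple_core_subset[OF H.topspace_eq] by auto
  then have qG: "q \<in> carrier G" and vG: "v \<in> carrier G" using vP by auto
  have r: "inv v \<otimes> q \<in> R" using q(2) vP by (simp add: Hinv)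
  have qv: "q = v \<otimes> (inv v \<otimes> q)" using qG vG by (simp add: m_assoc[symmetric])
  have rL: "inv v \<otimes> q \<in> L" using r by (simp add: R_def)
  have "v \<otimes> (inv v \<otimes> q) \<in> L" using v(2) rL by blast
  then have qL: "q \<in> L" using qv by simp
  have "\<sigma> q i = \<sigma> v i" if i: "i \<in> I" for i
  proof -
    have "\<sigma> (v \<otimes> (inv v \<otimes> q)) i = \<sigma> v i"
      using \<sigma>mult[OF vG rL i] r i vG by (simp add: R_def)
    then show ?thesis using qv by simp
  qed
  then show ?thesis using that q(1) qL by blast
qed

text \<open>
  For \<open>\<gamma> \<in> C\<close> let \<open>w \<gamma> a = c \<otimes> (a \<otimes> inv c \<otimes> inv a)\<close>, where \<open>c \<in> L\<close> has value \<open>\<gamma>\<close> at \<open>p\<close> and is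
  trivial elsewhere. The element to be detected is the commutator of \<open>w \<gamma> a\<close> with \<open>inv b\<close> if \<open>C\<close> is
  abelian, and that of \<open>w \<gamma> a\<close> with \<open>w \<delta> b\<close> if \<open>\<gamma>, \<delta> \<in> C\<close> do not commute.
\<close>

lemma (in profinite_group) abelian_simple_core_nontrivial:
  assumes P: "P \<lhd> G" "closedin T P" and L: "L \<lhd> G" "closedin T L"
    and coc: "cocycle G A I act \<sigma>" and lc: "\<And>i. locally_constant T (\<lambda>x. \<sigma> x i)"
    and triv: "\<And>l i. l \<in> L \<Longrightarrow> i \<in> I \<Longrightarrow> act l i = i"
    and C: "subgroup C A" "C \<noteq> {\<one>\<^bsub>A\<^esub>}" and LC: "\<And>l i. l \<in> L \<Longrightarrow> i \<in> I \<Longrightarrow> \<sigma> l i \<in> C"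
    and CL: "\<And>f. f \<in> I \<rightarrow> C \<Longrightarrow> \<exists>x\<in>L. \<forall>i\<in>I. \<sigma> x i = f i"
    and ab: "a \<in> P" "b \<in> P" and p: "p \<in> I" "act a p \<noteq> p" "act b p \<noteq> p" "act a p \<noteq> act b p"
  obtains q where "q \<in> abelian_simple_core (G\<lparr>carrier := P\<rparr>) (subtopology T P)" "q \<in> L"
    "\<sigma> q p \<noteq> \<one>\<^bsub>A\<^esub>"
proof -
  interpret P: normal P G by fact
  interpret L: normal L G by fact
  interpret coc: cocycle G A I act \<sigma> by fact
  interpret C: subgroup C A by fact
  have \<sigma>mult: "\<sigma> (x \<otimes> y) i = \<sigma> x i \<otimes>\<^bsub>A\<^esub> \<sigma> y i" if "x \<in> carrier G" "y \<in> L" "i \<in> I" for x y i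
    using that by (simp add: coc.cocycle_mult triv)
  have \<sigma>inv: "\<sigma> (inv x) i = inv\<^bsub>A\<^esub> \<sigma> x i" if "x \<in> L" "i \<in> I" for x i
    using that by (simp add: coc.cocycle_inv triv)
  have \<sigma>conj: "\<sigma> (h \<otimes> x \<otimes> inv h) i = \<one>\<^bsub>A\<^esub>"
    if "h \<in> carrier G" "x \<in> L" "i \<in> I" "\<sigma> x (act (inv h) i) = \<one>\<^bsub>A\<^esub>" for h x i
    using that triv by (subst coc.cocycle_conj) auto
  have abG: "a \<in> carrier G" "b \<in> carrier G" using ab by auto
  have w: "\<exists>w\<in>L \<inter> P. \<sigma> w p = \<gamma> \<and> (\<forall>i\<in>I - {p, act h p}. \<sigma> w i = \<one>\<^bsub>A\<^esub>)"
    if \<gamma>: "\<gamma> \<in> C" and h: "h \<in> P" "act h p \<noteq> p" for \<gamma> h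
  proof -
    have hG: "h \<in> carrier G" using h by auto
    obtain c where c: "c \<in> L" "\<forall>i\<in>I. \<sigma> c i = (if i = p then \<gamma> else \<one>\<^bsub>A\<^esub>)"
      using CL[of "\<lambda>i. if i = p then \<gamma> else \<one>\<^bsub>A\<^esub>"] \<gamma> C.one_closed by auto
    have cG: "c \<in> carrier G" using c by auto
    \<comment> \<open>\<open>c\<close> need not lie in \<open>P\<close>, but
      \<open>c \<otimes> ?d\<close> is its commutator with \<open>h \<in> P\<close> and does. The
      price is a second point \<open>act h p\<close> in the support.\<close>
    let ?d = "h \<otimes> inv c \<otimes> inv h"
    have dL: "?d \<in> L" using L.inv_op_closed2[OF hG] c(1) by blast
    have d1: "\<sigma> ?d i = \<one>\<^bsub>A\<^esub>" if i: "i \<in> I" "i \<noteq> act h p" for i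
    proof (rule \<sigma>conj[OF hG _ i(1)])
      have "act (inv h) i \<noteq> p" using coc.act_inv_act(2)[OF hG i(1)] i(2) by auto
      then show "\<sigma> (inv c) (act (inv h) i) = \<one>\<^bsub>A\<^esub>"
        using c i hG by (simp add: \<sigma>inv)
    qed (use c in blast)
    have "c \<otimes> ?d \<in> L" using c dL by blast
    moreover have "c \<otimes> ?d \<in> P"
    proof -
      have "c \<otimes> h \<otimes> inv c \<otimes> inv h \<in> P" using P.inv_op_closed2[OF cG h(1)] h(1) by blast
      then show ?thesis using cG hG by (simp add: m_assoc)
    qed
    moreover have "\<sigma> (c \<otimes> ?d) p = \<gamma>"
      using c d1[of p] h p(1) cG dL \<gamma> C.subset by (auto simp: \<sigma>mult)
    moreover have "\<sigma> (c \<otimes> ?d) i = \<one>\<^bsub>A\<^esub>" if "i \<in> I - {p, act h p}" for i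
      using c d1[of i] that cG dL by (simp add: \<sigma>mult)
    ultimately show ?thesis by blast
  qed
  show ?thesis
  proof (cases "\<forall>\<gamma>\<in>C. \<forall>\<delta>\<in>C. \<gamma> \<otimes>\<^bsub>A\<^esub> \<delta> = \<delta> \<otimes>\<^bsub>A\<^esub> \<gamma>")
    case True
    obtain \<gamma> where \<gamma>: "\<gamma> \<in> C" "\<gamma> \<noteq> \<one>\<^bsub>A\<^esub>" using C(2) C.one_closed by blast
    obtain w where w: "w \<in> L" "w \<in> P" "\<sigma> w p = \<gamma>" "\<And>i. i \<in> I - {p, act a p} \<Longrightarrow> \<sigma> w i = \<one>\<^bsub>A\<^esub>"
      using w[OF \<gamma>(1) ab(1) p(2)] by blast
    have wG: "w \<in> carrier G" using w by auto
    define v where "v = w \<otimes> inv b \<otimes> inv w \<otimes> inv (inv b)"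
    have v: "v = w \<otimes> (inv b \<otimes> inv w \<otimes> inv (inv b))" using wG abG by (simp add: v_def m_assoc)
    have eL: "inv b \<otimes> inv w \<otimes> inv (inv b) \<in> L" using L.inv_op_closed2[of "inv b" "inv w"] w abG by simp
    have vL: "v \<in> L" unfolding v using w eL by blast
    \<comment> \<open>The conjugate has at \<open>p\<close> a value conjugate to that of
      \<open>inv w\<close> at \<open>act b p\<close>, which lies outside the support
      \<open>{p, act a p}\<close>. So \<open>\<gamma>\<close> survives at \<open>p\<close>.\<close>
    have "\<sigma> (inv b \<otimes> inv w \<otimes> inv (inv b)) p = \<one>\<^bsub>A\<^esub>"
      using w p abG by (intro \<sigma>conj) (auto simp: \<sigma>inv)
    then have "\<sigma> v p = \<gamma>" unfolding v using wG eL p(1) w(3) \<gamma> C.subset by (auto simp: \<sigma>mult)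
    moreover obtain q where "q \<in> abelian_simple_core (G\<lparr>carrier := P\<rparr>) (subtopology T P)" "q \<in> L"
      "\<And>i. i \<in> I \<Longrightarrow> \<sigma> q i = \<sigma> v i"
    \<comment> \<open>All coordinates on \<open>L\<close> lie in the commutative \<open>C\<close>,
      so no restriction of supports is required: \<open>S\<close> is \<open>I\<close>, and the
      conjugating element is \<open>\<one>\<close>.\<close>
    proof (rule abelian_simple_core_detects[OF P L coc lc triv P.one_closed _ w(2) _ v_def vL, where S = I])
      fix x y i assume xy: "x \<in> L" "y \<in> L" "i \<in> I"
      then have "\<sigma> x i \<in> C" "\<sigma> (\<one> \<otimes> y \<otimes> inv \<one>) i \<in> C"
        using LC by simp_all
      then show "\<sigma> x i \<otimes>\<^bsub>A\<^esub> \<sigma> (\<one> \<otimes> y \<otimes> inv \<one>) i = \<sigma> (\<one> \<otimes> y \<otimes> inv \<one>) i \<otimes>\<^bsub>A\<^esub> \<sigma> x i"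
        using True by blast
    qed (use ab in auto)
    ultimately show ?thesis using that p(1) \<gamma> by metis
  next
    case False
    then obtain \<gamma> \<delta> where \<gamma>: "\<gamma> \<in> C" and \<delta>: "\<delta> \<in> C" and \<gamma>\<delta>: "\<gamma> \<otimes>\<^bsub>A\<^esub> \<delta> \<noteq> \<delta> \<otimes>\<^bsub>A\<^esub> \<gamma>" by blast
    obtain s where s: "s \<in> L" "s \<in> P" "\<sigma> s p = \<gamma>" "\<And>i. i \<in> I - {p, act a p} \<Longrightarrow> \<sigma> s i = \<one>\<^bsub>A\<^esub>"
      using w[OF \<gamma> ab(1) p(2)] by blast
    obtain t where t: "t \<in> L" "t \<in> P" "\<sigma> t p = \<delta>" "\<And>i. i \<in> I - {p, act b p} \<Longrightarrow> \<sigma> t i = \<one>\<^bsub>A\<^esub>"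
      using w[OF \<delta> ab(2) p(3)] by blast
    have stG: "s \<in> carrier G" "t \<in> carrier G" using s t by auto
    define v where "v = s \<otimes> t \<otimes> inv s \<otimes> inv t"
    have vL: "v \<in> L" using s t by (simp add: v_def)
    have \<sigma>v: "\<sigma> v i = \<sigma> s i \<otimes>\<^bsub>A\<^esub> \<sigma> t i \<otimes>\<^bsub>A\<^esub> inv\<^bsub>A\<^esub> \<sigma> s i \<otimes>\<^bsub>A\<^esub> inv\<^bsub>A\<^esub> \<sigma> t i" if "i \<in> I" for i
      using s t stG that by (simp add: v_def \<sigma>mult \<sigma>inv)
    \<comment> \<open>The supports \<open>{p, act a p}\<close> and \<open>{p, act b p}\<close> meet
      only in \<open>p\<close>, and a commutator is trivial wherever one of its entries is.\<close>
    have v1: "\<sigma> v i = \<one>\<^bsub>A\<^esub>" if i: "i \<in> I - {p}" for i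
    proof -
      have "\<sigma> s i = \<one>\<^bsub>A\<^esub> \<or> \<sigma> t i = \<one>\<^bsub>A\<^esub>" using s(4)[of i] t(4)[of i] i p(4) by auto
      then show ?thesis using \<sigma>v[of i] i stG by auto
    qed
    have vp: "\<sigma> v p \<noteq> \<one>\<^bsub>A\<^esub>"
      using \<sigma>v[OF p(1)] s t \<gamma> \<delta> \<gamma>\<delta> coc.B.commutator_eq_one_iff[of \<gamma> \<delta>] C.subset by auto
    obtain q where "q \<in> abelian_simple_core (G\<lparr>carrier := P\<rparr>) (subtopology T P)" "q \<in> L"
      "\<And>i. i \<in> I \<Longrightarrow> \<sigma> q i = \<sigma> v i"
    \<comment> \<open>Conjugation by \<open>a\<close> moves the support from \<open>p\<close> to
      \<open>act a p\<close>, so elements supported at \<open>p\<close> commute coordinatewise with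
      such conjugates.\<close>
    proof (rule abelian_simple_core_detects[OF P L coc lc triv ab(1) _ s(2) t(2) v_def vL v1, where S = "{p}"])
      fix x y i assume xy: "x \<in> L" "y \<in> L" "i \<in> I"
        "\<forall>j\<in>I - {p}. \<sigma> x j = \<one>\<^bsub>A\<^esub>" "\<forall>j\<in>I - {p}. \<sigma> y j = \<one>\<^bsub>A\<^esub>"
      have z: "a \<otimes> y \<otimes> inv a \<in> carrier G" "x \<in> carrier G" using abG xy by auto
      show "\<sigma> x i \<otimes>\<^bsub>A\<^esub> \<sigma> (a \<otimes> y \<otimes> inv a) i = \<sigma> (a \<otimes> y \<otimes> inv a) i \<otimes>\<^bsub>A\<^esub> \<sigma> x i"
      proof (cases "i = p")
        case True
        have "act (inv a) p \<noteq> p" using coc.act_inv_act(2)[OF abG(1) p(1)] p(2) by auto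
        then have "\<sigma> (a \<otimes> y \<otimes> inv a) p = \<one>\<^bsub>A\<^esub>"
          using xy abG p(1) by (intro \<sigma>conj) auto
        then show ?thesis using True z p(1) by simp
      next
        case False
        then have "\<sigma> x i = \<one>\<^bsub>A\<^esub>" using xy by simp
        then show ?thesis using z xy(3) by simp
      qed
    qed auto
    then show ?thesis using that p(1) vp by metis
  qed
qed

lemma (in profinite_group) embedding_property_step:
  assumes EP: "embedding_property G T"
    and M: "subgroup M G" "closedin T M" and P: "P \<lhd> G" "closedin T P"
    and MP: "\<And>x. x \<in> carrier G \<Longrightarrow> \<exists>p\<in>P. \<exists>m\<in>M. x = p \<otimes> m"
    and PM: "abelian_simple_core (G\<lparr>carrier := P\<rparr>) (subtopology T P) \<subseteq> M"
  shows "embedding_property (G\<lparr>carrier := M\<rparr>) (subtopology T M)"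
proof (rule embedding_property_minimalI)
  interpret M: subgroup M G by fact
  interpret P: normal P G by fact
  let ?M = "G\<lparr>carrier := M\<rparr>" and ?TM = "subtopology T M"
  interpret MT: topological_group ?M ?TM by (rule subgroup_topological[OF M(1)])
  show "topspace ?TM = carrier ?M" by (rule MT.topspace_eq)
  have tM: "topspace ?TM = M" using MT.topspace_eq by simp
  fix A B :: "nat monoid" and \<alpha> \<phi>
  assume A: "group A" "finite (carrier A)" and B: "group B"
    and \<alpha>: "\<alpha> \<in> hom A B" "\<alpha> ` carrier A = carrier B" and \<phi>: "continuous_epi ?M ?TM B \<phi>"
    and C1: "kernel A B \<alpha> \<noteq> {\<one>\<^bsub>A\<^esub>}"
    and min: "\<And>J. J \<lhd> A \<Longrightarrow> J \<subseteq> kernel A B \<alpha> \<Longrightarrow> J = {\<one>\<^bsub>A\<^esub>} \<or> J = kernel A B \<alpha>"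
  interpret A: group A by fact
  interpret B: group B by fact
  interpret \<alpha>: group_hom A B \<alpha> using \<alpha> by (simp add: group_hom_def group_hom_axioms_def A B)
  define C where "C = kernel A B \<alpha>"
  have C: "subgroup C A" unfolding C_def by (rule \<alpha>.subgroup_kernel)
  interpret C: subgroup C A by fact
  have \<phi>h: "\<phi> \<in> hom ?M B" and \<phi>s: "\<phi> ` M = carrier B" and \<phi>l: "locally_constant ?TM \<phi>"
    using \<phi> by (simp_all add: continuous_epi_def)
  interpret \<phi>: group_hom ?M B \<phi>
    using \<phi>h B MT.is_group by (simp add: group_hom_def group_hom_axioms_def)
  have "openin ?TM {x \<in> topspace ?TM. \<phi> x = \<one>\<^bsub>B\<^esub>}" using \<phi>l by (simp add: locally_constant_def)
  \<comment> \<open>\<open>V\<close> cuts out the kernel of \<open>\<phi>\<close>. Every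
    \<open>L\<close> inside \<open>V\<close> meets \<open>M\<close> in that kernel, so that
    \<open>\<phi>\<close> extends to \<open>M L\<close> with trivial values on
    \<open>L\<close>.\<close>
  then obtain V where V: "openin T V" "{x \<in> M. \<phi> x = \<one>\<^bsub>B\<^esub>} = V \<inter> M"
    unfolding openin_subtopology tM by blast
  have "\<one> \<in> {x \<in> M. \<phi> x = \<one>\<^bsub>B\<^esub>}" using \<phi>.hom_one by simp
  then have V1: "\<one> \<in> V" unfolding V(2) by blast
  have "\<exists>L. L \<lhd> G \<and> openin T L \<and> L \<subseteq> V \<and> (L \<subseteq> M \<or> (\<exists>a\<in>P. \<exists>b\<in>P.
      a \<notin> M <#> L \<and> b \<notin> M <#> L \<and> inv a \<otimes> b \<notin> M <#> L))"
  proof (rule open_normal_separating[OF M P.subset MP V(1) V1])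
    fix L assume "L \<lhd> G" "openin T L" "L \<subseteq> V" "L \<subseteq> M"
    then show ?thesis by blast
  next
    fix L a b assume "L \<lhd> G" "openin T L" "L \<subseteq> V" "a \<in> P" "b \<in> P"
      "a \<notin> M <#> L" "b \<notin> M <#> L" "inv a \<otimes> b \<notin> M <#> L"
    then show ?thesis by blast
  qed
  then obtain L where L: "L \<lhd> G" "openin T L" "L \<subseteq> V"
    and sep: "L \<subseteq> M \<or> (\<exists>a\<in>P. \<exists>b\<in>P. a \<notin> M <#> L \<and> b \<notin> M <#> L \<and> inv a \<otimes> b \<notin> M <#> L)"
    by blast
  interpret L: normal L G by fact
  define K where "K = M <#> L"
  have K: "subgroup K G" unfolding K_def by (rule subgroup_mult_normal[OF M(1) L(1)])
  interpret K: subgroup K G by fact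
  have MLK: "m \<otimes> l \<in> K" if "m \<in> M" "l \<in> L" for m l
    using that unfolding K_def set_mult_def by blast
  have LK: "L \<subseteq> K" using MLK[OF M.one_closed] L.subset by auto
  have MK: "M \<subseteq> K" using MLK[OF _ L.one_closed] M.subset by auto
  have "\<phi> x = \<one>\<^bsub>B\<^esub>" if "x \<in> L \<inter> M" for x using that V(2) L(3) by blast
  then obtain \<phi>' where \<phi>': "\<phi>' \<in> hom (G\<lparr>carrier := K\<rparr>) B"
    "\<And>m. m \<in> M \<Longrightarrow> \<phi>' m = \<phi> m" "\<And>l. l \<in> L \<Longrightarrow> \<phi>' l = \<one>\<^bsub>B\<^esub>"
    using hom_mult_extension[OF M(1) L(1) B \<phi>h] unfolding K_def by metis
  define I where "I = (\<lambda>x. x <# K) ` carrier G"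
  let ?act = "l_coset G"
  obtain \<kappa> where \<kappa>: "cocycle G B I ?act \<kappa>" "\<And>k. k \<in> K \<Longrightarrow> \<kappa> k K = \<phi>' k"
    "\<And>l i. l \<in> L \<Longrightarrow> i \<in> I \<Longrightarrow> l <# i = i" "\<And>l i. l \<in> L \<Longrightarrow> i \<in> I \<Longrightarrow> \<kappa> l i = \<one>\<^bsub>B\<^esub>"
    using coset_cocycle[OF K B \<phi>'(1) L(1) LK \<phi>'(3), folded I_def] by metis
  interpret \<kappa>: cocycle G B I ?act \<kappa> by fact
  \<comment> \<open>A coset of \<open>K\<close> can be recovered from the coset of \<open>L\<close>
    it comes from; hence \<open>I\<close> is an image of the finite group
    \<open>G/L\<close>.\<close>
  have "x <# K = (\<Union>y\<in>L #> x. y <# K)" if x: "x \<in> carrier G" for x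
  proof -
    have "(l \<otimes> x) <# K = x <# K" if "l \<in> L" for l
      using \<kappa>(3)[OF that, of "x <# K"] x that K.subset by (simp add: lcos_m_assoc I_def)
    moreover have "L \<noteq> {}" using L.one_closed by blast
    ultimately show ?thesis by (auto simp: r_coset_def)
  qed
  then have "I \<subseteq> (\<lambda>X. \<Union>y\<in>X. y <# K) ` carrier (G Mod L)"
    unfolding carrier_FactGroup I_def by blast
  then have finI: "finite I"
    using finite_open_quotient[OF L(1,2)] by (rule finite_subset[OF _ finite_imageI])
  have KI: "K \<in> I" using lcos_mult_one[OF K.subset] imageI[OF one_closed, of "\<lambda>x. x <# K"]
    by (simp add: I_def)
  obtain \<sigma> where \<sigma>: "cocycle G A I ?act \<sigma>"
    "\<And>x i. x \<in> carrier G \<Longrightarrow> i \<in> I \<Longrightarrow> \<alpha> (\<sigma> x i) = \<kappa> x i"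
    "\<And>i. locally_constant T (\<lambda>x. \<sigma> x i)"
    "\<And>f. f \<in> I \<rightarrow> C \<Longrightarrow> \<exists>x\<in>L. \<forall>i\<in>I. \<sigma> x i = f i"
    using lift_cocycle[OF EP L(1,2) finI \<kappa>(1,3,4) A \<alpha>] unfolding C_def by metis
  interpret \<sigma>: cocycle G A I ?act \<sigma> by fact
  \<comment> \<open>The coset \<open>K\<close> is fixed exactly by \<open>K\<close>, so evaluation
    there turns the cocycle into a homomorphism on \<open>K\<close>, which lifts
    \<open>\<phi>\<close> on \<open>M\<close>.\<close>
  define \<psi> where "\<psi> = (\<lambda>x. \<sigma> x K)"
  have actK: "x <# K = K \<longleftrightarrow> x \<in> K" if "x \<in> carrier G" for x
    using l_coset_eq_iff[OF K one_closed that] K.subset that by (auto simp: lcos_mult_one)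
  have \<psi>c: "\<psi> x \<in> carrier A" if "x \<in> carrier G" for x using that KI by (simp add: \<psi>_def)
  have \<psi>m: "\<psi> (x \<otimes> y) = \<psi> x \<otimes>\<^bsub>A\<^esub> \<psi> y" if "x \<in> carrier G" "y \<in> K" for x y
    using that KI actK[of y] by (simp add: \<psi>_def \<sigma>.cocycle_mult)
  have \<alpha>\<psi>: "\<alpha> (\<psi> x) = \<phi> x" if "x \<in> M" for x
    using that MK \<sigma>(2)[of x K] KI \<kappa>(2) \<phi>'(2) by (auto simp: \<psi>_def)
  have LC: "\<sigma> l i \<in> C" if "l \<in> L" "i \<in> I" for l i
  proof -
    have lG: "l \<in> carrier G" using that(1) L.subset by blast
    have "\<alpha> (\<sigma> l i) = \<one>\<^bsub>B\<^esub>" using \<sigma>(2)[OF lG that(2)] \<kappa>(4)[OF that] by (rule trans)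
    then show ?thesis using \<sigma>.cocycle_closed[OF lG that(2)] unfolding C_def kernel_def by blast
  qed
  have CL: "\<exists>l\<in>L. \<psi> l = c" if c: "c \<in> C" for c
  proof -
    obtain l where "l \<in> L" "\<forall>i\<in>I. \<sigma> l i = c" using \<sigma>(4)[of "\<lambda>_. c"] c by auto
    then show ?thesis using KI unfolding \<psi>_def by blast
  qed
  have quo: "inv\<^bsub>A\<^esub> \<psi> m \<otimes>\<^bsub>A\<^esub> a \<in> C" if a: "a \<in> carrier A" and m: "m \<in> M" "\<alpha> a = \<phi> m" for a m
  proof -
    have p: "\<psi> m \<in> carrier A" using \<psi>c[of m] m(1) M.subset by blast
    have "\<alpha> (inv\<^bsub>A\<^esub> \<psi> m \<otimes>\<^bsub>A\<^esub> a) = inv\<^bsub>B\<^esub> \<alpha> (\<psi> m) \<otimes>\<^bsub>B\<^esub> \<alpha> a" using a p by simp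
    also have "\<dots> = inv\<^bsub>B\<^esub> \<alpha> a \<otimes>\<^bsub>B\<^esub> \<alpha> a" unfolding \<alpha>\<psi>[OF m(1)] m(2) by (rule refl)
    also have "\<dots> = \<one>\<^bsub>B\<^esub>" by (rule B.l_inv[OF \<alpha>.hom_closed[OF a]])
    finally show ?thesis using a p unfolding C_def kernel_def by blast
  qed
  \<comment> \<open>What remains is that \<open>M\<close> alone, and not only \<open>L\<close>,
    reaches all of \<open>C\<close>.\<close>
  have key: "\<exists>m\<in>M. \<psi> m = c" if c: "c \<in> C" for c
  proof (cases "L \<subseteq> M")
    case True
    then show ?thesis using CL[OF c] by blast
  next
    case False
    then obtain a b where ab: "a \<in> P" "b \<in> P" "a \<notin> K" "b \<notin> K" "inv a \<otimes> b \<notin> K"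
      using sep unfolding K_def by blast
    have abG: "a \<in> carrier G" "b \<in> carrier G" using ab by auto
    let ?D = "abelian_simple_core (G\<lparr>carrier := P\<rparr>) (subtopology T P)"
    have "C \<noteq> {\<one>\<^bsub>A\<^esub>}" using C1 by (simp add: C_def)
    \<comment> \<open>With base point \<open>K\<close>, the three conditions on \<open>a\<close> and
      \<open>b\<close> say that the cosets of \<open>\<one>\<close>, \<open>a\<close> and
      \<open>b\<close> are distinct points of \<open>I\<close>.\<close>
    then obtain q where q: "q \<in> ?D" "q \<in> L" "\<sigma> q K \<noteq> \<one>\<^bsub>A\<^esub>"
      using abelian_simple_core_nontrivial[OF P L(1) closedin_open_subgroup[OF L.subgroup_axioms L(2)]
          \<sigma>(1,3) \<kappa>(3) C _ LC \<sigma>(4) ab(1,2) KI]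
        actK abG ab l_coset_eq_iff[OF K abG] by metis
    have "?D \<lhd> G" by (rule normal_abelian_simple_core[OF P(1) topspace_eq continuous_map_conj])
    then have DL: "?D \<inter> L \<lhd> G" by (rule normal_subgroup_intersect[OF _ L(1)])
    interpret DL: normal "?D \<inter> L" G by fact
    have DLK: "x \<in> K" if "x \<in> ?D \<inter> L" for x using that LK by blast
    define J where "J = \<psi> ` (?D \<inter> L)"
    have JC: "J \<subseteq> C" using LC KI by (auto simp: J_def \<psi>_def)
    have "J \<lhd> A"
    proof (rule A.normal_invI)
      show "subgroup J A"
      proof (rule A.subgroupI)
        show "J \<subseteq> carrier A" using JC C.subset by blast
        show "J \<noteq> {}" using q by (auto simp: J_def)
      next
        fix a assume "a \<in> J"
        then obtain x where x: "x \<in> ?D \<inter> L" "a = \<psi> x" by (auto simp: J_def)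
        have xG: "x \<in> carrier G" using x(1) DL.subset by blast
        have "\<psi> (inv x) = inv\<^bsub>A\<^esub> \<psi> x"
          using \<sigma>.cocycle_inv[OF xG KI] actK[of "inv x"] DLK[of "inv x"] x xG DL.m_inv_closed
          by (simp add: \<psi>_def)
        then show "inv\<^bsub>A\<^esub> a \<in> J" using x DL.m_inv_closed[of x] unfolding J_def by force
      next
        fix a b assume "a \<in> J" "b \<in> J"
        then obtain x y where "x \<in> ?D \<inter> L" "a = \<psi> x" "y \<in> ?D \<inter> L" "b = \<psi> y" by (auto simp: J_def)
        then show "a \<otimes>\<^bsub>A\<^esub> b \<in> J"
          using \<psi>m[of x y] DL.m_closed[of x y] DLK[of y] DL.subset unfolding J_def
          by (metis imageI subsetD)
      qed
      fix a j assume a: "a \<in> carrier A" and "j \<in> J"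
      then obtain x where x: "x \<in> ?D \<inter> L" "j = \<psi> x" by (auto simp: J_def)
      have xG: "x \<in> carrier G" using x(1) DL.subset by blast
      have "\<alpha> a \<in> \<phi> ` M" using a \<phi>s \<alpha>.hom_closed by blast
      then obtain m where m: "m \<in> M" "\<alpha> a = \<phi> m" by blast
      have mG: "m \<in> carrier G" using m by auto
      have "inv\<^bsub>A\<^esub> \<psi> m \<otimes>\<^bsub>A\<^esub> a \<in> C" by (rule quo[OF a m])
      then obtain l where l: "l \<in> L" "\<psi> l = inv\<^bsub>A\<^esub> \<psi> m \<otimes>\<^bsub>A\<^esub> a" using CL by blast
      \<comment> \<open>Every \<open>a\<close> is a value of \<open>\<psi>\<close> on
        \<open>K = M L\<close>: the factor from \<open>M\<close> matches its image in
        \<open>B\<close>, and the one from \<open>L\<close> corrects by an element of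
        \<open>C\<close>. Since \<open>?D \<inter> L\<close> is normal in \<open>G\<close>, its
        image is therefore invariant under all of \<open>A\<close>.\<close>
      define k where "k = m \<otimes> l"
      have k: "k \<in> K" using l m LK MK by (auto simp: k_def)
      then have kG: "k \<in> carrier G" using K.subset by blast
      have "\<psi> k = a"
        using \<psi>m[OF mG, of l] l LK a \<psi>c[OF mG] by (auto simp: k_def A.m_assoc[symmetric])
      have lx: "x <# i = i" if "i \<in> I" for i using \<kappa>(3) x that by blast
      have "\<psi> (k \<otimes> x \<otimes> inv k) = a \<otimes>\<^bsub>A\<^esub> j \<otimes>\<^bsub>A\<^esub> inv\<^bsub>A\<^esub> a"
        using \<sigma>.cocycle_conj[OF kG xG KI lx] actK[of "inv k"] k x \<open>\<psi> k = a\<close> by (simp add: \<psi>_def)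
      then show "a \<otimes>\<^bsub>A\<^esub> j \<otimes>\<^bsub>A\<^esub> inv\<^bsub>A\<^esub> a \<in> J"
        using DL.inv_op_closed2[OF kG x(1)] unfolding J_def by (metis imageI)
    qed
    moreover have "\<psi> q \<in> J" "\<psi> q \<noteq> \<one>\<^bsub>A\<^esub>" using q by (auto simp: J_def \<psi>_def)
    \<comment> \<open>Minimality of the kernel enters only here: one nontrivial value on
      \<open>?D \<inter> L\<close> already gives all of \<open>C\<close>, and \<open>?D\<close> lies
      in \<open>M\<close>.\<close>
    ultimately have "J = C" using min[of J] JC unfolding C_def by blast
    then obtain x where "x \<in> ?D" "c = \<psi> x" using c unfolding J_def by blast
    then show ?thesis using PM by blast
  qed
  have "\<psi> ` M = carrier A"
  proof (intro equalityI subsetI)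
    fix a assume a: "a \<in> carrier A"
    then have "\<alpha> a \<in> \<phi> ` M" using \<phi>s \<alpha>.hom_closed by blast
    then obtain m where m: "m \<in> M" "\<alpha> a = \<phi> m" by blast
    then have mG: "m \<in> carrier G" by auto
    have "inv\<^bsub>A\<^esub> \<psi> m \<otimes>\<^bsub>A\<^esub> a \<in> C" by (rule quo[OF a m])
    then obtain n where n: "n \<in> M" "\<psi> n = inv\<^bsub>A\<^esub> \<psi> m \<otimes>\<^bsub>A\<^esub> a" using key by blast
    have "\<psi> (m \<otimes> n) = a"
      using \<psi>m[OF mG, of n] n MK a \<psi>c[OF mG] by (auto simp: A.m_assoc[symmetric])
    then show "a \<in> \<psi> ` M" using m n M.m_closed by blast
  qed (use \<psi>c in auto)
  moreover have "\<psi> \<in> hom ?M A"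
    by (rule homI) (use \<psi>c \<psi>m MK in auto)
  moreover have "locally_constant ?TM \<psi>"
    unfolding \<psi>_def by (rule locally_constant_subtopology[OF \<sigma>(3)])
  ultimately show "\<exists>\<psi>. continuous_epi ?M ?TM A \<psi> \<and> (\<forall>x\<in>carrier ?M. \<alpha> (\<psi> x) = \<phi> x)"
    using \<alpha>\<psi> by (intro exI[of _ \<psi>]) (simp add: continuous_epi_def)
qed

section \<open>Free profinite groups\<close>

lemma (in profinite_group) open_normal_nat_quotient:
  assumes N: "N \<lhd> G" "openin T N"
  obtains A :: "nat monoid" and a where "group A" "finite (carrier A)" "continuous_epi G T A a"
    "\<And>x. x \<in> carrier G \<Longrightarrow> a x = \<one>\<^bsub>A\<^esub> \<longleftrightarrow> x \<in> N"
proof -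
  interpret N: normal N G by fact
  obtain A :: "nat monoid" and e f where A: "group A" "finite (carrier A)"
    "e \<in> hom (G Mod N) A" "e ` carrier (G Mod N) = carrier A"
    "\<And>X. X \<in> carrier (G Mod N) \<Longrightarrow> f (e X) = X"
    using finite_group_iso_nat[OF N.factorgroup_is_group finite_open_quotient[OF N]] by metis
  have e1: "e N = \<one>\<^bsub>A\<^esub>"
    using hom_one[OF A(3) N.factorgroup_is_group A(1)] by simp
  show ?thesis
  proof (rule that[OF A(1,2)])
    show "continuous_epi G T A (\<lambda>x. e (N #> x))"
      by (rule continuous_epi_compose[OF continuous_epi_coset[OF N] A(3,4) topspace_eq])
    fix x assume x: "x \<in> carrier G"
    have "N = N #> \<one>" using N.subset by simp
    then have "N #> x \<in> carrier (G Mod N)" "N \<in> carrier (G Mod N)"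
      using x one_closed unfolding carrier_FactGroup by blast+
    then have "e (N #> x) = e N \<longleftrightarrow> N #> x = N" using A(5) by metis
    then show "e (N #> x) = \<one>\<^bsub>A\<^esub> \<longleftrightarrow> x \<in> N"
      unfolding e1
      using coset_join1[OF _ x N.subgroup_axioms] coset_join2[OF x N.subgroup_axioms] by blast
  qed
qed

lemma (in group) hom_eq_on_generate:
  assumes "group B" "f \<in> hom G B" "g \<in> hom G B" "X \<subseteq> carrier G" "\<And>x. x \<in> X \<Longrightarrow> f x = g x"
    and "y \<in> generate G X"
  shows "f y = g y"
proof -
  interpret f: group_hom G B f using assms by (simp add: group_hom_def group_hom_axioms_def)
  interpret g: group_hom G B g using assms by (simp add: group_hom_def group_hom_axioms_def)
  show ?thesis
    using assms(6)
  proof induction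
    case (inv h)
    then have "h \<in> carrier G" using assms(4) by blast
    then show ?case using assms(5)[OF inv] by simp
  next
    case (eng h1 h2)
    then have "h1 \<in> carrier G" "h2 \<in> carrier G" using generate_in_carrier[OF assms(4)] by auto
    then show ?case using eng by simp
  qed (use assms(5) in auto)
qed

lemma (in topological_group) generate_meets_open:
  assumes "topologically_generates G T X" "openin T U" "x \<in> U"
  obtains y where "y \<in> generate G X" "y \<in> U"
proof -
  have "x \<in> T closure_of generate G X"
    using assms openin_subset[OF assms(2)] by (auto simp: topologically_generates_def topspace_eq)
  then show ?thesis using that assms(2,3) unfolding in_closure_of by blast
qed

text \<open>The fibres of \<open>f\<close> and \<open>g\<close> through \<open>x\<close> are open,
  so their intersection meets the dense subgroup generated by \<open>X\<close>.\<close>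

lemma (in topological_group) hom_eq_on_topological_generators:
  assumes B: "group B" and f: "f \<in> hom G B" "locally_constant T f"
    and g: "g \<in> hom G B" "locally_constant T g"
    and X: "topologically_generates G T X" and eq: "\<And>x. x \<in> X \<Longrightarrow> f x = g x"
    and x: "x \<in> carrier G"
  shows "f x = g x"
proof -
  let ?U = "{y \<in> topspace T. f y = f x} \<inter> {y \<in> topspace T. g y = g x}"
  have U: "openin T ?U" using f(2) g(2) by (auto simp: locally_constant_def)
  have "x \<in> ?U" using x by (simp add: topspace_eq)
  then obtain y where y: "y \<in> generate G X" "y \<in> ?U"
    using generate_meets_open[OF X U] by blast
  have "f y = g y"
    by (rule hom_eq_on_generate[OF B f(1) g(1) _ eq y(1)])
      (use X in \<open>simp_all add: topologically_generates_def\<close>)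
  moreover have "f y = f x" "g y = g x" using y(2) by auto
  ultimately show ?thesis by simp
qed

text \<open>This admits finite groups as targets of the extension property of a basis.\<close>

lemma (in group) profinite_group_discrete:
  assumes "finite (carrier G)"
  shows "profinite_group G (discrete_topology (carrier G))"
proof (unfold_locales, goal_cases)
  case 2
  show ?case by (simp flip: prod_topology_discrete_topology) auto
next
  case (6 C x y)
  then show ?case by (auto simp: connectedin_discrete_topology)
qed (use assms in \<open>auto simp: compact_space_discrete_topology Hausdorff_space_discrete_topology\<close>)

text \<open>
  All but finitely many basis elements lie in the kernel of a given \<open>\<phi>\<close>, so sufficiently many of
  them are free to be mapped onto \<^term>\<open>kernel A B \<alpha>\<close>.
\<close>

lemma free_embedding_property:
  assumes "free_profinite_omega F T"
  shows "embedding_property F T"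
  unfolding embedding_property_def
proof (intro allI impI, elim conjE)
  interpret F: profinite_group F T using assms by (simp add: free_profinite_omega_def)
  obtain X where X: "infinite X" "countable_profinite_basis F T X"
    using assms by (auto simp: free_profinite_omega_def)
  have XF: "X \<subseteq> carrier F" and Xgen: "topologically_generates F T X"
    and Xconv: "converges_to_one F T X (\<lambda>x. x)"
    using X(2) by (auto simp: countable_profinite_basis_def topologically_generates_def)
  fix A B :: "nat monoid" and \<alpha> \<phi>
  assume A: "group A" "finite (carrier A)" and B: "group B"
    and \<alpha>: "\<alpha> \<in> hom A B" "\<alpha> ` carrier A = carrier B" and \<phi>: "continuous_epi F T B \<phi>"
  interpret A: group A by fact
  interpret \<alpha>: group_hom A B \<alpha> using \<alpha> by (simp add: group_hom_def group_hom_axioms_def A B)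
  have \<phi>h: "\<phi> \<in> hom F B" and \<phi>s: "\<phi> ` carrier F = carrier B" and \<phi>l: "locally_constant T \<phi>"
    using \<phi> by (simp_all add: continuous_epi_def)
  interpret \<phi>: group_hom F B \<phi> using \<phi>h by (simp add: group_hom_def group_hom_axioms_def B F.is_group)
  \<comment> \<open>\<open>S\<close> is finite because the basis converges to \<open>1\<close> and
    the kernel of \<open>\<phi>\<close> is open and normal.\<close>
  define S where "S = {x \<in> X. \<phi> x \<noteq> \<one>\<^bsub>B\<^esub>}"
  have "finite S"
  proof -
    have "openin T (kernel F B \<phi>)"
      using \<phi>l by (simp add: locally_constant_def kernel_def F.topspace_eq)
    then have "finite {x \<in> X. x \<notin> kernel F B \<phi>}"
      using Xconv \<phi>.normal_kernel by (simp add: converges_to_one_def)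
    moreover have "S = {x \<in> X. x \<notin> kernel F B \<phi>}" using XF by (auto simp: S_def kernel_def)
    ultimately show ?thesis by simp
  qed
  let ?C = "kernel A B \<alpha>"
  have finC: "finite ?C" using A(2) by (simp add: kernel_def)
  have "infinite (X - S)" using X(1) \<open>finite S\<close> by simp
  then obtain Y where Y: "finite Y" "card Y = card ?C" "Y \<subseteq> X - S"
    using infinite_arbitrarily_large by metis
  then obtain e where e: "bij_betw e Y ?C" using finite_same_card_bij finC by metis
  \<comment> \<open>\<open>Y\<close> avoids \<open>S\<close>, so \<open>\<phi>\<close> is trivial on
    it and the values there may run through the whole kernel; on \<open>S\<close> some lift of
    \<open>\<phi>\<close> is chosen, elsewhere \<open>\<one>\<close>.\<close>
  define \<theta> where "\<theta> = (\<lambda>x. if x \<in> Y then e x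
    else if x \<in> S then inv_into (carrier A) \<alpha> (\<phi> x) else \<one>\<^bsub>A\<^esub>)"
  have \<theta>: "\<theta> x \<in> carrier A \<and> \<alpha> (\<theta> x) = \<phi> x" if x: "x \<in> X" for x
  proof (cases "x \<in> Y")
    case True
    then have "e x \<in> ?C" "\<phi> x = \<one>\<^bsub>B\<^esub>" using e Y(3) by (auto simp: bij_betw_def S_def)
    then show ?thesis using True by (simp add: \<theta>_def kernel_def)
  next
    case False
    have "\<phi> x \<in> \<alpha> ` carrier A" using x XF \<alpha>(2) by auto
    then show ?thesis
      using False x by (auto simp: \<theta>_def S_def inv_into_into f_inv_into_f)
  qed
  have \<theta>X: "\<theta> ` X \<subseteq> carrier A" using \<theta> by blast
  let ?gen = "generate A (\<theta> ` X)"
  \<comment> \<open>Fibres of \<open>\<phi>\<close> are open, hence met by the dense subgroup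
    generated by \<open>X\<close>. The subgroup \<open>?gen\<close> thus maps onto \<open>B\<close>;
    as it also contains the kernel, it is all of \<open>A\<close>.\<close>
  have Bgen: "carrier B \<subseteq> \<alpha> ` ?gen"
  proof
    fix b assume "b \<in> carrier B"
    then have "b \<in> \<phi> ` carrier F" using \<phi>s by simp
    then obtain x where x: "x \<in> carrier F" "\<phi> x = b" by blast
    have "openin T {y \<in> topspace T. \<phi> y = b}" using \<phi>l by (simp add: locally_constant_def)
    then obtain y where y: "y \<in> generate F X" "\<phi> y = b"
      using F.generate_meets_open[OF Xgen, of _ x] x by (auto simp: F.topspace_eq)
    have "\<alpha> ` \<theta> ` X = \<phi> ` X" using \<theta> by (force simp: image_iff)
    then have "\<phi> ` generate F X = \<alpha> ` ?gen"
      using \<phi>.generate_img[OF XF] \<alpha>.generate_img[OF \<theta>X] by simp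
    then show "b \<in> \<alpha> ` ?gen" using y by blast
  qed
  have sg: "subgroup ?gen A" by (rule A.generate_is_subgroup[OF \<theta>X])
  interpret gen: subgroup ?gen A by (rule sg)
  have genA: "?gen = carrier A"
  proof (intro equalityI subsetI)
    fix a assume a: "a \<in> carrier A"
    then have "\<alpha> a \<in> \<alpha> ` ?gen" using Bgen \<alpha>.hom_closed by blast
    then obtain b where b: "b \<in> ?gen" "\<alpha> a = \<alpha> b" by blast
    have bA: "b \<in> carrier A" using b(1) gen.subset by blast
    have "inv\<^bsub>A\<^esub> b \<otimes>\<^bsub>A\<^esub> a \<in> ?C" using a bA b(2) by (simp add: kernel_def)
    then obtain y where "y \<in> Y" "e y = inv\<^bsub>A\<^esub> b \<otimes>\<^bsub>A\<^esub> a" using e by (metis bij_betw_def imageE)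
    then have "inv\<^bsub>A\<^esub> b \<otimes>\<^bsub>A\<^esub> a = \<theta> y" "y \<in> X" using Y(3) by (auto simp: \<theta>_def)
    then have "inv\<^bsub>A\<^esub> b \<otimes>\<^bsub>A\<^esub> a \<in> ?gen" by (simp add: generate.incl)
    then have "b \<otimes>\<^bsub>A\<^esub> (inv\<^bsub>A\<^esub> b \<otimes>\<^bsub>A\<^esub> a) \<in> ?gen" using b(1) gen.m_closed by blast
    then show "a \<in> ?gen" using a bA by (simp add: A.m_assoc[symmetric])
  qed (use gen.subset in blast)
  let ?U = "discrete_topology (carrier A)"
  have AU: "profinite_group A ?U" by (rule A.profinite_group_discrete[OF A(2)])
  have "topologically_generates A ?U (\<theta> ` X)"
    using \<theta>X genA closure_of_topspace[of ?U] by (simp add: topologically_generates_def)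
  moreover have "converges_to_one A ?U X \<theta>"
    unfolding converges_to_one_def
  proof (intro allI impI, elim conjE)
    fix N assume "N \<lhd> A"
    then have "\<one>\<^bsub>A\<^esub> \<in> N" by (simp add: normal_imp_subgroup subgroup.one_closed)
    then have "{x \<in> X. \<theta> x \<notin> N} \<subseteq> Y \<union> S" by (auto simp: \<theta>_def)
    then show "finite {x \<in> X. \<theta> x \<notin> N}" using Y(1) \<open>finite S\<close> finite_subset by blast
  qed
  ultimately have "unique_extension F T X A ?U \<theta>"
    by (rule countable_basis_extension[OF X(2) F.profinite_group_axioms AU])
  then obtain h where h: "h \<in> hom F A" "continuous_map T ?U h" "\<forall>x\<in>X. h x = \<theta> x"
    unfolding unique_extension_def by blast
  interpret h: group_hom F A h using h(1) by (simp add: group_hom_def group_hom_axioms_def A F.is_group)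
  have "h ` carrier F = carrier A"
  proof
    have "h ` X = \<theta> ` X" using h(3) by auto
    then have "h ` generate F X = carrier A" using h.generate_img[OF XF] genA by simp
    moreover have "generate F X \<subseteq> carrier F" by (rule F.generate_incl[OF XF])
    ultimately show "carrier A \<subseteq> h ` carrier F" by blast
  qed auto
  moreover have hl: "locally_constant T h"
    unfolding locally_constant_def
  proof
    fix b
    have "openin T {x \<in> topspace T. h x \<in> {b} \<inter> carrier A}"
      by (rule openin_continuous_map_preimage[OF h(2)]) simp
    moreover have "{x \<in> topspace T. h x \<in> {b} \<inter> carrier A} = {x \<in> topspace T. h x = b}"
      by (auto simp: F.topspace_eq)
    ultimately show "openin T {x \<in> topspace T. h x = b}" by simp
  qed
  ultimately have "continuous_epi F T A h" using h(1) by (simp add: continuous_epi_def)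
  moreover have "\<alpha> (h x) = \<phi> x" if "x \<in> carrier F" for x
  proof (rule F.hom_eq_on_topological_generators[OF B _ _ \<phi>h \<phi>l Xgen _ that])
    show "(\<lambda>x. \<alpha> (h x)) \<in> hom F B" using hom_compose[OF h(1) \<alpha>(1)] by (simp add: o_def)
    show "locally_constant T (\<lambda>x. \<alpha> (h x))" by (rule locally_constant_compose[OF hl]) simp
    show "\<alpha> (h x) = \<phi> x" if "x \<in> X" for x using h(3) \<theta> that by simp
  qed
  ultimately show "\<exists>\<psi>. continuous_epi F T A \<psi> \<and> (\<forall>x\<in>carrier F. \<alpha> (\<psi> x) = \<phi> x)" by blast
qed

section \<open>Countability of the open normal subgroups\<close>

text \<open>The sets need not decrease and only have trivial intersection; in a compact group this
  makes their finite intersections a neighbourhood base at the identity.\<close>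

definition countable_normal_base :: "('a, 'm) monoid_scheme \<Rightarrow> 'a topology \<Rightarrow> (nat \<Rightarrow> 'a set) \<Rightarrow> bool" where
  "countable_normal_base G T U \<longleftrightarrow> (\<forall>n. U n \<lhd> G \<and> openin T (U n)) \<and> (\<Inter>n. U n) = {\<one>\<^bsub>G\<^esub>}"

text \<open>
  A continuous homomorphism to a finite group is determined by its nontrivial values on the
  generators, of which there are only finitely many.
\<close>

lemma (in profinite_group) countable_open_normal:
  assumes X: "countable X" "topologically_generates G T X" "converges_to_one G T X (\<lambda>x. x)"
  shows "countable {N. N \<lhd> G \<and> openin T N}" (is "countable ?\<N>")
proof -
  define Q where "Q = (\<lambda>N (A :: nat monoid, a). group A \<and> finite (carrier A) \<and> continuous_epi G T A a \<and>
    (\<forall>x\<in>carrier G. a x = \<one>\<^bsub>A\<^esub> \<longleftrightarrow> x \<in> N))"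
  have "\<exists>p. Q N p" if "N \<in> ?\<N>" for N
  proof -
    have "N \<lhd> G" "openin T N" using that by auto
    then show ?thesis
    proof (rule open_normal_nat_quotient)
      fix A :: "nat monoid" and a assume "group A" "finite (carrier A)" "continuous_epi G T A a"
        "\<And>x. x \<in> carrier G \<Longrightarrow> a x = \<one>\<^bsub>A\<^esub> \<longleftrightarrow> x \<in> N"
      then show ?thesis unfolding Q_def by (intro exI[of _ "(A, a)"]) simp
    qed
  qed
  then obtain q where q: "\<And>N. N \<in> ?\<N> \<Longrightarrow> Q N (q N)" by metis
  define A a where "A = (\<lambda>N. fst (q N))" and "a = (\<lambda>N. snd (q N))"
  have Aa: "group (A N)" "finite (carrier (A N))" "continuous_epi G T (A N) (a N)"
    "\<And>x. x \<in> carrier G \<Longrightarrow> a N x = \<one>\<^bsub>A N\<^esub> \<longleftrightarrow> x \<in> N" if "N \<in> ?\<N>" for N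
    using q[OF that] by (auto simp: Q_def A_def a_def split_beta)
  define k where "k = to_nat_on X"
  have k: "inj_on k X" using X(1) by (simp add: k_def inj_on_to_nat_on)
  have XG: "X \<subseteq> carrier G" using X(2) by (simp add: topologically_generates_def)
  \<comment> \<open>The code of \<open>N\<close> consists of finite data on natural numbers: the
    multiplication table of the quotient, the nontrivial values on \<open>X\<close>, and the
    unit.\<close>
  define tab where "tab = (\<lambda>N. (\<lambda>(x, y). (x, y, x \<otimes>\<^bsub>A N\<^esub> y)) ` (carrier (A N) \<times> carrier (A N)))"
  define val where "val = (\<lambda>N. (\<lambda>x. (k x, a N x)) ` {x \<in> X. x \<notin> N})"
  define code where "code = (\<lambda>N. (tab N, val N, \<one>\<^bsub>A N\<^esub>))"
  have fin: "finite (tab N)" "finite (val N)" if N: "N \<in> ?\<N>" for N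
    using Aa(2)[OF N] X(3) N by (auto simp: tab_def val_def converges_to_one_def)
  have "countable (Collect finite \<times> Collect finite \<times> (UNIV :: nat set) ::
      ((nat \<times> nat \<times> nat) set \<times> (nat \<times> nat) set \<times> nat) set)"
    by (intro countable_SIGMA countable_Collect_finite) auto
  moreover have "code ` ?\<N> \<subseteq> Collect finite \<times> Collect finite \<times> UNIV"
    unfolding code_def using fin by blast
  ultimately have "countable (code ` ?\<N>)" using countable_subset by blast
  moreover have "inj_on code ?\<N>"
  proof (rule inj_onI)
    fix M N assume M: "M \<in> ?\<N>" and N: "N \<in> ?\<N>" and "code M = code N"
    then have tab: "tab M = tab N" and val: "val M = val N" and one: "\<one>\<^bsub>A M\<^esub> = \<one>\<^bsub>A N\<^esub>"
      by (auto simp: code_def)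
    have aM: "a M \<in> hom G (A M)" "locally_constant T (a M)"
      and aN: "a N \<in> hom G (A N)" "locally_constant T (a N)"
      using Aa(3)[OF M] Aa(3)[OF N] by (auto simp: continuous_epi_def)
    \<comment> \<open>Every element occurs as a left factor, so the table also records the
      carrier.\<close>
    have carr: "carrier (A K) = fst ` tab K" for K
      by (force simp: tab_def image_iff)
    have cMN: "carrier (A M) = carrier (A N)" unfolding carr tab ..
    have mult: "x \<otimes>\<^bsub>A M\<^esub> y = x \<otimes>\<^bsub>A N\<^esub> y" if "x \<in> carrier (A M)" "y \<in> carrier (A M)" for x y
    proof -
      have "(x, y, x \<otimes>\<^bsub>A M\<^esub> y) \<in> tab N"
        unfolding tab[symmetric] using that by (auto simp: tab_def)
      then show ?thesis by (auto simp: tab_def)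
    qed
    have aN': "a N \<in> hom G (A M)"
      using aN(1) mult cMN by (auto simp: hom_def Pi_def)
    \<comment> \<open>Values off the kernel are recorded in the code. It suffices that
      \<open>x\<close> lies outside one of the two subgroups; inside both, both values are the
      unit.\<close>
    have val_eq: "a K x = a K' x" if "val K = val K'" "K' \<in> ?\<N>" "x \<in> X" "x \<notin> K" for K K' x
    proof -
      have "(k x, a K x) \<in> val K'" using that(1,3,4) unfolding val_def by blast
      then obtain y where "y \<in> X" "k x = k y" "a K x = a K' y" unfolding val_def by blast
      then show ?thesis using k that(3) by (metis inj_onD)
    qed
    have eqX: "a M x = a N x" if x: "x \<in> X" for x
    proof (cases "x \<in> M \<and> x \<in> N")
      case True
      then have "a M x = \<one>\<^bsub>A M\<^esub>" "a N x = \<one>\<^bsub>A N\<^esub>" using Aa(4) M N x XG by blast+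
      then show ?thesis using one by simp
    next
      case False
      then show ?thesis using val_eq[OF val N x] val_eq[OF val[symmetric] M x] by metis
    qed
    have eq: "a M x = a N x" if "x \<in> carrier G" for x
      by (rule hom_eq_on_topological_generators[OF Aa(1)[OF M] aM aN' aN(2) X(2) eqX that])
    have MG: "M \<subseteq> carrier G" and NG: "N \<subseteq> carrier G"
      using M N by (auto dest: normal_imp_subgroup subgroup.subset)
    have "x \<in> M \<longleftrightarrow> x \<in> N" if "x \<in> carrier G" for x
      using Aa(4)[OF M that] Aa(4)[OF N that] eq[OF that] one by simp
    then show "M = N" using MG NG by blast
  qed
  ultimately show ?thesis by (rule countable_image_inj_on)
qed

lemma (in profinite_group) countable_normal_base_exists:
  assumes "countable {N. N \<lhd> G \<and> openin T N}" (is "countable ?\<N>")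
  obtains U where "countable_normal_base G T U"
proof -
  have "carrier G \<in> ?\<N>" using normal_self openin_topspace topspace_eq by (metis mem_Collect_eq)
  then have ne: "?\<N> \<noteq> {}" by blast
  have "range (from_nat_into ?\<N>) = ?\<N>" using range_from_nat_into[OF ne assms] .
  moreover have "\<Inter>?\<N> = {\<one>}"
  proof (intro equalityI subsetI)
    fix x assume x: "x \<in> \<Inter>?\<N>"
    then have xG: "x \<in> carrier G" using \<open>carrier G \<in> ?\<N>\<close> by blast
    show "x \<in> {\<one>}"
    proof (rule ccontr)
      assume "x \<notin> {\<one>}"
      then have "x \<noteq> \<one>" by simp
      then obtain V W where "openin T V" "openin T W" "\<one> \<in> V" "x \<in> W" "disjnt V W"
        using Hausdorff xG unfolding Hausdorff_space_def topspace_eq by (metis one_closed)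
      moreover from this obtain N where "N \<lhd> G" "openin T N" "N \<subseteq> V" using open_normal_base by blast
      ultimately show False using x by (auto simp: disjnt_iff)
    qed
  qed (auto dest: normal_imp_subgroup subgroup.one_closed)
  ultimately have "countable_normal_base G T (from_nat_into ?\<N>)"
    unfolding countable_normal_base_def using from_nat_into[OF ne] by auto
  then show ?thesis using that by blast
qed

section \<open>The uniqueness theorem of Iwasawa\<close>

lemma locally_constant_const: "locally_constant T (\<lambda>_. c)"
  unfolding locally_constant_def
proof
  fix b
  show "openin T {x \<in> topspace T. c = b}" by (cases "c = b") simp_all
qed

text \<open>
  A pair of epimorphisms onto a common finite group is a partial isomorphism; refining it on
  alternating sides yields, by compactness, the graph of an isomorphism.
\<close>

definition common_quotient ::
  "('a, 'm) monoid_scheme \<Rightarrow> 'a topology \<Rightarrow> ('b, 'n) monoid_scheme \<Rightarrow> 'b topology \<Rightarrow>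
   nat monoid \<Rightarrow> ('a \<Rightarrow> nat) \<Rightarrow> ('b \<Rightarrow> nat) \<Rightarrow> bool" where
  "common_quotient G T H U A a b \<longleftrightarrow>
     group A \<and> finite (carrier A) \<and> continuous_epi G T A a \<and> continuous_epi H U A b"

text \<open>Half a step of the back-and-forth: \<open>A'\<close> is the quotient of \<open>G\<close>
  by \<open>N \<inter> ker a\<close>, so \<open>a\<close> factors through \<open>a'\<close>, and the
  embedding property of \<open>H\<close> lifts \<open>b\<close> along
  \<open>A' \<rightarrow> A\<close>.\<close>

lemma common_quotient_refine:
  assumes G: "profinite_group G T" and H: "profinite_group H U"
    and EP: "embedding_property H U"
    and ab: "common_quotient G T H U A a b" and N: "N \<lhd> G" "openin T N"
  obtains A' a' b' where "common_quotient G T H U A' a' b'"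
    "\<forall>x\<in>carrier G. \<forall>y\<in>carrier H. a' x = b' y \<longrightarrow> a x = b y"
    "\<forall>x\<in>carrier G. a' x = \<one>\<^bsub>A'\<^esub> \<longrightarrow> x \<in> N"
proof -
  interpret G: profinite_group G T by fact
  interpret H: profinite_group H U by fact
  have A: "group A" "finite (carrier A)" and a: "continuous_epi G T A a"
    and b: "continuous_epi H U A b"
    using ab by (auto simp: common_quotient_def)
  have ah: "a \<in> hom G A" and as: "a ` carrier G = carrier A" and al: "locally_constant T a"
    using a by (simp_all add: continuous_epi_def)
  interpret a: group_hom G A a using ah A by (simp add: group_hom_def group_hom_axioms_def G.is_group)
  let ?N = "N \<inter> kernel G A a"
  have "openin T (kernel G A a)"
    using al by (simp add: locally_constant_def kernel_def G.topspace_eq)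
  then have N': "?N \<lhd> G" "openin T ?N"
    using G.normal_subgroup_intersect[OF N(1) a.normal_kernel] N(2) by auto
  show ?thesis
  proof (rule G.open_normal_nat_quotient[OF N'])
    fix A' :: "nat monoid" and a'
    assume A': "group A'" "finite (carrier A')" and a': "continuous_epi G T A' a'"
      and ker: "\<And>x. x \<in> carrier G \<Longrightarrow> a' x = \<one>\<^bsub>A'\<^esub> \<longleftrightarrow> x \<in> ?N"
    have a'h: "a' \<in> hom G A'" and a's: "a' ` carrier G = carrier A'"
      using a' by (simp_all add: continuous_epi_def)
    interpret a': group_hom G A' a'
      using a'h A' by (simp add: group_hom_def group_hom_axioms_def G.is_group)
    have "a x = \<one>\<^bsub>A\<^esub>" if "x \<in> carrier G" "a' x = \<one>\<^bsub>A'\<^esub>" for x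
      using ker[OF that(1)] that(2) unfolding kernel_def by blast
    then obtain \<alpha> where \<alpha>: "\<alpha> \<in> hom A' A" and \<alpha>s': "\<alpha> ` carrier A' = a ` carrier G"
      and \<alpha>a': "\<And>x. x \<in> carrier G \<Longrightarrow> \<alpha> (a' x) = a x"
      using hom_factor_surj[OF a'.group_hom_axioms a's a.group_hom_axioms] by blast
    have \<alpha>s: "\<alpha> ` carrier A' = carrier A" using \<alpha>s' as by (rule trans)
    obtain b' where b': "continuous_epi H U A' b'" "\<And>y. y \<in> carrier H \<Longrightarrow> \<alpha> (b' y) = b y"
      using embedding_propertyD[OF EP H.topspace_eq A' A(1) \<alpha> \<alpha>s b] by blast
    show ?thesis
    proof (rule that[of A' a' b'])
      show "common_quotient G T H U A' a' b'" using A' a' b' by (simp add: common_quotient_def)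
      show "\<forall>x\<in>carrier G. \<forall>y\<in>carrier H. a' x = b' y \<longrightarrow> a x = b y"
        using \<alpha>a' b'(2) by metis
      show "\<forall>x\<in>carrier G. a' x = \<one>\<^bsub>A'\<^esub> \<longrightarrow> x \<in> N" using ker by blast
    qed
  qed
qed

theorem embedding_property_imp_isomorphic:
  assumes G: "profinite_group G T" and H: "profinite_group H U"
    and EPG: "embedding_property G T" and EPH: "embedding_property H U"
    and V: "countable_normal_base G T V" and W: "countable_normal_base H U W"
  shows "top_isomorphic G T H U"
proof -
  interpret G: profinite_group G T by fact
  interpret H: profinite_group H U by fact
  have V': "V n \<lhd> G" "openin T (V n)" and W': "W n \<lhd> H" "openin U (W n)" for n
    using V W by (auto simp: countable_normal_base_def)
  let ?ok = "\<lambda>(A, a, b). common_quotient G T H U A a b"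
  \<comment> \<open>The first condition makes agreement at one stage imply agreement at the previous
    one; the other two make the stages separate points on both sides.\<close>
  let ?fine = "\<lambda>n (A, a, b) (A', a', b').
    (\<forall>x\<in>carrier G. \<forall>y\<in>carrier H. a' x = b' y \<longrightarrow> a x = b y) \<and>
    (\<forall>x\<in>carrier G. a' x = \<one>\<^bsub>A'\<^esub> \<longrightarrow> x \<in> V n) \<and> (\<forall>y\<in>carrier H. b' y = \<one>\<^bsub>A'\<^esub> \<longrightarrow> y \<in> W n)"
  have "\<exists>f :: nat \<Rightarrow> nat monoid \<times> ('a \<Rightarrow> nat) \<times> ('c \<Rightarrow> nat).
    \<forall>n. ?ok (f n) \<and> ?fine n (f n) (f (Suc n))"
  proof (rule dependent_nat_choice)
    \<comment> \<open>The trivial group is a common quotient to start from.\<close>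
    let ?A = "\<lparr>carrier = {0}, monoid.mult = (\<lambda>_ _. 0), one = 0\<rparr> :: nat monoid"
    have "group ?A" by (rule groupI) auto
    moreover have "continuous_epi G T ?A (\<lambda>_. 0)"
      using G.one_closed by (auto simp: continuous_epi_def hom_def locally_constant_const)
    moreover have "continuous_epi H U ?A (\<lambda>_. 0)"
      using H.one_closed by (auto simp: continuous_epi_def hom_def locally_constant_const)
    ultimately show "\<exists>x. ?ok x" by (intro exI[of _ "(?A, \<lambda>_. 0, \<lambda>_. 0)"]) (simp add: common_quotient_def)
  next
    fix p :: "nat monoid \<times> ('a \<Rightarrow> nat) \<times> ('c \<Rightarrow> nat)" and n assume "?ok p"
    then obtain A a b where p: "p = (A, a, b)" "common_quotient G T H U A a b" by auto
    obtain A1 a1 b1 where 1: "common_quotient G T H U A1 a1 b1"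
      "\<forall>x\<in>carrier G. \<forall>y\<in>carrier H. a1 x = b1 y \<longrightarrow> a x = b y"
      "\<forall>x\<in>carrier G. a1 x = \<one>\<^bsub>A1\<^esub> \<longrightarrow> x \<in> V n"
      by (rule common_quotient_refine[OF G H EPH p(2) V'[of n]])
    have "common_quotient H U G T A1 b1 a1" using 1(1) by (simp add: common_quotient_def)
    then obtain A2 b2 a2 where 2: "common_quotient H U G T A2 b2 a2"
      "\<forall>y\<in>carrier H. \<forall>x\<in>carrier G. b2 y = a2 x \<longrightarrow> b1 y = a1 x"
      "\<forall>y\<in>carrier H. b2 y = \<one>\<^bsub>A2\<^esub> \<longrightarrow> y \<in> W n"
      by (rule common_quotient_refine[OF H G EPG _ W'[of n]])
    interpret b2: group_hom H A2 b2
      using 2(1) by (simp add: common_quotient_def continuous_epi_def group_hom_def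
          group_hom_axioms_def H.is_group)
    interpret b1: group_hom H A1 b1
      using 1(1) by (simp add: common_quotient_def continuous_epi_def group_hom_def
          group_hom_axioms_def H.is_group)
    \<comment> \<open>The refinement for \<open>G\<close> survives the one for \<open>H\<close>: an
      \<open>x\<close> trivial in \<open>A2\<close> agrees there with the identity of
      \<open>H\<close>, hence also in \<open>A1\<close>.\<close>
    have "x \<in> V n" if x: "x \<in> carrier G" "a2 x = \<one>\<^bsub>A2\<^esub>" for x
    proof -
      have "b1 \<one>\<^bsub>H\<^esub> = a1 x" using 2(2)[rule_format, OF H.one_closed x(1)] x(2) by simp
      then show ?thesis using 1(3)[rule_format, OF x(1)] by simp
    qed
    moreover have "a x = b y" if "x \<in> carrier G" "y \<in> carrier H" "a2 x = b2 y" for x y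
      using 1(2) 2(2) that by metis
    moreover have "common_quotient G T H U A2 a2 b2" using 2(1) by (simp add: common_quotient_def)
    ultimately show "\<exists>q. ?ok q \<and> ?fine n p q"
      using 2(3) p(1) by (intro exI[of _ "(A2, a2, b2)"]) auto
  qed
  then obtain f where f0: "\<forall>n. ?ok (f n) \<and> ?fine n (f n) (f (Suc n))" by (rule exE)
  have f: "?ok (f n)" "?fine n (f n) (f (Suc n))" for n
    by (rule conjunct1[OF spec[OF f0]], rule conjunct2[OF spec[OF f0]])
  define A a b where "A = (\<lambda>n. fst (f n))" and "a = (\<lambda>n. fst (snd (f n)))"
    and "b = (\<lambda>n. snd (snd (f n)))"
  have grpA: "group (A n)" and aepi: "continuous_epi G T (A n) (a n)"
    and bepi: "continuous_epi H U (A n) (b n)" for n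
    using f(1)[of n] by (auto simp: A_def a_def b_def common_quotient_def split_beta)
  have ref: "a n x = b n y" if "x \<in> carrier G" "y \<in> carrier H" "a (Suc n) x = b (Suc n) y" for n x y
    using f(2)[of n] that by (auto simp: a_def b_def split_beta)
  have aV: "x \<in> V n" if "x \<in> carrier G" "a (Suc n) x = \<one>\<^bsub>A (Suc n)\<^esub>" for n x
    using f(2)[of n] that by (auto simp: A_def a_def b_def split_beta)
  have bW: "y \<in> W n" if "y \<in> carrier H" "b (Suc n) y = \<one>\<^bsub>A (Suc n)\<^esub>" for n y
    using f(2)[of n] that by (auto simp: A_def a_def b_def split_beta)
  have ahom: "group_hom G (A n) (a n)" and bhom: "group_hom H (A n) (b n)" for n
    using aepi[of n] bepi[of n] grpA[of n]
    by (auto simp: continuous_epi_def group_hom_def group_hom_axioms_def G.is_group H.is_group)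
  \<comment> \<open>\<open>R\<close> is the graph of the isomorphism: \<open>x\<close> and
    \<open>y\<close> correspond if they agree in every common quotient.\<close>
  define R where "R = (\<lambda>x y. \<forall>n. a n x = b n y)"
  have total: "\<exists>y\<in>carrier H. R x y" if x: "x \<in> carrier G" for x
  proof -
    \<comment> \<open>The partners of \<open>x\<close> at stage \<open>n\<close> form a nonempty
      closed set, decreasing in \<open>n\<close> by \<open>ref\<close>, so compactness provides a
      partner for all stages.\<close>
    let ?C = "\<lambda>n. {y \<in> topspace U. b n y \<in> {a n x}}"
    have "(\<Inter>n. ?C n) \<noteq> {}"
    proof (rule compact_space_imp_nest[OF H.compact])
      show "closedin U (?C n)" for n
        using bepi[of n] by (intro locally_constant_closed_vimage) (simp add: continuous_epi_def)
      show "?C n \<noteq> {}" for n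
      proof -
        have "a n x \<in> b n ` carrier H" using x aepi[of n] bepi[of n] unfolding continuous_epi_def by blast
        then show ?thesis by (auto simp: H.topspace_eq)
      qed
      show "decseq ?C"
        unfolding decseq_Suc_iff
      proof (intro allI subsetI)
        fix n y assume "y \<in> ?C (Suc n)"
        then have *: "y \<in> carrier H" "a (Suc n) x = b (Suc n) y"
          by (auto simp: H.topspace_eq)
        then show "y \<in> ?C n" using * ref[OF x *(1,2)] by (simp add: H.topspace_eq)
      qed
    qed
    then obtain y where "\<forall>n. y \<in> ?C n" by blast
    then have "y \<in> carrier H" "R x y" by (auto simp: R_def H.topspace_eq)
    then show ?thesis by blast
  qed
  have total': "\<exists>x\<in>carrier G. R x y" if y: "y \<in> carrier H" for y
  proof -
    let ?C = "\<lambda>n. {x \<in> topspace T. a n x \<in> {b n y}}"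
    have "(\<Inter>n. ?C n) \<noteq> {}"
    proof (rule compact_space_imp_nest[OF G.compact])
      show "closedin T (?C n)" for n
        using aepi[of n] by (intro locally_constant_closed_vimage) (simp add: continuous_epi_def)
      show "?C n \<noteq> {}" for n
      proof -
        have "b n y \<in> a n ` carrier G" using y aepi[of n] bepi[of n] unfolding continuous_epi_def by blast
        then show ?thesis by (force simp: G.topspace_eq)
      qed
      show "decseq ?C"
        unfolding decseq_Suc_iff
      proof (intro allI subsetI)
        fix n x assume "x \<in> ?C (Suc n)"
        then have *: "x \<in> carrier G" "a (Suc n) x = b (Suc n) y"
          by (auto simp: G.topspace_eq)
        then show "x \<in> ?C n" using * ref[OF *(1) y *(2)] by (simp add: G.topspace_eq)
      qed
    qed
    then obtain x where "\<forall>n. x \<in> ?C n" by blast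
    then have "x \<in> carrier G" "R x y" by (auto simp: R_def G.topspace_eq)
    then show ?thesis by blast
  qed
  have Rmult: "R (x \<otimes>\<^bsub>G\<^esub> x') (y \<otimes>\<^bsub>H\<^esub> y')"
    if "x \<in> carrier G" "x' \<in> carrier G" "y \<in> carrier H" "y' \<in> carrier H" "R x y" "R x' y'" for x x' y y'
    using that group_hom.hom_mult[OF ahom] group_hom.hom_mult[OF bhom] by (simp add: R_def)
  have Rinv: "R (inv\<^bsub>G\<^esub> x) (inv\<^bsub>H\<^esub> y)" if "x \<in> carrier G" "y \<in> carrier H" "R x y" for x y
    using that group_hom.hom_inv[OF ahom] group_hom.hom_inv[OF bhom] by (simp add: R_def)
  have R1: "x = \<one>\<^bsub>G\<^esub>" if "x \<in> carrier G" "R x \<one>\<^bsub>H\<^esub>" for x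
  proof -
    have "x \<in> V n" for n using aV[OF that(1)] that(2) group_hom.hom_one[OF bhom] by (simp add: R_def)
    then show ?thesis using V by (auto simp: countable_normal_base_def)
  qed
  have R1': "y = \<one>\<^bsub>H\<^esub>" if "y \<in> carrier H" "R \<one>\<^bsub>G\<^esub> y" for y
  proof -
    have "b n y = \<one>\<^bsub>A n\<^esub>" for n using that(2) group_hom.hom_one[OF ahom] by (simp add: R_def)
    then have "y \<in> W n" for n using bW[OF that(1)] by blast
    then show ?thesis using W by (auto simp: countable_normal_base_def)
  qed
  have uniq: "y = y'" if "x \<in> carrier G" "y \<in> carrier H" "y' \<in> carrier H" "R x y" "R x y'" for x y y'
  proof -
    have "R (x \<otimes>\<^bsub>G\<^esub> inv\<^bsub>G\<^esub> x) (y \<otimes>\<^bsub>H\<^esub> inv\<^bsub>H\<^esub> y')"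
      by (intro Rmult Rinv that G.inv_closed H.inv_closed)
    then have "y \<otimes>\<^bsub>H\<^esub> inv\<^bsub>H\<^esub> y' = \<one>\<^bsub>H\<^esub>" using R1' that by simp
    then show ?thesis using that H.inv_solve_right[of "\<one>\<^bsub>H\<^esub>" y y'] by simp
  qed
  have uniq': "x = x'" if "x \<in> carrier G" "x' \<in> carrier G" "y \<in> carrier H" "R x y" "R x' y" for x x' y
  proof -
    have "R (x \<otimes>\<^bsub>G\<^esub> inv\<^bsub>G\<^esub> x') (y \<otimes>\<^bsub>H\<^esub> inv\<^bsub>H\<^esub> y)"
      by (intro Rmult Rinv that G.inv_closed H.inv_closed)
    then have "x \<otimes>\<^bsub>G\<^esub> inv\<^bsub>G\<^esub> x' = \<one>\<^bsub>G\<^esub>" using R1 that by simp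
    then show ?thesis using that G.inv_solve_right[of "\<one>\<^bsub>G\<^esub>" x x'] by simp
  qed
  define h where "h = (\<lambda>x. SOME y. y \<in> carrier H \<and> R x y)"
  have h: "h x \<in> carrier H" "R x (h x)" if "x \<in> carrier G" for x
    using someI_ex[of "\<lambda>y. y \<in> carrier H \<and> R x y"] total[OF that] unfolding h_def by blast+
  have hom: "h \<in> hom G H"
    by (rule homI) (use h Rmult uniq in \<open>meson G.m_closed H.m_closed\<close>)+
  have inj: "inj_on h (carrier G)" by (rule inj_onI) (use h uniq' in metis)
  have surj: "h ` carrier G = carrier H"
  proof (intro equalityI subsetI)
    fix y assume y: "y \<in> carrier H"
    then obtain x where "x \<in> carrier G" "R x y" using total' by blast
    then show "y \<in> h ` carrier G" using h uniq y by (metis imageI)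
  qed (use h in auto)
  have "continuous_map T U h"
    unfolding continuous_map_def
  proof (intro conjI allI impI)
    show "h \<in> topspace T \<rightarrow> topspace U" using h by (auto simp: G.topspace_eq H.topspace_eq)
    fix O' assume O: "openin U O'"
    show "openin T {x \<in> topspace T. h x \<in> O'}"
    proof (subst openin_subopen, intro ballI)
      fix x assume x: "x \<in> {x \<in> topspace T. h x \<in> O'}"
      then have xG: "x \<in> carrier G" by (simp add: G.topspace_eq)
      \<comment> \<open>If the partners of \<open>x\<close> left \<open>O'\<close> at every stage,
        compactness would give one outside \<open>O'\<close> for all stages, against uniqueness of
        \<open>h x\<close>. A stage \<open>n\<close> where they stay inside makes the fibre of
        \<open>a n\<close> a neighbourhood of \<open>x\<close> sent into \<open>O'\<close>.\<close>
      let ?C = "\<lambda>n. {y \<in> topspace U. b n y \<in> {a n x}} \<inter> (topspace U - O')"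
      have "\<exists>n. ?C n = {}"
      proof (rule ccontr)
        assume "\<nexists>n. ?C n = {}"
        then have ne: "?C n \<noteq> {}" for n by blast
        have "(\<Inter>n. ?C n) \<noteq> {}"
        proof (rule compact_space_imp_nest[OF H.compact _ ne])
          show "closedin U (?C n)" for n
            using bepi[of n] O
            by (intro closedin_Int locally_constant_closed_vimage) (auto simp: continuous_epi_def)
          show "decseq ?C"
            unfolding decseq_Suc_iff
          proof (intro allI subsetI)
            fix n y assume "y \<in> ?C (Suc n)"
            then have *: "y \<in> carrier H" "a (Suc n) x = b (Suc n) y" "y \<notin> O'"
              by (auto simp: H.topspace_eq)
            then show "y \<in> ?C n" using * ref[OF xG *(1,2)] by (simp add: H.topspace_eq)
          qed
        qed
        then obtain y where "\<forall>n. y \<in> ?C n" by blast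
        then have y: "y \<in> carrier H" "R x y" "y \<notin> O'" by (auto simp: R_def H.topspace_eq)
        then have "y = h x" using uniq h xG by metis
        then show False using x y by simp
      qed
      then obtain n where n: "?C n = {}" by blast
      show "\<exists>S. openin T S \<and> x \<in> S \<and> S \<subseteq> {x \<in> topspace T. h x \<in> O'}"
      proof (intro exI conjI)
        show "openin T {z \<in> topspace T. a n z = a n x}"
          using aepi[of n] by (simp add: continuous_epi_def locally_constant_def)
        show "x \<in> {z \<in> topspace T. a n z = a n x}" using x by simp
        show "{z \<in> topspace T. a n z = a n x} \<subseteq> {x \<in> topspace T. h x \<in> O'}"
        proof
          fix z assume z: "z \<in> {z \<in> topspace T. a n z = a n x}"
          then have "h z \<in> topspace U" "b n (h z) = a n x"
            using h[of z] by (auto simp: G.topspace_eq H.topspace_eq R_def)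
          then have "h z \<in> O'" using n by blast
          then show "z \<in> {x \<in> topspace T. h x \<in> O'}" using z by simp
        qed
      qed
    qed
  qed
  then have "homeomorphic_map T U h"
    using continuous_imp_homeomorphic_map[OF _ G.compact H.Hausdorff] surj inj
    by (simp add: G.topspace_eq H.topspace_eq)
  moreover have "h \<in> iso G H" using hom inj surj by (simp add: iso_def bij_betw_def)
  ultimately show ?thesis unfolding top_isomorphic_def by blast
qed

section \<open>Descent along the abelian-simple series\<close>

lemma (in profinite_group) countable_normal_base_subgroup:
  assumes "countable_normal_base G T U" "subgroup M G"
  shows "countable_normal_base (G\<lparr>carrier := M\<rparr>) (subtopology T M) (\<lambda>n. U n \<inter> M)"
proof -
  have "(\<Inter>n. U n \<inter> M) = {\<one>}"
    using assms subgroup.one_closed[OF assms(2)] unfolding countable_normal_base_def by blast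
  then show ?thesis
    using assms normal_Int_subgroup[OF assms(2)]
    by (auto simp: countable_normal_base_def openin_subtopology_Int)
qed

text \<open>
  The steps are covered by \<open>embedding_property_step\<close> since \<open>D\<^sub>i\<close> is normal in \<open>M D\<^sub>i = (M D\<^sub>i\<^sub>+\<^sub>1) D\<^sub>i\<close>.
\<close>

lemma (in profinite_group) embedding_property_chain:
  assumes EP: "embedding_property G T" and M: "subgroup M G" "closedin T M"
    and D: "\<And>i. D i \<lhd> G" "\<And>i. closedin T (D i)" and D0: "D 0 = carrier G"
    and dec: "\<And>i. D (Suc i) \<subseteq> D i"
    and core: "\<And>i. abelian_simple_core (G\<lparr>carrier := D i\<rparr>) (subtopology T (D i)) \<subseteq> D (Suc i)"
  shows "embedding_property (G\<lparr>carrier := M <#> D i\<rparr>) (subtopology T (M <#> D i))"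
proof (induction i)
  case 0
  have "M <#> D 0 = carrier G"
    unfolding D0 using set_mult_carrier_idem[OF M(1)] commut_normal[OF M(1) normal_self] by simp
  moreover have "subtopology T (carrier G) = T" using subtopology_topspace topspace_eq by metis
  ultimately show ?case using EP by simp
next
  case (Suc i)
  interpret M: subgroup M G by fact
  let ?K = "M <#> D i" and ?L = "M <#> D (Suc i)"
  have sub: "subgroup (M <#> D j) G" for j by (rule subgroup_mult_normal[OF M(1) D(1)])
  have cl: "closedin T (M <#> D j)" for j by (rule closedin_set_mult[OF M(2) D(2)])
  have one: "\<one> \<in> D j" for j using D(1) normal_imp_subgroup subgroup.one_closed by blast
  have DG: "D j \<subseteq> carrier G" for j using D(1) normal_imp_subgroup subgroup.subset by blast
  have MD: "m \<otimes> d \<in> M <#> D j" if "m \<in> M" "d \<in> D j" for m d j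
    using that unfolding set_mult_def by blast
  have Msub: "M \<subseteq> M <#> D j" for j using MD[OF _ one] M.subset by auto
  have Dsub: "D j \<subseteq> M <#> D j" for j using MD[OF M.one_closed] DG[of j] by (metis l_one subsetD subsetI)
  interpret D: normal "D i" G by (rule D(1))
  interpret K: profinite_group "G\<lparr>carrier := ?K\<rparr>" "subtopology T ?K"
    by (rule closed_subgroup_profinite[OF sub cl])
  have LK: "?L \<subseteq> ?K" using dec[of i] by (auto simp: set_mult_def)
    have "embedding_property ((G\<lparr>carrier := ?K\<rparr>)\<lparr>carrier := ?L\<rparr>) (subtopology (subtopology T ?K) ?L)"
    proof (rule K.embedding_property_step[OF Suc.IH])
      show "subgroup ?L (G\<lparr>carrier := ?K\<rparr>)" by (rule subgroup_incl[OF sub sub LK])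
      show "closedin (subtopology T ?K) ?L" by (rule closedin_subset_topspace[OF cl LK])
      show "D i \<lhd> G\<lparr>carrier := ?K\<rparr>" by (rule normal_restrict_supergroup[OF sub D(1) Dsub])
      show "closedin (subtopology T ?K) (D i)" by (rule closedin_subset_topspace[OF D(2) Dsub])
      \<comment> \<open>\<open>M D i = D i M\<close>, and \<open>M\<close> is contained in the
        smaller product, so the larger product is generated as the step requires.\<close>
      show "\<exists>p\<in>D i. \<exists>m\<in>?L. x = p \<otimes>\<^bsub>G\<lparr>carrier := ?K\<rparr>\<^esub> m" if "x \<in> carrier (G\<lparr>carrier := ?K\<rparr>)" for x
      proof -
        have "x \<in> D i <#> M" using that commut_normal[OF M(1) D(1)] by simp
        then obtain p m where "p \<in> D i" "m \<in> M" "x = p \<otimes> m" unfolding set_mult_def by blast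
        moreover have "m \<in> ?L" using \<open>m \<in> M\<close> Msub by blast
        ultimately show ?thesis by auto
      qed
      show "abelian_simple_core (G\<lparr>carrier := ?K, carrier := D i\<rparr>)
          (subtopology (subtopology T ?K) (D i)) \<subseteq> ?L"
        using core Dsub Dsub[of i] by (auto simp: subtopology_subtopology Int_absorb1 Int_absorb2)
    qed
  then show ?case using LK by (simp add: subtopology_subtopology Int_absorb1)
qed

text \<open>Pulling the series back replaces \<open>F/N\<close> by subgroups of the profinite group
  itself. The core of \<open>D i\<close> maps into the core of its image by functoriality, and
  closedness follows as open subgroups of the terms below have open, hence closed,
  preimages.\<close>

lemma (in profinite_group) abelian_simple_series_preimage:
  assumes N: "N \<lhd> G"
  defines "D \<equiv> \<lambda>i. {x \<in> carrier G. N #> x \<in> abelian_simple_series (G Mod N) (coset_topology G T N) i}"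
  shows "D i \<lhd> G" "closedin T (D i)" "D (Suc i) \<subseteq> D i"
    "abelian_simple_core (G\<lparr>carrier := D i\<rparr>) (subtopology T (D i)) \<subseteq> D (Suc i)"
proof -
  interpret N: normal N G by fact
  define Q and U where "Q = G Mod N" and "U = coset_topology G T N"
  define \<pi> where "\<pi> = (\<lambda>x. N #> x)"
  define S where "S = abelian_simple_series Q U"
  have Ddef: "D i = {x \<in> carrier G. \<pi> x \<in> S i}" for i by (simp add: D_def S_def Q_def U_def \<pi>_def)
  have Q: "group Q" unfolding Q_def by (rule N.factorgroup_is_group)
  interpret Q: group Q by fact
  have \<pi>h: "\<pi> \<in> hom G Q" unfolding \<pi>_def Q_def by (rule N.r_coset_hom_Mod)
  have \<pi>s: "\<pi> ` carrier G = carrier Q" by (simp add: \<pi>_def Q_def carrier_FactGroup)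
  interpret \<pi>: group_hom G Q \<pi> using \<pi>h Q by (simp add: group_hom_def group_hom_axioms_def)
  have U: "topspace U = carrier Q" and quo: "quotient_map T U \<pi>"
    using \<pi>s unfolding U_def coset_topology_def
    by (simp_all add: topspace_quotient_topology quotient_map_quotient_topology topspace_eq flip: \<pi>_def)
  have \<pi>c: "continuous_map T U \<pi>" using quo by (rule quotient_imp_continuous_map)
  \<comment> \<open>Continuity of conjugation in the quotient is inherited from the group through
    the quotient map.\<close>
  have conj: "continuous_map U U (\<lambda>q. g \<otimes>\<^bsub>Q\<^esub> q \<otimes>\<^bsub>Q\<^esub> inv\<^bsub>Q\<^esub> g)" if g: "g \<in> carrier Q" for g
  proof (rule continuous_compose_quotient_map[OF quo])
    obtain x where x: "x \<in> carrier G" "g = \<pi> x" using g \<pi>s by blast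
    have "continuous_map T U (\<pi> \<circ> (\<lambda>y. x \<otimes> y \<otimes> inv x))"
      by (rule continuous_map_compose[OF continuous_map_conj[OF x(1)] \<pi>c])
    then show "continuous_map T U ((\<lambda>q. g \<otimes>\<^bsub>Q\<^esub> q \<otimes>\<^bsub>Q\<^esub> inv\<^bsub>Q\<^esub> g) \<circ> \<pi>)"
      by (rule continuous_map_eq) (use x in \<open>simp add: topspace_eq\<close>)
  qed
  have S: "S i \<lhd> Q" for i
  proof (induction i)
    case 0
    show ?case by (simp add: S_def Q.normal_self)
  next
    case (Suc i)
    then show ?case using Q.normal_abelian_simple_core[OF _ U conj] by (simp add: S_def)
  qed
  have SQ: "S i \<subseteq> carrier Q" for i using S normal_imp_subgroup subgroup.subset by blast
  have topS: "topspace (subtopology U (S i)) = carrier (Q\<lparr>carrier := S i\<rparr>)" for i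
    using SQ by (auto simp: U)
  have S_Suc: "S (Suc i) = abelian_simple_core (Q\<lparr>carrier := S i\<rparr>) (subtopology U (S i))" for i
    by (simp add: S_def)
  have Sdec: "S (Suc i) \<subseteq> S i" for i
    unfolding S_Suc
    using group.abelian_simple_core_subset[OF Q.subgroup_imp_group[OF normal_imp_subgroup[OF S]] topS]
    by simp
  have sub: "subgroup {x \<in> carrier G. \<pi> x \<in> H} G" if "subgroup H Q" for H
  proof (rule subgroupI)
    interpret H: subgroup H Q by (rule that)
    have "\<one> \<in> {x \<in> carrier G. \<pi> x \<in> H}" by simp
    then show "{x \<in> carrier G. \<pi> x \<in> H} \<noteq> {}" by blast
  qed (use that in \<open>auto simp: subgroup.m_closed subgroup.m_inv_closed\<close>)
  show D: "D i \<lhd> G" for i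
  proof (rule normal_invI)
    show "subgroup (D i) G" unfolding Ddef by (rule sub[OF normal_imp_subgroup[OF S]])
    show "x \<otimes> h \<otimes> inv x \<in> D i" if "x \<in> carrier G" "h \<in> D i" for x h
      using that normal.inv_op_closed2[OF S] by (simp add: Ddef)
  qed
  show dec: "D (Suc i) \<subseteq> D i" for i unfolding Ddef using Sdec by blast
  have Dsub: "subgroup (D i) G" for i using D by (rule normal_imp_subgroup)
  have \<pi>i: "group_hom (G\<lparr>carrier := D i\<rparr>) (Q\<lparr>carrier := S i\<rparr>) \<pi>" for i
    using subgroup_imp_group[OF Dsub] Q.subgroup_imp_group[OF normal_imp_subgroup[OF S]]
    by (auto simp: group_hom_def group_hom_axioms_def hom_def Ddef)
  have \<pi>is: "\<pi> ` carrier (G\<lparr>carrier := D i\<rparr>) = carrier (Q\<lparr>carrier := S i\<rparr>)" for i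
  proof -
    have "S i \<subseteq> \<pi> ` D i"
    proof
      fix q assume q: "q \<in> S i"
      then have "q \<in> \<pi> ` carrier G" using SQ \<pi>s by blast
      then show "q \<in> \<pi> ` D i" using q unfolding Ddef by blast
    qed
    then show ?thesis by (auto simp: Ddef)
  qed
  have \<pi>ic: "continuous_map (subtopology T (D i)) (subtopology U (S i)) \<pi>" for i
    using \<pi>c by (auto simp: continuous_map_in_subtopology continuous_map_from_subtopology Ddef)
  have topD: "topspace (subtopology T (D i)) = carrier (G\<lparr>carrier := D i\<rparr>)" for i
    by (auto simp: topspace_eq Ddef)
  show "abelian_simple_core (G\<lparr>carrier := D i\<rparr>) (subtopology T (D i)) \<subseteq> D (Suc i)" for i
  proof
    fix x assume x: "x \<in> abelian_simple_core (G\<lparr>carrier := D i\<rparr>) (subtopology T (D i))"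
    have "x \<in> D i"
      using x group.abelian_simple_core_subset[OF subgroup_imp_group[OF Dsub] topD] by auto
    moreover have "\<pi> x \<in> S (Suc i)"
      unfolding S_Suc by (rule abelian_simple_core_hom[OF \<pi>i \<pi>is \<pi>ic topD x])
    ultimately show "x \<in> D (Suc i)" by (simp add: Ddef)
  qed
  show "closedin T (D i)" for i
  proof (induction i)
    case 0
    have "D 0 = topspace T" using \<pi>.hom_closed by (auto simp: Ddef S_def topspace_eq)
    then show ?case by simp
  next
    case (Suc i)
    interpret Di: topological_group "G\<lparr>carrier := D i\<rparr>" "subtopology T (D i)"
      by (rule subgroup_topological[OF Dsub])
    let ?\<N> = "{N. N \<lhd> Q\<lparr>carrier := S i\<rparr> \<and> openin (subtopology U (S i)) N \<and>
      (comm_group (Q\<lparr>carrier := S i\<rparr> Mod N) \<or> simple_group (Q\<lparr>carrier := S i\<rparr> Mod N))}"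
    let ?P = "\<lambda>N. {x \<in> D i. \<pi> x \<in> N}"
    have "closedin (subtopology T (D i)) (?P N)" if N: "N \<in> ?\<N>" for N
    proof (rule Di.closedin_open_subgroup)
      have NS: "subgroup N Q"
        using N Q.incl_subgroup[OF normal_imp_subgroup[OF S]] normal_imp_subgroup by blast
      have "N \<subseteq> S i" using N openin_subset[of "subtopology U (S i)" N] by auto
      then have P: "?P N = {x \<in> carrier G. \<pi> x \<in> N}" by (auto simp: Ddef)
      have "?P N \<subseteq> D i" by blast
      then show "subgroup (?P N) (G\<lparr>carrier := D i\<rparr>)"
        unfolding P by (rule subgroup_incl[OF sub[OF NS] Dsub])
      have "openin (subtopology T (D i)) {x \<in> topspace (subtopology T (D i)). \<pi> x \<in> N}"
        using N by (intro openin_continuous_map_preimage[OF \<pi>ic]) blast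
      then show "openin (subtopology T (D i)) (?P N)" unfolding topD by simp
    qed
    \<comment> \<open>Inserting the whole space keeps the family nonempty and makes its intersection
      a subset of \<open>D i\<close>.\<close>
    then have "closedin (subtopology T (D i)) (\<Inter> (insert (topspace (subtopology T (D i))) (?P ` ?\<N>)))"
      using closedin_topspace[of "subtopology T (D i)"] by (intro closedin_Inter) blast+
    moreover have "\<Inter> (insert (topspace (subtopology T (D i))) (?P ` ?\<N>)) = D (Suc i)"
    proof -
      have "D (Suc i) = {x \<in> D i. \<pi> x \<in> S (Suc i)}" using dec[of i] unfolding Ddef by blast
      also have "\<dots> = {x \<in> D i. \<forall>N\<in>?\<N>. \<pi> x \<in> N}"
        unfolding S_Suc abelian_simple_core_def by blast
      also have "\<dots> = \<Inter> (insert (D i) (?P ` ?\<N>))" by blast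
      finally show ?thesis using topD by simp
    qed
    ultimately show ?case using closedin_trans_full Suc by metis
  qed
qed

theorem theorem5p7:
  fixes F :: "'a monoid" and T :: "'a topology" and M N :: "'a set"
  assumes "free_profinite_omega F T"
    and "subgroup M F" and "closedin T M"
    and "N \<lhd> F" and "closedin T N"
    and "N \<subseteq> M"
    and "abelian_simple_length (F Mod N) (coset_topology F T N) < \<infinity>"
  shows "top_isomorphic (F\<lparr>carrier := M\<rparr>) (subtopology T M) F T"
proof -
  interpret F: profinite_group F T using assms(1) by (simp add: free_profinite_omega_def)
  interpret N: normal N F by fact
  obtain X where "countable X" "topologically_generates F T X" "converges_to_one F T X (\<lambda>x. x)"
    using assms(1) by (auto simp: free_profinite_omega_def countable_profinite_basis_def)
  then obtain U where U: "countable_normal_base F T U"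
    using F.countable_open_normal F.countable_normal_base_exists by blast
  obtain l where l: "abelian_simple_series (F Mod N) (coset_topology F T N) l = {\<one>\<^bsub>F Mod N\<^esub>}"
    using assms(7) unfolding abelian_simple_length_finite_iff by blast
  define D where
    "D = (\<lambda>i. {x \<in> carrier F. N #>\<^bsub>F\<^esub> x \<in> abelian_simple_series (F Mod N) (coset_topology F T N) i})"
  have D: "D i \<lhd> F" "closedin T (D i)" "D (Suc i) \<subseteq> D i"
    "abelian_simple_core (F\<lparr>carrier := D i\<rparr>) (subtopology T (D i)) \<subseteq> D (Suc i)" for i
    unfolding D_def by (rule F.abelian_simple_series_preimage[OF assms(4)])+
  have D0: "D 0 = carrier F" by (auto simp: D_def carrier_FactGroup)
  \<comment> \<open>The series ends in the unit coset, whose preimage is \<open>N\<close>.\<close>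
  have "D l = N"
    using F.coset_join1[OF _ _ N.subgroup_axioms] F.coset_join2[OF _ N.subgroup_axioms] N.subset
    by (auto simp: D_def l)
  have EPF: "embedding_property F T" by (rule free_embedding_property[OF assms(1)])
  \<comment> \<open>Since \<open>N\<close> lies in \<open>M\<close>, the chain of products
    \<open>M D i\<close> ends at \<open>M\<close> itself.\<close>
  have "M <#>\<^bsub>F\<^esub> N = M"
    using F.set_mult_subgroup_idem[OF assms(2) F.subgroup_incl[OF N.subgroup_axioms assms(2,6)]] .
  then have EPM: "embedding_property (F\<lparr>carrier := M\<rparr>) (subtopology T M)"
    using F.embedding_property_chain[OF EPF assms(2,3) D(1,2) D0 D(3,4), of l] \<open>D l = N\<close> by simp
  show ?thesis
    by (rule embedding_property_imp_isomorphic[OF F.closed_subgroup_profinite[OF assms(2,3)]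
          F.profinite_group_axioms EPM EPF F.countable_normal_base_subgroup[OF U assms(2)] U])
qed

end
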